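(* Let $(R,\mathfrak m)$ be a Noetherian local ring of characteristic $p>0$ whose residue field $k=R/\mathfrak m$ is perfect. Let $x$ be a regular element of $R$ such that $\operatorname{Coker}\bigl(H^i_{\mathfrak m}(R)\xrightarrow{x}H^i_{\mathfrak m}(R)\bigr)$ has finite length for every $i$. If $R/(x)$ is $F$-injective, then the map $x^{p-1}F: H^i_{\mathfrak m}(R)\to H^i_{\mathfrak m}(R)$ is injective for every $i$; in particular, $R$ is $F$-injective.
   Context: A regular element of $R$ is a nonzerodivisor of $R$ contained in $\mathfrak m$. For a Noetherian local ring $(S,\mathfrak n)$ of characteristic $p$, the Frobenius endomorphism $r\mapsto r^p$ induces a natural Frobenius action $F:H^i_{\mathfrak n}(S)\to H^i_{\mathfrak n}(S)$ (an additive map with $F(ru)=r^pF(u)$ for $r\in S$) on each local cohomology module. $S$ is $F$-injective if this $F$ is injective for every $i\ge 0$. The map $x^{p-1}F$ sends $u$ to $x^{p-1}\cdot F(u)$. *)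

theory Defs
  imports
    "HOL-Computational_Algebra.Primes"
    "HOL-Algebra.QuotRing"
    "HOL-Algebra.Module"
    "HOL-Algebra.Ring_Divisibility"
begin

locale noetherian_local_ring = cring R + noetherian_ring R for R (structure) +
  assumes unique_maximal: "\<exists>!M. maximalideal M R"

definition maximal_ideal :: "('a, 'b) ring_scheme \<Rightarrow> 'a set" where
  "maximal_ideal R = (THE M. maximalideal M R)"

definition ring_char :: "('a, 'b) ring_scheme \<Rightarrow> nat" where
  "ring_char R = Gcd {n. [n] \<cdot>\<^bsub>R\<^esub> \<one>\<^bsub>R\<^esub> = \<zero>\<^bsub>R\<^esub>}"

text \<open>A field is perfect if it has characteristic 0, or characteristic \<open>p > 0\<close> and every
  element is a \<open>p\<close>-th power.\<close>

definition perfect_field :: "('a, 'b) ring_scheme \<Rightarrow> bool" where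
  "perfect_field K \<longleftrightarrow> field K \<and>
     (ring_char K = 0 \<or> (\<forall>a\<in>carrier K. \<exists>b\<in>carrier K. b [^]\<^bsub>K\<^esub> ring_char K = a))"

definition regular_element :: "('a, 'b) ring_scheme \<Rightarrow> 'a \<Rightarrow> bool" where
  "regular_element R x \<longleftrightarrow> x \<in> maximal_ideal R \<and>
     (\<forall>a\<in>carrier R. x \<otimes>\<^bsub>R\<^esub> a = \<zero>\<^bsub>R\<^esub> \<longrightarrow> a = \<zero>\<^bsub>R\<^esub>)"

text \<open>The type of modules extends the type of rings. Of a quotient module only the
  additive group and the scalar multiplication are meaningful, so the multiplicative
  fields are left unspecified.\<close>

definition quot_module ::
    "('a, 'b, 'c) module_scheme \<Rightarrow> 'b set \<Rightarrow> ('a, 'b set) module" where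
  "quot_module M N =
     \<lparr> carrier = a_rcosets\<^bsub>M\<^esub> N, monoid.mult = undefined, monoid.one = undefined,
       ring.zero = N, add = set_add M,
       smult = (\<lambda>a U. \<Union>u\<in>U. N +>\<^bsub>M\<^esub> (a \<odot>\<^bsub>M\<^esub> u)) \<rparr>"

definition coker_mult :: "('a, 'b, 'c) module_scheme \<Rightarrow> 'a \<Rightarrow> ('a, 'b set) module" where
  "coker_mult M x = quot_module M ((\<lambda>u. x \<odot>\<^bsub>M\<^esub> u) ` carrier M)"

text \<open>Finite length means that there is a composition series; the last clause says that
  the successive quotients are simple.\<close>

definition finite_length ::
    "('a, 'b) ring_scheme \<Rightarrow> ('a, 'c, 'd) module_scheme \<Rightarrow> bool" where
  "finite_length R M \<longleftrightarrow> (\<exists>(n::nat) N.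
     N 0 = {\<zero>\<^bsub>M\<^esub>} \<and> N n = carrier M \<and>
     (\<forall>i\<le>n. submodule (N i) R M) \<and>
     (\<forall>i<n. N i \<subset> N (Suc i) \<and>
        \<not> (\<exists>L. submodule L R M \<and> N i \<subset> L \<and> L \<subset> N (Suc i))))"

text \<open>Fractions \<open>r/s\<close> with \<open>s\<close> in a multiplicatively closed set \<open>W\<close> containing one.\<close>

definition frac_rel :: "('a, 'b) ring_scheme \<Rightarrow> 'a set \<Rightarrow> (('a \<times> 'a) \<times> ('a \<times> 'a)) set" where
  "frac_rel R W = {((r, s), (r', s')). r \<in> carrier R \<and> s \<in> W \<and> r' \<in> carrier R \<and> s' \<in> W \<and>
     (\<exists>t\<in>W. t \<otimes>\<^bsub>R\<^esub> (s' \<otimes>\<^bsub>R\<^esub> r) = t \<otimes>\<^bsub>R\<^esub> (s \<otimes>\<^bsub>R\<^esub> r'))}"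

definition loc_frac :: "('a, 'b) ring_scheme \<Rightarrow> 'a set \<Rightarrow> 'a \<Rightarrow> 'a \<Rightarrow> ('a \<times> 'a) set" where
  "loc_frac R W r s = frac_rel R W `` {(r, s)}"

definition localization :: "('a, 'b) ring_scheme \<Rightarrow> 'a set \<Rightarrow> ('a \<times> 'a) set ring" where
  "localization R W =
     \<lparr> carrier = (carrier R \<times> W) // frac_rel R W,
       monoid.mult = (\<lambda>U V. \<Union>(r, s)\<in>U. \<Union>(r', s')\<in>V. loc_frac R W (r \<otimes>\<^bsub>R\<^esub> r') (s \<otimes>\<^bsub>R\<^esub> s')),
       monoid.one = loc_frac R W \<one>\<^bsub>R\<^esub> \<one>\<^bsub>R\<^esub>,
       ring.zero = loc_frac R W \<zero>\<^bsub>R\<^esub> \<one>\<^bsub>R\<^esub>,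
       add = (\<lambda>U V. \<Union>(r, s)\<in>U. \<Union>(r', s')\<in>V.
          loc_frac R W ((r \<otimes>\<^bsub>R\<^esub> s') \<oplus>\<^bsub>R\<^esub> (r' \<otimes>\<^bsub>R\<^esub> s)) (s \<otimes>\<^bsub>R\<^esub> s')) \<rparr>"

text \<open>The canonical map into the localization at a larger multiplicative set \<open>W\<close>.\<close>

definition loc_map :: "('a, 'b) ring_scheme \<Rightarrow> 'a set \<Rightarrow> ('a \<times> 'a) set \<Rightarrow> ('a \<times> 'a) set" where
  "loc_map R W U = (\<Union>(r, s)\<in>U. loc_frac R W r s)"

definition cech_index :: "'a list \<Rightarrow> nat \<Rightarrow> nat set set" where
  "cech_index xs i = {J. J \<subseteq> {..<length xs} \<and> card J = i}"

text \<open>The monomials in the \<open>x\<^sub>j\<close> with \<open>j \<in> J\<close>. Localizing at this set is the same as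
  inverting the single element \<open>\<Prod>j\<in>J. x\<^sub>j\<close>.\<close>

definition cech_denoms :: "('a, 'b) ring_scheme \<Rightarrow> 'a list \<Rightarrow> nat set \<Rightarrow> 'a set" where
  "cech_denoms R xs J = range (\<lambda>e :: nat \<Rightarrow> nat. \<Otimes>\<^bsub>R\<^esub>j\<in>J. (xs ! j) [^]\<^bsub>R\<^esub> e j)"

definition cech_loc :: "('a, 'b) ring_scheme \<Rightarrow> 'a list \<Rightarrow> nat set \<Rightarrow> ('a \<times> 'a) set ring" where
  "cech_loc R xs J = localization R (cech_denoms R xs J)"

text \<open>\<open>C\<^sup>i = \<Prod>\<^bsub>|J| = i\<^esub> R\<^bsub>x\<^sub>J\<^esub>\<close>, as a module over \<open>R\<close>; it also carries the componentwise
  ring structure.\<close>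

definition cech ::
    "('a, 'b) ring_scheme \<Rightarrow> 'a list \<Rightarrow> nat \<Rightarrow> ('a, nat set \<Rightarrow> ('a \<times> 'a) set) module" where
  "cech R xs i =
     \<lparr> carrier = (\<Pi>\<^sub>E J\<in>cech_index xs i. carrier (cech_loc R xs J)),
       monoid.mult = (\<lambda>c d. \<lambda>J\<in>cech_index xs i. c J \<otimes>\<^bsub>cech_loc R xs J\<^esub> d J),
       monoid.one = (\<lambda>J\<in>cech_index xs i. \<one>\<^bsub>cech_loc R xs J\<^esub>),
       ring.zero = (\<lambda>J\<in>cech_index xs i. \<zero>\<^bsub>cech_loc R xs J\<^esub>),
       add = (\<lambda>c d. \<lambda>J\<in>cech_index xs i. c J \<oplus>\<^bsub>cech_loc R xs J\<^esub> d J),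
       smult = (\<lambda>a c. \<lambda>J\<in>cech_index xs i.
          loc_frac R (cech_denoms R xs J) a \<one>\<^bsub>R\<^esub> \<otimes>\<^bsub>cech_loc R xs J\<^esub> c J) \<rparr>"

definition cech_diff ::
    "('a, 'b) ring_scheme \<Rightarrow> 'a list \<Rightarrow> nat \<Rightarrow> (nat set \<Rightarrow> ('a \<times> 'a) set)
      \<Rightarrow> (nat set \<Rightarrow> ('a \<times> 'a) set)" where
  "cech_diff R xs i c =
     (\<lambda>J\<in>cech_index xs (Suc i). \<Oplus>\<^bsub>cech_loc R xs J\<^esub>j\<in>J.
        (let y = loc_map R (cech_denoms R xs J) (c (J - {j})) in
         if even (card {k \<in> J. k < j}) then y else \<ominus>\<^bsub>cech_loc R xs J\<^esub> y))"

definition cech_cocycles ::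
    "('a, 'b) ring_scheme \<Rightarrow> 'a list \<Rightarrow> nat \<Rightarrow> (nat set \<Rightarrow> ('a \<times> 'a) set) set" where
  "cech_cocycles R xs i =
     {c \<in> carrier (cech R xs i). cech_diff R xs i c = \<zero>\<^bsub>cech R xs (Suc i)\<^esub>}"

fun cech_coboundaries ::
    "('a, 'b) ring_scheme \<Rightarrow> 'a list \<Rightarrow> nat \<Rightarrow> (nat set \<Rightarrow> ('a \<times> 'a) set) set" where
  "cech_coboundaries R xs 0 = {\<zero>\<^bsub>cech R xs 0\<^esub>}"
| "cech_coboundaries R xs (Suc i) = cech_diff R xs i ` carrier (cech R xs i)"

definition cech_cohomology ::
    "('a, 'b) ring_scheme \<Rightarrow> 'a list \<Rightarrow> nat \<Rightarrow> ('a, (nat set \<Rightarrow> ('a \<times> 'a) set) set) module" where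
  "cech_cohomology R xs i =
     quot_module ((cech R xs i) \<lparr>carrier := cech_cocycles R xs i\<rparr>) (cech_coboundaries R xs i)"

text \<open>In characteristic \<open>p\<close> the \<open>p\<close>-th power maps of the localizations commute with the
  differentials; this is the action they induce on cohomology.\<close>

definition cech_frobenius ::
    "nat \<Rightarrow> ('a, 'b) ring_scheme \<Rightarrow> 'a list \<Rightarrow> nat \<Rightarrow> (nat set \<Rightarrow> ('a \<times> 'a) set) set
      \<Rightarrow> (nat set \<Rightarrow> ('a \<times> 'a) set) set" where
  "cech_frobenius p R xs i U =
     (\<Union>c\<in>U. cech_coboundaries R xs i +>\<^bsub>cech R xs i\<^esub> (c [^]\<^bsub>cech R xs i\<^esub> p))"

text \<open>Over a Noetherian ring, local cohomology with support in \<open>I\<close>, together with its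
  Frobenius action, is the cohomology of the Cech complex on any finite sequence of generators
  of \<open>I\<close>; different sequences give canonically isomorphic modules. An arbitrary but fixed
  sequence is chosen here.\<close>

definition ideal_gens :: "('a, 'b) ring_scheme \<Rightarrow> 'a set \<Rightarrow> 'a list" where
  "ideal_gens R I = (SOME xs. set xs \<subseteq> carrier R \<and> Idl\<^bsub>R\<^esub> (set xs) = I)"

definition local_cohomology ::
    "('a, 'b) ring_scheme \<Rightarrow> 'a set \<Rightarrow> nat \<Rightarrow> ('a, (nat set \<Rightarrow> ('a \<times> 'a) set) set) module" where
  "local_cohomology R I i = cech_cohomology R (ideal_gens R I) i"

definition lc_frobenius ::
    "nat \<Rightarrow> ('a, 'b) ring_scheme \<Rightarrow> 'a set \<Rightarrow> nat \<Rightarrow> (nat set \<Rightarrow> ('a \<times> 'a) set) set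
      \<Rightarrow> (nat set \<Rightarrow> ('a \<times> 'a) set) set" where
  "lc_frobenius p R I i = cech_frobenius p R (ideal_gens R I) i"

text \<open>Here \<open>S\<close> is meant to be a Noetherian local ring of prime characteristic.\<close>

definition F_injective :: "('a, 'b) ring_scheme \<Rightarrow> bool" where
  "F_injective S \<longleftrightarrow> (\<forall>i. inj_on (lc_frobenius (ring_char S) S (maximal_ideal S) i)
     (carrier (local_cohomology S (maximal_ideal S) i)))"

end

theory Submission
  imports Defs "HOL-Algebra.Multiplicative_Group"
begin

text \<open>Multiplication by \<open>x\<close> gives a short exact sequence \<open>0 \<rightarrow> R \<rightarrow> R \<rightarrow> R/x \<rightarrow> 0\<close>, on which the Frobenius
map of \<open>R/x\<close> lifts to \<open>F\<close> on the second copy of \<open>R\<close> and to \<open>x\<^bsup>p-1\<^esup>F\<close> on the first. Hence the connecting map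
\<open>\<delta> : H\<^bsup>i-1\<^esup>(R/x) \<rightarrow> H\<^sup>i(R)\<close> satisfies \<open>\<delta> F = x\<^bsup>p-1\<^esup>F \<delta>\<close>, and its kernel is the image \<open>L\<close> of
\<open>H\<^bsup>i-1\<^esup>(R)\<close>, which is isomorphic to the cokernel of \<open>x\<close> on \<open>H\<^bsup>i-1\<^esup>(R)\<close> and so has finite length.
Suppose that \<open>x\<^bsup>p-1\<^esup>F u = 0\<close>. A power of \<open>x\<close> kills \<open>u\<close>, because \<open>x\<close> lies in the maximal ideal, and
\<open>x\<^bsup>p-1\<^esup>F\<close> also kills every multiple of \<open>u\<close>; so it is enough to treat the case \<open>x u = 0\<close>. Then \<open>u = \<delta> v\<close>,
and \<open>\<delta> (F v) = 0\<close> shows that \<open>F v \<in> L\<close>. The map \<open>F\<close> is injective on \<open>L\<close> since \<open>R/x\<close> is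
\<open>F\<close>-injective, and an injective Frobenius-linear map of a module of finite length over a local ring with perfect
residue field is surjective. So \<open>F v = F w\<close> with \<open>w \<in> L\<close>, injectivity of \<open>F\<close> on
\<open>H\<^bsup>i-1\<^esup>(R/x)\<close> gives \<open>v = w \<in> L\<close>, and \<open>u = \<delta> v = 0\<close>.

The homological algebra is done with elements of the ring itself. A Cech cochain is finite, so its components have
a common denominator: it is given by numerators \<open>r\<^sub>J\<close> and a level \<open>n\<close>, standing for the
fractions \<open>r\<^sub>J / (\<Prod>j\<in>J. x\<^sub>j)\<^sup>n\<close>. In terms of numerators the Cech differential is the differential
\<open>kdiff n\<close> of the Koszul cochain complex of the powers \<open>x\<^sub>j\<^sup>n\<close>. Every Cech cocycle comes from an honest Koszul
cocycle of a large enough level, and its class vanishes exactly when, after a further raise of the level, it becomes a Koszul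
boundary (\<open>ev_bdry\<close>). That the connecting map is compatible with Frobenius then is a computation with numerators,
\<open>connecting_step_aligned\<close>; the finite length hypothesis enters through \<open>frobenius_linear_surjective\<close>.

The local cohomology of \<open>R/x\<close> is computed from some generators of its maximal ideal, not from the images of the
generators chosen for \<open>R\<close>. Injectivity of Frobenius does not depend on this choice
(\<open>frob_inj_change_generators\<close>): adding a generator \<open>y\<close> that already lies in the ideal of the others changes
the Cech complex by a localization at \<open>y\<close> of the Cech complex of the others. That complex is acyclic, because each of
the others acts as zero on the Koszul cohomology up to a power (\<open>contracting_homotopy\<close>), hence so does a power of
\<open>y\<close>, which is invertible there.\<close>

section \<open>The Frobenius endomorphism of a commutative ring\<close>

lemma (in cring) binomial_expansion:
  assumes "a \<in> carrier R" "b \<in> carrier R"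
  shows "(a \<oplus> b) [^] (n::nat) = (\<Oplus>k\<in>{..n}. [(n choose k)] \<cdot> (a [^] k \<otimes> b [^] (n - k)))"
proof (induction n)
  case 0
  then show ?case using assms by simp
next
  case (Suc n)
  let ?t = "\<lambda>n k. [(n choose k)] \<cdot> (a [^] k \<otimes> b [^] (n - k))"
  have t_closed: "?t m k \<in> carrier R" for m k using assms by simp
  have A: "(\<Oplus>k\<in>{..n}. ?t n k) \<otimes> a = (\<Oplus>k\<in>{..n}. [(n choose k)] \<cdot> (a [^] Suc k \<otimes> b [^] (n - k)))"
    using assms
    by (subst finsum_ldistr) (auto intro!: finsum_cong' simp: add_pow_ldistr add_pow_rdistr m_ac)
  have "(\<Oplus>k\<in>{..n}. ?t n k) \<otimes> b = (\<Oplus>k\<in>{..n}. [(n choose k)] \<cdot> (a [^] k \<otimes> b [^] (Suc n - k)))"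
    using assms
    by (subst finsum_ldistr) (auto intro!: finsum_cong' simp: add_pow_ldistr add_pow_rdistr m_assoc Suc_diff_le)
  also have "\<dots> = (\<Oplus>k\<in>{..Suc n}. [(n choose k)] \<cdot> (a [^] k \<otimes> b [^] (Suc n - k)))"
    using assms by (subst finsum_Suc) (auto simp: binomial_eq_0)
  also have "\<dots> = (\<Oplus>k\<in>{..n}. [(n choose Suc k)] \<cdot> (a [^] Suc k \<otimes> b [^] (n - k))) \<oplus> ?t (Suc n) 0"
    using assms by (subst finsum_Suc2) auto
  finally have B: "(\<Oplus>k\<in>{..n}. ?t n k) \<otimes> b = \<dots>" .
  have "(a \<oplus> b) [^] Suc n = (\<Oplus>k\<in>{..n}. ?t n k) \<otimes> a \<oplus> (\<Oplus>k\<in>{..n}. ?t n k) \<otimes> b"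
    using assms Suc.IH by (simp add: r_distr)
  also have "\<dots> = ((\<Oplus>k\<in>{..n}. [(n choose k)] \<cdot> (a [^] Suc k \<otimes> b [^] (n - k)))
      \<oplus> (\<Oplus>k\<in>{..n}. [(n choose Suc k)] \<cdot> (a [^] Suc k \<otimes> b [^] (n - k)))) \<oplus> ?t (Suc n) 0"
    unfolding A B using assms by (intro a_assoc[symmetric]) auto
  also have "\<dots> = (\<Oplus>k\<in>{..n}. ?t (Suc n) (Suc k)) \<oplus> ?t (Suc n) 0"
    using assms by (subst finsum_addf[symmetric])
      (auto intro!: arg_cong2[where f="(\<oplus>)"] finsum_cong' simp: add.nat_pow_mult)
  also have "\<dots> = (\<Oplus>k\<in>{..Suc n}. ?t (Suc n) k)"
    by (rule finsum_Suc2[symmetric]) (use t_closed in auto)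
  finally show ?case .
qed

locale char_p_ring = cring R for R (structure) +
  fixes p :: nat
  assumes p_prime: "Factorial_Ring.prime p" and p_one: "[p] \<cdot> \<one> = \<zero>"
begin

lemma multiple_of_p:
  assumes "p dvd m" "a \<in> carrier R"
  shows "[m] \<cdot> a = \<zero>"
proof -
  obtain k where k: "m = p * k" using assms by auto
  have "[m] \<cdot> a = ([p] \<cdot> \<one>) \<otimes> ([k] \<cdot> a)"
    using assms by (simp add: k add_pow_ldistr add.nat_pow_pow mult.commute)
  then show ?thesis using assms p_one by simp
qed

text \<open>The binomial coefficients strictly between the two ends are divisible by \<open>p\<close>.\<close>

lemma frobenius_add:
  assumes "a \<in> carrier R" "b \<in> carrier R"
  shows "(a \<oplus> b) [^] p = a [^] p \<oplus> b [^] p"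
proof -
  obtain q where q: "p = Suc (Suc q)"
    using prime_ge_2_nat[OF p_prime] by (metis add_2_eq_Suc le_Suc_ex)
  have z: "[(p choose Suc k)] \<cdot> (a [^] Suc k \<otimes> b [^] (p - Suc k)) = \<zero>" if "k \<le> q" for k
    using assms that by (intro multiple_of_p dvd_choose_prime) (use p_prime in \<open>auto simp: q\<close>)
  have "(a \<oplus> b) [^] p = (\<Oplus>k\<in>{..p}. [(p choose k)] \<cdot> (a [^] k \<otimes> b [^] (p - k)))"
    using assms by (rule binomial_expansion)
  also have "\<dots> = a [^] p \<oplus> (\<Oplus>k\<in>{..Suc q}. [(p choose k)] \<cdot> (a [^] k \<otimes> b [^] (p - k)))"
    unfolding q using assms by (subst finsum_Suc) auto
  also have "(\<Oplus>k\<in>{..Suc q}. [(p choose k)] \<cdot> (a [^] k \<otimes> b [^] (p - k))) =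
      (\<Oplus>k\<in>{..q}. [(p choose Suc k)] \<cdot> (a [^] Suc k \<otimes> b [^] (p - Suc k))) \<oplus> b [^] p"
    using assms by (subst finsum_Suc2) auto
  also have "(\<Oplus>k\<in>{..q}. [(p choose Suc k)] \<cdot> (a [^] Suc k \<otimes> b [^] (p - Suc k))) = \<zero>"
    using z by (intro add.finprod_one_eqI) auto
  finally show ?thesis using assms by simp
qed

lemma frobenius_zero [simp]: "\<zero> [^] p = \<zero>"
  using prime_gt_0_nat[OF p_prime] by (simp add: nat_pow_zero)

lemma frobenius_minus:
  assumes "a \<in> carrier R"
  shows "(\<ominus> a) [^] p = \<ominus> (a [^] p)"
proof -
  have "(\<ominus> a) [^] p \<oplus> a [^] p = \<zero>"
    using assms frobenius_add[of "\<ominus> a" a] by (simp add: l_neg)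
  then show ?thesis using assms by (intro minus_equality[symmetric]) auto
qed

lemma frobenius_diff:
  assumes "a \<in> carrier R" "b \<in> carrier R"
  shows "(a \<ominus> b) [^] p = a [^] p \<ominus> b [^] p"
  using assms by (simp add: minus_eq frobenius_add frobenius_minus)

lemma frobenius_finsum:
  assumes "finite A" "\<And>j. j \<in> A \<Longrightarrow> g j \<in> carrier R"
  shows "(\<Oplus>j\<in>A. g j) [^] p = (\<Oplus>j\<in>A. g j [^] p)"
  using assms
proof (induction A)
  case (insert j A)
  then show ?case by (simp add: frobenius_add Pi_iff)
qed simp

lemma iterated_frobenius_add:
  assumes "a \<in> carrier R" "b \<in> carrier R"
  shows "(a \<oplus> b) [^] (p ^ e) = a [^] (p ^ e) \<oplus> b [^] (p ^ e)"
proof (induction e)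
  case (Suc e)
  have "(a \<oplus> b) [^] (p ^ Suc e) = ((a \<oplus> b) [^] (p ^ e)) [^] p"
    using assms by (simp add: nat_pow_pow mult.commute)
  then show ?case using assms by (simp add: Suc frobenius_add nat_pow_pow mult.commute)
qed (use assms in simp)

end

section \<open>Cochains with a common denominator\<close>

text \<open>The faces of dimension \<open>i - 1\<close> of the full simplex on \<open>A\<close>. The vertex set is a parameter, and not an
initial segment of the naturals, so that vertices can be added and removed without renumbering; signs depend only on the order
of the vertices within a face.\<close>

definition faces :: "nat set \<Rightarrow> nat \<Rightarrow> nat set set" where
  "faces A i = {J. J \<subseteq> A \<and> card J = i}"

lemma faces_mono: "A \<subseteq> B \<Longrightarrow> faces A i \<subseteq> faces B i"
  by (auto simp: faces_def)

lemma finite_faces: "J \<in> faces A i \<Longrightarrow> finite A \<Longrightarrow> finite J"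
  by (auto simp: faces_def intro: finite_subset)

lemma faces_remove: "J \<in> faces A (Suc i) \<Longrightarrow> j \<in> J \<Longrightarrow> J - {j} \<in> faces A i"
  by (auto simp: faces_def)

lemma faces_insert: "J \<in> faces A i \<Longrightarrow> finite A \<Longrightarrow> j \<in> A \<Longrightarrow> j \<notin> J \<Longrightarrow> insert j J \<in> faces A (Suc i)"
  by (auto simp: faces_def dest: finite_subset)

locale koszul = cring R for R (structure) +
  fixes f :: "nat \<Rightarrow> 'a"
  assumes f_closed [simp, intro]: "f j \<in> carrier R"
begin

definition face_sign :: "nat set \<Rightarrow> nat \<Rightarrow> 'a" where
  "face_sign J j = (if even (card {k \<in> J. k < j}) then \<one> else \<ominus> \<one>)"

definition mpow :: "nat set \<Rightarrow> nat \<Rightarrow> 'a" where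
  "mpow J n = (\<Otimes>j\<in>J. f j [^] n)"

text \<open>The Koszul differential for the powers \<open>f j [^] n\<close>. It is the Cech differential on numerators: bringing
\<open>r\<^bsub>J-{j}\<^esub> / (\<Prod>k\<in>J-{j}. f k)\<^sup>n\<close> to the denominator of the face \<open>J\<close> multiplies the
numerator by \<open>f j [^] n\<close>.\<close>

definition kdiff :: "nat \<Rightarrow> (nat set \<Rightarrow> 'a) \<Rightarrow> nat set \<Rightarrow> 'a" where
  "kdiff n r J = (\<Oplus>j\<in>J. face_sign J j \<otimes> (f j [^] n \<otimes> r (J - {j})))"

text \<open>No condition is imposed outside the faces of the given dimension; numerators are total functions so that cochains can be
added and restricted without bookkeeping.\<close>

definition cocycle :: "nat set \<Rightarrow> nat \<Rightarrow> nat \<Rightarrow> (nat set \<Rightarrow> 'a) \<Rightarrow> bool" where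
  "cocycle A i n r \<longleftrightarrow> (\<forall>J\<in>faces A (Suc i). kdiff n r J = \<zero>)"

text \<open>The condition that the class of the cochain vanishes in Cech cohomology, the direct limit of the Koszul cohomologies: multiplying by
\<open>mpow J k\<close> rewrites the same fractions at level \<open>n + k\<close>. In degree 0 it says that the fraction vanishes, since
the differential is an empty sum on the empty face.\<close>

definition ev_bdry :: "nat set \<Rightarrow> nat \<Rightarrow> nat \<Rightarrow> (nat set \<Rightarrow> 'a) \<Rightarrow> bool" where
  "ev_bdry A i n r \<longleftrightarrow> (\<exists>k e. (\<forall>J. e J \<in> carrier R) \<and>
     (\<forall>J\<in>faces A i. mpow J k \<otimes> r J = kdiff (n + k) e J))"

lemma face_sign_closed [simp, intro]: "face_sign J j \<in> carrier R"
  by (simp add: face_sign_def)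

lemma face_sign_face_sign [simp]: "face_sign J j \<otimes> face_sign J j = \<one>"
  by (simp add: face_sign_def l_minus r_minus)

lemma face_sign_face_sign_left: "a \<in> carrier R \<Longrightarrow> face_sign J j \<otimes> (face_sign J j \<otimes> a) = a"
  by (simp add: m_assoc[symmetric])

lemma face_sign_remove:
  assumes "finite J" "j \<in> J" "j \<noteq> l"
  shows "face_sign (J - {j}) l = (if j < l then \<ominus> face_sign J l else face_sign J l)"
proof (cases "j < l")
  case True
  have "{k \<in> J. k < l} = insert j {k \<in> J - {j}. k < l}" using assms True by auto
  then have "card {k \<in> J. k < l} = Suc (card {k \<in> J - {j}. k < l})"
    using assms by simp
  then show ?thesis using True by (simp add: face_sign_def)
next
  case False
  then have "{k \<in> J - {j}. k < l} = {k \<in> J. k < l}" using assms by auto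
  then show ?thesis using False by (simp add: face_sign_def)
qed

text \<open>The sign rule behind the vanishing of the squared differential: deleting \<open>j\<close> first shifts the position of
\<open>l\<close> by one exactly when \<open>j < l\<close>, and precisely one of the two orders does this.\<close>

lemma face_sign_swap:
  assumes "finite J" "j \<in> J" "l \<in> J" "j \<noteq> l"
  shows "face_sign J j \<otimes> face_sign (J - {j}) l = \<ominus> (face_sign J l \<otimes> face_sign (J - {l}) j)"
  using assms by (auto simp: face_sign_remove l_minus r_minus m_comm)

lemma mpow_closed [simp, intro]: "mpow J n \<in> carrier R"
  by (simp add: mpow_def)

lemma mpow_remove:
  assumes "finite J" "j \<in> J"
  shows "mpow J n = f j [^] n \<otimes> mpow (J - {j}) n"
proof -
  have "mpow J n = mpow (insert j (J - {j})) n" using assms by (simp add: insert_absorb)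
  also have "\<dots> = f j [^] n \<otimes> mpow (J - {j}) n"
    unfolding mpow_def using assms by (subst finprod_insert) auto
  finally show ?thesis .
qed

lemma mpow_add: "finite J \<Longrightarrow> mpow J (n + m) = mpow J n \<otimes> mpow J m"
  unfolding mpow_def by (subst finprod_multf[symmetric]) (auto simp: nat_pow_mult)

lemma mpow_0 [simp]: "mpow J 0 = \<one>"
  by (simp add: mpow_def)

lemma mpow_pow: "finite J \<Longrightarrow> mpow J n [^] (m::nat) = mpow J (n * m)"
proof (induction m)
  case (Suc m)
  then show ?case by (simp add: mpow_add m_comm)
qed simp

lemma kdiff_closed [simp, intro]:
  assumes "\<And>J. r J \<in> carrier R"
  shows "kdiff n r J \<in> carrier R"
  unfolding kdiff_def using assms by (intro finsum_closed) auto

lemma kdiff_cong: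
  assumes "\<And>j. j \<in> J \<Longrightarrow> r (J - {j}) = s (J - {j})" "\<And>J. s J \<in> carrier R"
  shows "kdiff n r J = kdiff n s J"
  unfolding kdiff_def using assms by (intro finsum_cong') auto

lemma kdiff_add:
  assumes "\<And>J. r J \<in> carrier R" "\<And>J. s J \<in> carrier R"
  shows "kdiff n (\<lambda>K. r K \<oplus> s K) J = kdiff n r J \<oplus> kdiff n s J"
  unfolding kdiff_def using assms
  by (subst finsum_addf[symmetric]) (auto intro!: finsum_cong' simp: r_distr)

lemma kdiff_smult:
  assumes "a \<in> carrier R" "\<And>J. r J \<in> carrier R"
  shows "kdiff n (\<lambda>K. a \<otimes> r K) J = a \<otimes> kdiff n r J"
proof (cases "finite J")
  case True
  then show ?thesis
    unfolding kdiff_def using assms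
    by (subst finsum_rdistr) (auto intro!: finsum_cong' simp: m_lcomm)
qed (use assms in \<open>simp add: kdiff_def\<close>)

lemma kdiff_minus:
  assumes "\<And>J. r J \<in> carrier R"
  shows "kdiff n (\<lambda>K. \<ominus> r K) J = \<ominus> kdiff n r J"
proof -
  have "kdiff n (\<lambda>K. \<ominus> r K) J = kdiff n (\<lambda>K. (\<ominus> \<one>) \<otimes> r K) J"
    using assms by (intro kdiff_cong) (auto simp: l_minus)
  also have "\<dots> = \<ominus> kdiff n r J" using assms by (subst kdiff_smult) (auto simp: l_minus)
  finally show ?thesis .
qed

lemma kdiff_diff:
  assumes "\<And>J. r J \<in> carrier R" "\<And>J. s J \<in> carrier R"
  shows "kdiff n (\<lambda>K. r K \<ominus> s K) J = kdiff n r J \<ominus> kdiff n s J"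
  using assms by (simp add: minus_eq kdiff_add kdiff_minus)

text \<open>Raising the level is a map of complexes.\<close>

lemma kdiff_mpow:
  assumes "\<And>J. r J \<in> carrier R" "finite J"
  shows "kdiff (n + k) (\<lambda>K. mpow K k \<otimes> r K) J = mpow J k \<otimes> kdiff n r J"
  unfolding kdiff_def using assms
  apply (subst finsum_rdistr)
    apply (auto intro!: finsum_cong')
  apply (subst mpow_remove[of J], assumption+)
  apply (simp add: nat_pow_mult[symmetric] m_ac)
  done

lemma antisymmetric_sum:
  assumes "finite J" "\<And>j l. g j l \<in> carrier R"
    and "\<And>j l. j \<in> J \<Longrightarrow> l \<in> J \<Longrightarrow> j \<noteq> l \<Longrightarrow> g j l = \<ominus> g l j"
  shows "(\<Oplus>j\<in>J. \<Oplus>l\<in>J - {j}. g j l) = \<zero>"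
  using assms(1,3)
proof (induction J)
  case (insert a J)
  have [simp]: "insert a J - {a} = J" using insert.hyps by auto
  have I: "(\<Oplus>l\<in>insert a J - {j}. g j l) = g j a \<oplus> (\<Oplus>l\<in>J - {j}. g j l)" if "j \<in> J" for j
  proof -
    have "insert a J - {j} = insert a (J - {j})" using that insert.hyps by auto
    then show ?thesis using insert.hyps assms(2) by simp
  qed
  have "(\<Oplus>j\<in>insert a J. \<Oplus>l\<in>insert a J - {j}. g j l) =
      (\<Oplus>l\<in>J. g a l) \<oplus> (\<Oplus>j\<in>J. \<Oplus>l\<in>insert a J - {j}. g j l)"
    using insert.hyps assms(2) by simp
  also have "(\<Oplus>j\<in>J. \<Oplus>l\<in>insert a J - {j}. g j l) = (\<Oplus>j\<in>J. g j a \<oplus> (\<Oplus>l\<in>J - {j}. g j l))"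
    using I assms(2) by (intro finsum_cong') auto
  also have "\<dots> = (\<Oplus>j\<in>J. g j a) \<oplus> (\<Oplus>j\<in>J. \<Oplus>l\<in>J - {j}. g j l)"
    using assms(2) by (intro finsum_addf) auto
  also have "(\<Oplus>j\<in>J. \<Oplus>l\<in>J - {j}. g j l) = \<zero>" by (rule insert.IH) (rule insert.prems, auto)
  also have "(\<Oplus>l\<in>J. g a l) \<oplus> ((\<Oplus>j\<in>J. g j a) \<oplus> \<zero>) = (\<Oplus>l\<in>J. g a l \<oplus> g l a)"
    using assms(2) by (subst finsum_addf) auto
  also have "\<dots> = \<zero>"
  proof (intro add.finprod_one_eqI)
    fix l assume "l \<in> J"
    then have "g a l = \<ominus> g l a" using insert.hyps by (intro insert.prems) auto
    then show "g a l \<oplus> g l a = \<zero>" using assms(2) by (simp add: l_neg)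
  qed
  finally show ?case .
qed simp

lemma kdiff_kdiff:
  assumes "\<And>J. r J \<in> carrier R" "finite J"
  shows "kdiff n (kdiff n r) J = \<zero>"
proof -
  define g where "g j l = face_sign J j \<otimes> (f j [^] n \<otimes> (face_sign (J - {j}) l \<otimes> (f l [^] n \<otimes> r (J - {j} - {l}))))" for j l
  have gc: "g j l \<in> carrier R" for j l using assms by (simp add: g_def)
  have "kdiff n (kdiff n r) J = (\<Oplus>j\<in>J. \<Oplus>l\<in>J - {j}. g j l)"
    unfolding kdiff_def
  proof (intro finsum_cong')
    fix j assume j: "j \<in> J"
    show "face_sign J j \<otimes> (f j [^] n \<otimes> (\<Oplus>l\<in>J - {j}. face_sign (J - {j}) l \<otimes> (f l [^] n \<otimes> r (J - {j} - {l})))) =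
      (\<Oplus>l\<in>J - {j}. g j l)"
      unfolding g_def using assms by (simp add: finsum_rdistr Pi_iff)
  qed (use gc in auto)
  also have "\<dots> = \<zero>"
  proof (rule antisymmetric_sum)
    fix j l assume jl: "j \<in> J" "l \<in> J" "j \<noteq> l"
    have *: "J - {j} - {l} = J - {l} - {j}" by auto
    have "g j l = (face_sign J j \<otimes> face_sign (J - {j}) l) \<otimes> (f j [^] n \<otimes> (f l [^] n \<otimes> r (J - {j} - {l})))"
      using assms by (simp add: g_def m_ac)
    also have "\<dots> = \<ominus> (face_sign J l \<otimes> face_sign (J - {l}) j) \<otimes> (f j [^] n \<otimes> (f l [^] n \<otimes> r (J - {l} - {j})))"
      using face_sign_swap[OF assms(2) jl] * by simp
    also have "\<dots> = \<ominus> g l j"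
      using assms by (simp add: g_def m_ac l_minus r_minus)
    finally show "g j l = \<ominus> g l j" .
  qed (use assms gc in auto)
  finally show ?thesis .
qed

text \<open>Insertion of the vertex \<open>j\<close> is a homotopy between multiplication by \<open>f j [^] n\<close> and zero on the
Koszul complex. So \<open>f j [^] n\<close> kills all cohomology at level \<open>n\<close>, with an explicit primitive. The
primitive vanishes on a face whenever the cocycle vanishes after \<open>j\<close> is added to that face, which keeps supports under control.\<close>

lemma contracting_homotopy:
  assumes r: "\<And>J. r J \<in> carrier R" and A: "finite A" and cocycle: "cocycle A i n r"
    and j: "j \<in> A" and J: "J \<in> faces A i"
  shows "kdiff n (\<lambda>K. if j \<in> K then \<zero> else face_sign (insert j K) j \<otimes> r (insert j K)) J = f j [^] n \<otimes> r J"
    (is "kdiff n ?h J = _")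
proof (cases "j \<in> J")
  case True
  have [simp]: "insert j J = J" using True by auto
  have fin: "finite J" using J A by (rule finite_faces)
  have hc: "?h K \<in> carrier R" for K using r by simp
  have "kdiff n ?h J = (\<Oplus>l\<in>J. if j = l then f j [^] n \<otimes> r J else \<zero>)"
    unfolding kdiff_def using True r
    by (intro finsum_cong') (auto simp: m_lcomm face_sign_face_sign_left)
  also have "\<dots> = f j [^] n \<otimes> r J"
    using True fin r by (intro finsum_singleton) auto
  finally show ?thesis .
next
  case False
  let ?J = "insert j J"
  have fin: "finite J" using J A by (rule finite_faces)
  have [simp]: "?J - {j} = J" using False by auto
  have "?J \<in> faces A (Suc i)" using J A j False by (rule faces_insert)
  then have "\<zero> = kdiff n r ?J" using cocycle by (simp add: cocycle_def)
  also have "\<dots> = face_sign ?J j \<otimes> (f j [^] n \<otimes> r J) \<oplus> (\<Oplus>l\<in>J. face_sign ?J l \<otimes> (f l [^] n \<otimes> r (?J - {l})))"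
    unfolding kdiff_def using fin False r by (subst finsum_insert) auto
  finally have 0: "face_sign ?J j \<otimes> (f j [^] n \<otimes> r J) \<oplus> (\<Oplus>l\<in>J. face_sign ?J l \<otimes> (f l [^] n \<otimes> r (?J - {l}))) = \<zero>"
    by simp
  define T where "T = (\<Oplus>l\<in>J. face_sign ?J l \<otimes> (f l [^] n \<otimes> r (?J - {l})))"
  have Tc: "T \<in> carrier R" using r by (auto simp: T_def intro!: finsum_closed)
  have "face_sign ?J j \<otimes> (f j [^] n \<otimes> r J) = \<ominus> T"
    using 0 r Tc by (intro minus_equality[symmetric]) (auto simp: T_def)
  then have "face_sign ?J j \<otimes> (face_sign ?J j \<otimes> (f j [^] n \<otimes> r J)) = face_sign ?J j \<otimes> \<ominus> T" by simp
  then have 1: "f j [^] n \<otimes> r J = \<ominus> face_sign ?J j \<otimes> T"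
    using r Tc by (simp add: face_sign_face_sign_left l_minus r_minus)
  have "kdiff n ?h J = (\<Oplus>l\<in>J. \<ominus> face_sign ?J j \<otimes> (face_sign ?J l \<otimes> (f l [^] n \<otimes> r (?J - {l}))))"
    unfolding kdiff_def
  proof (intro finsum_cong')
    fix l assume l: "l \<in> J"
    have jl: "j \<noteq> l" using False l by auto
    have e: "insert j (J - {l}) = ?J - {l}" using jl by auto
    have s: "face_sign J l \<otimes> face_sign (?J - {l}) j = \<ominus> face_sign ?J j \<otimes> face_sign ?J l"
      using face_sign_remove[of ?J j l] face_sign_remove[of ?J l j] jl l fin by (auto simp: l_minus r_minus m_comm)
    have "face_sign J l \<otimes> (f l [^] n \<otimes> ?h (J - {l})) = (face_sign J l \<otimes> face_sign (?J - {l}) j) \<otimes> (f l [^] n \<otimes> r (?J - {l}))"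
      using False r by (simp add: e m_ac)
    then show "face_sign J l \<otimes> (f l [^] n \<otimes> ?h (J - {l})) =
        \<ominus> face_sign ?J j \<otimes> (face_sign ?J l \<otimes> (f l [^] n \<otimes> r (?J - {l})))"
      using r by (simp add: s m_assoc)
  qed (use r in auto)
  also have "\<dots> = \<ominus> face_sign ?J j \<otimes> T"
    unfolding T_def using r fin by (subst finsum_rdistr) auto
  finally show ?thesis using 1 by simp
qed

lemma ev_bdryI:
  assumes "\<And>J. e J \<in> carrier R" "\<And>J. J \<in> faces A i \<Longrightarrow> mpow J k \<otimes> r J = kdiff (n + k) e J"
  shows "ev_bdry A i n r"
  using assms unfolding ev_bdry_def by blast

lemma ev_bdryE:
  assumes "ev_bdry A i n r"
  obtains k e where "\<And>J. e J \<in> carrier R" "\<And>J. J \<in> faces A i \<Longrightarrow> mpow J k \<otimes> r J = kdiff (n + k) e J"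
  using assms unfolding ev_bdry_def by blast

lemma ev_bdry_cong:
  assumes "\<And>J. J \<in> faces A i \<Longrightarrow> r J = s J"
  shows "ev_bdry A i n r \<longleftrightarrow> ev_bdry A i n s"
  using assms by (auto simp: ev_bdry_def)

lemma cocycle_cong:
  assumes "\<And>J. J \<in> faces A i \<Longrightarrow> r J = s J" "\<And>J. s J \<in> carrier R"
  shows "cocycle A i n r \<longleftrightarrow> cocycle A i n s"
proof -
  have "kdiff n r J = kdiff n s J" if "J \<in> faces A (Suc i)" for J
    using assms that by (intro kdiff_cong) (auto simp: faces_remove)
  then show ?thesis by (simp add: cocycle_def)
qed

lemma ev_bdry_mono: "ev_bdry B i n r \<Longrightarrow> A \<subseteq> B \<Longrightarrow> ev_bdry A i n r"
  unfolding ev_bdry_def using faces_mono by blast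

lemma cocycle_mono: "cocycle B i n r \<Longrightarrow> A \<subseteq> B \<Longrightarrow> cocycle A i n r"
  unfolding cocycle_def using faces_mono by blast

lemma ev_bdry_kdiff: "(\<And>J. e J \<in> carrier R) \<Longrightarrow> ev_bdry A i n (kdiff n e)"
  by (rule ev_bdryI[where k = 0 and e = e]) auto

lemma cocycle_kdiff: "finite A \<Longrightarrow> (\<And>J. e J \<in> carrier R) \<Longrightarrow> cocycle A i n (kdiff n e)"
  by (simp add: cocycle_def kdiff_kdiff finite_faces)

text \<open>Whether a class vanishes does not depend on the level at which it is written.\<close>

lemma ev_bdry_mpow:
  assumes "finite A" "\<And>J. r J \<in> carrier R"
  shows "ev_bdry A i (n + k) (\<lambda>J. mpow J k \<otimes> r J) \<longleftrightarrow> ev_bdry A i n r"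
proof
  assume "ev_bdry A i (n + k) (\<lambda>J. mpow J k \<otimes> r J)"
  then obtain l e where e: "\<And>J. e J \<in> carrier R"
    "\<And>J. J \<in> faces A i \<Longrightarrow> mpow J l \<otimes> (mpow J k \<otimes> r J) = kdiff (n + k + l) e J" by (rule ev_bdryE) blast
  show "ev_bdry A i n r"
  proof (rule ev_bdryI)
    fix J assume J: "J \<in> faces A i"
    then have "finite J" using assms by (auto intro: finite_faces)
    then show "mpow J (l + k) \<otimes> r J = kdiff (n + (l + k)) e J"
      using e(2)[OF J] assms by (simp add: mpow_add m_ac ac_simps)
  qed (use e in auto)
next
  assume "ev_bdry A i n r"
  then obtain l e where e: "\<And>J. e J \<in> carrier R"
    "\<And>J. J \<in> faces A i \<Longrightarrow> mpow J l \<otimes> r J = kdiff (n + l) e J" by (rule ev_bdryE) blast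
  show "ev_bdry A i (n + k) (\<lambda>J. mpow J k \<otimes> r J)"
  proof (rule ev_bdryI)
    fix J assume J: "J \<in> faces A i"
    then have fin: "finite J" using assms by (auto intro: finite_faces)
    have "mpow J l \<otimes> (mpow J k \<otimes> r J) = mpow J k \<otimes> kdiff (n + l) e J"
      using e(2)[OF J, symmetric] assms by (simp add: m_lcomm)
    also have "\<dots> = kdiff (n + l + k) (\<lambda>J. mpow J k \<otimes> e J) J"
      using e fin by (simp add: kdiff_mpow)
    finally show "mpow J l \<otimes> (mpow J k \<otimes> r J) = kdiff (n + k + l) (\<lambda>J. mpow J k \<otimes> e J) J"
      by (simp add: ac_simps)
  qed (use e in auto)
qed

lemma ev_bdry_add:
  assumes "finite A" "\<And>J. r J \<in> carrier R" "\<And>J. s J \<in> carrier R" "ev_bdry A i n r" "ev_bdry A i n s"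
  shows "ev_bdry A i n (\<lambda>J. r J \<oplus> s J)"
proof -
  obtain k e where e: "\<And>J. e J \<in> carrier R"
    "\<And>J. J \<in> faces A i \<Longrightarrow> mpow J k \<otimes> r J = kdiff (n + k) e J" using assms(4) by (rule ev_bdryE) blast
  obtain l g where g: "\<And>J. g J \<in> carrier R"
    "\<And>J. J \<in> faces A i \<Longrightarrow> mpow J l \<otimes> s J = kdiff (n + l) g J" using assms(5) by (rule ev_bdryE) blast
  show ?thesis
  proof (rule ev_bdryI)
    fix J assume J: "J \<in> faces A i"
    then have fin: "finite J" using assms by (auto intro: finite_faces)
    have "mpow J (k + l) \<otimes> (r J \<oplus> s J) =
        mpow J l \<otimes> (mpow J k \<otimes> r J) \<oplus> mpow J k \<otimes> (mpow J l \<otimes> s J)"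
      using assms fin by (simp add: mpow_add r_distr m_ac)
    also have "\<dots> = kdiff (n + k + l) (\<lambda>J. mpow J l \<otimes> e J) J \<oplus> kdiff (n + l + k) (\<lambda>J. mpow J k \<otimes> g J) J"
      using e g fin by (simp add: J kdiff_mpow)
    also have "\<dots> = kdiff (n + (k + l)) (\<lambda>J. mpow J l \<otimes> e J \<oplus> mpow J k \<otimes> g J) J"
      using e g by (subst kdiff_add) (auto simp: ac_simps)
    finally show "mpow J (k + l) \<otimes> (r J \<oplus> s J) = \<dots>" .
  qed (use e g in auto)
qed

lemma ev_bdry_smult:
  assumes "\<And>J. r J \<in> carrier R" "a \<in> carrier R" "ev_bdry A i n r"
  shows "ev_bdry A i n (\<lambda>J. a \<otimes> r J)"
proof -
  obtain k e where e: "\<And>J. e J \<in> carrier R"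
    "\<And>J. J \<in> faces A i \<Longrightarrow> mpow J k \<otimes> r J = kdiff (n + k) e J" using assms(3) by (rule ev_bdryE) blast
  show ?thesis
  proof (rule ev_bdryI)
    fix J assume J: "J \<in> faces A i"
    have "mpow J k \<otimes> (a \<otimes> r J) = a \<otimes> kdiff (n + k) e J"
      using assms e(2)[OF J, symmetric] by (simp add: m_lcomm)
    then show "mpow J k \<otimes> (a \<otimes> r J) = kdiff (n + k) (\<lambda>J. a \<otimes> e J) J"
      using assms e by (simp add: kdiff_smult)
  qed (use e assms in auto)
qed

lemma cocycle_mpow:
  assumes "finite A" "\<And>J. r J \<in> carrier R" "cocycle A i n r"
  shows "cocycle A i (n + k) (\<lambda>J. mpow J k \<otimes> r J)"
  using assms by (simp add: cocycle_def kdiff_mpow finite_faces)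

lemma cocycle_smult:
  assumes "\<And>J. r J \<in> carrier R" "a \<in> carrier R" "cocycle A i n r"
  shows "cocycle A i n (\<lambda>J. a \<otimes> r J)"
  using assms by (simp add: cocycle_def kdiff_smult)

lemma cocycle_add:
  assumes "\<And>J. r J \<in> carrier R" "\<And>J. s J \<in> carrier R" "cocycle A i n r" "cocycle A i n s"
  shows "cocycle A i n (\<lambda>J. r J \<oplus> s J)"
  using assms by (simp add: cocycle_def kdiff_add)

lemma cocycle_diff:
  assumes "\<And>J. r J \<in> carrier R" "\<And>J. s J \<in> carrier R" "cocycle A i n r" "cocycle A i n s"
  shows "cocycle A i n (\<lambda>J. r J \<ominus> s J)"
  using assms(3,4) unfolding cocycle_def kdiff_diff[OF assms(1,2)] by (simp add: minus_eq)

end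

section \<open>Adding a generator that lies in the ideal of the others\<close>

locale koszul_char_p = koszul R f + char_p_ring R p for R (structure) and f p
begin

lemma face_sign_frobenius: "face_sign J j [^] p = face_sign J j"
  by (simp add: face_sign_def frobenius_minus)

lemma kdiff_frobenius:
  assumes "\<And>J. r J \<in> carrier R" "finite J"
  shows "kdiff (n * p) (\<lambda>J. r J [^] p) J = kdiff n r J [^] p"
  unfolding kdiff_def using assms
  by (subst frobenius_finsum)
    (auto intro!: finsum_cong' simp: nat_pow_distrib nat_pow_pow face_sign_frobenius)

lemma cocycle_frobenius:
  assumes "finite A" "\<And>J. r J \<in> carrier R" "cocycle A i n r"
  shows "cocycle A i (n * p) (\<lambda>J. r J [^] p)"
  using assms by (simp add: cocycle_def kdiff_frobenius finite_faces)

lemma ev_bdry_frobenius: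
  assumes "finite A" "\<And>J. r J \<in> carrier R" "ev_bdry A i n r"
  shows "ev_bdry A i (n * p) (\<lambda>J. r J [^] p)"
proof -
  obtain k e where e: "\<And>J. e J \<in> carrier R"
    "\<And>J. J \<in> faces A i \<Longrightarrow> mpow J k \<otimes> r J = kdiff (n + k) e J" using assms(3) by (rule ev_bdryE) blast
  show ?thesis
  proof (rule ev_bdryI)
    fix J assume J: "J \<in> faces A i"
    then have fin: "finite J" using assms by (auto intro: finite_faces)
    have "mpow J (k * p) \<otimes> r J [^] p = (mpow J k \<otimes> r J) [^] p"
      using assms fin by (simp add: nat_pow_distrib mpow_pow)
    also have "\<dots> = kdiff ((n + k) * p) (\<lambda>J. e J [^] p) J"
      using e fin J by (simp add: kdiff_frobenius)
    finally show "mpow J (k * p) \<otimes> r J [^] p = kdiff (n * p + k * p) (\<lambda>J. e J [^] p) J"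
      by (simp add: add_mult_distrib)
  qed (use e in auto)
qed

text \<open>Fix a large power \<open>q\<close> of \<open>p\<close>. The elements whose \<open>q\<close>-th power multiplies the cocycle into a boundary form an
ideal, because raising to the power \<open>q\<close> is additive; by the homotopy this ideal contains every \<open>f j\<close> with \<open>j\<close>
outside \<open>B\<close>. Keeping track of the support \<open>B\<close> lets one statement serve both the full complex
(\<open>B = {}\<close>) and the subcomplex of faces through one vertex.\<close>

lemma power_kills_cocycle:
  assumes r: "\<And>J. r J \<in> carrier R" and A: "finite A" and cocycle: "cocycle A i n r"
    and supp: "\<And>J. \<not> B \<subseteq> J \<Longrightarrow> r J = \<zero>"
    and y: "y \<in> Idl (f ` (A - B))"
  shows "\<exists>(q::nat) e. (\<forall>J. e J \<in> carrier R) \<and> (\<forall>J. \<not> B \<subseteq> J \<longrightarrow> e J = \<zero>) \<and>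
    (\<forall>J\<in>faces A i. y [^] q \<otimes> r J = kdiff n e J)"
proof -
  \<comment> \<open>A \<open>p\<close>-power that is at least \<open>n\<close>: raising to \<open>q\<close> is
    additive and \<open>f j [^] q\<close> is a multiple of \<open>f j [^] n\<close>.\<close>
  define q where "q = p ^ n"
  have nq: "n \<le> q" and q0: "q > 0" using prime_ge_2_nat[OF p_prime]
    by (auto simp: q_def intro: order.trans[OF less_imp_le[OF less_exp]] power_mono)
  define kills where "kills a e \<longleftrightarrow> (\<forall>J. e J \<in> carrier R) \<and> (\<forall>J. \<not> B \<subseteq> J \<longrightarrow> e J = \<zero>) \<and>
    (\<forall>J\<in>faces A i. a \<otimes> r J = kdiff n e J)" for a e
  define Y where "Y = {y \<in> carrier R. \<exists>e. kills (y [^] q) e}"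
  have mult: "kills (b \<otimes> a) (\<lambda>J. b \<otimes> e J)" if "kills a e" "a \<in> carrier R" "b \<in> carrier R" for a b e
    using that r by (auto simp: kills_def kdiff_smult m_assoc)
  have add: "kills (a \<oplus> b) (\<lambda>J. e J \<oplus> g J)" if "kills a e" "kills b g" "a \<in> carrier R" "b \<in> carrier R" for a b e g
    using that r by (auto simp: kills_def kdiff_add l_distr)
  have YM: "b \<otimes> a \<in> Y" if "a \<in> Y" "b \<in> carrier R" for a b
    using that mult[of "a [^] q" _ "b [^] q"] by (auto simp: Y_def nat_pow_distrib)
  have YA: "a \<oplus> b \<in> Y" if "a \<in> Y" "b \<in> Y" for a b
    using that add[of "a [^] q" _ "b [^] q"] by (auto simp: Y_def iterated_frobenius_add q_def)
  have Y0: "\<zero> \<in> Y"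
    using q0 r by (auto simp: Y_def kills_def nat_pow_zero kdiff_def intro!: exI[of _ "\<lambda>_. \<zero>"])
  have YC: "Y \<subseteq> carrier R" by (auto simp: Y_def)
  have Ym: "\<ominus> a \<in> Y" if "a \<in> Y" for a
    using YM[OF that, of "\<ominus> \<one>"] that YC by (auto simp: l_minus)
  have "ideal Y R"
  proof (rule idealI)
    show "subgroup Y (add_monoid R)"
      by (rule subgroup.intro) (use YC YA Y0 Ym in \<open>auto simp: a_inv_def[symmetric]\<close>)
    show "a \<otimes> x \<in> Y" "x \<otimes> a \<in> Y" if "a \<in> Y" "x \<in> carrier R" for a x
      using YM[OF that] that YC by (auto simp: m_comm)
  qed (rule ring_axioms)
  moreover have "f j \<in> Y" if j: "j \<in> A - B" for j
  proof -
    let ?h = "\<lambda>K. if j \<in> K then \<zero> else face_sign (insert j K) j \<otimes> r (insert j K)"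
    have "\<not> B \<subseteq> insert j J" if "\<not> B \<subseteq> J" for J using that j by auto
    then have "kills (f j [^] n) ?h"
      using r contracting_homotopy[OF r A cocycle, of j] j supp by (auto simp: kills_def)
    then have "kills (f j [^] (q - n) \<otimes> f j [^] n) (\<lambda>J. f j [^] (q - n) \<otimes> ?h J)"
      by (rule mult) auto
    then show ?thesis using nq by (auto simp: Y_def nat_pow_mult)
  qed
  ultimately have "Idl (f ` (A - B)) \<subseteq> Y" by (intro genideal_minimal) auto
  then show ?thesis using y unfolding Y_def kills_def by blast
qed

text \<open>The cochains supported on faces through \<open>a\<close> form, up to a shift, the Cech complex of the remaining generators over the
localization at \<open>f a\<close>. A power of \<open>f a\<close> kills its cohomology by the preceding lemma and is a unit there; in
terms of numerators, dividing by that power is the same as raising the level only at the vertices other than \<open>a\<close>.\<close>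

lemma acyclic_support:
  assumes r: "\<And>J. r J \<in> carrier R" and A: "finite A" "a \<notin> A" and cocycle: "cocycle (insert a A) i n r"
    and supp: "\<And>J. a \<notin> J \<Longrightarrow> r J = \<zero>"
    and fa: "f a \<in> Idl (f ` A)"
  shows "\<exists>k e. (\<forall>J. e J \<in> carrier R) \<and> (\<forall>J. a \<notin> J \<longrightarrow> e J = \<zero>) \<and>
    (\<forall>J\<in>faces (insert a A) i. mpow J k \<otimes> r J = kdiff (n + k) e J)"
proof -
  have "insert a A - {a} = A" using A by auto
  then have *: "f a \<in> Idl (f ` (insert a A - {a}))" using fa by simp
  have A': "finite (insert a A)" using A by simp
  have supp': "r J = \<zero>" if "\<not> {a} \<subseteq> J" for J
    using supp that by auto
  obtain q e where e: "\<And>J. e J \<in> carrier R" "\<And>J. \<not> {a} \<subseteq> J \<Longrightarrow> e J = \<zero>"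
    and eq: "\<And>J. J \<in> faces (insert a A) i \<Longrightarrow> f a [^] (q::nat) \<otimes> r J = kdiff n e J"
    using power_kills_cocycle[OF r A' cocycle supp' *] by blast
  have e0: "e J = \<zero>" if "a \<notin> J" for J using e(2) that by auto
  \<comment> \<open>This cochain at level \<open>n + q\<close> stands for \<open>e\<close> divided by \<open>f
    a [^] q\<close>.\<close>
  let ?e = "\<lambda>J. mpow (J - {a}) q \<otimes> e J"
  have "mpow J q \<otimes> r J = kdiff (n + q) ?e J" if J: "J \<in> faces (insert a A) i" for J
  proof (cases "a \<in> J")
    case False
    have "kdiff (n + q) ?e J = kdiff (n + q) (\<lambda>_. \<zero>) J"
      using False e0 by (intro kdiff_cong) auto
    then show ?thesis using supp[OF False] by (simp add: kdiff_def)
  next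
    case True
    have fin: "finite J" using J A by (auto intro: finite_faces)
    have "mpow J q \<otimes> r J = mpow (J - {a}) q \<otimes> kdiff n e J"
      using mpow_remove[OF fin True, of q] eq[OF J, symmetric] r by (simp add: m_ac)
    also have "\<dots> = kdiff (n + q) ?e J"
      unfolding kdiff_def
    proof (subst finsum_rdistr, use fin e in \<open>auto intro!: finsum_cong'\<close>)
      fix j assume j: "j \<in> J"
      show "mpow (J - {a}) q \<otimes> (face_sign J j \<otimes> (f j [^] n \<otimes> e (J - {j}))) =
        face_sign J j \<otimes> (f j [^] (n + q) \<otimes> (mpow (J - {j} - {a}) q \<otimes> e (J - {j})))"
      proof (cases "j = a")
        case True
        then show ?thesis using e0 by simp
      next
        case False
        have "J - {a} - {j} = J - {j} - {a}" by auto
        then have "mpow (J - {a}) q = f j [^] q \<otimes> mpow (J - {j} - {a}) q"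
          using mpow_remove[of "J - {a}" j q] fin j False by simp
        then show ?thesis using e by (simp add: nat_pow_mult[symmetric] m_ac)
      qed
    qed
    finally show ?thesis .
  qed
  then show ?thesis using e e0 by (intro exI[of _ q] exI[of _ ?e]) auto
qed

text \<open>Injectivity of the restriction from \<open>insert a A\<close> to \<open>A\<close> on cohomology: after subtracting a boundary, a cocycle
that bounds on \<open>A\<close> is supported on faces through \<open>a\<close>, where everything is acyclic.\<close>

lemma ev_bdry_insert:
  assumes r: "\<And>J. r J \<in> carrier R" and A: "finite A" "a \<notin> A" and cocycle: "cocycle (insert a A) i n r"
    and fa: "f a \<in> Idl (f ` A)" and bd: "ev_bdry A i n r"
  shows "ev_bdry (insert a A) i n r"
proof -
  have A': "finite (insert a A)" using A by simp
  obtain k b where b: "\<And>J. b J \<in> carrier R"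
    "\<And>J. J \<in> faces A i \<Longrightarrow> mpow J k \<otimes> r J = kdiff (n + k) b J" using bd by (rule ev_bdryE) blast
  let ?b = "\<lambda>J. if a \<in> J then \<zero> else b J"
  let ?s = "\<lambda>J. mpow J k \<otimes> r J \<ominus> kdiff (n + k) ?b J"
  let ?c = "\<lambda>J. if a \<in> J then ?s J else \<zero>"
  have sc: "?s J \<in> carrier R" for J using r b by auto
  have "cocycle (insert a A) i (n + k) ?s"
    using r b cocycle A' by (intro cocycle_diff cocycle_mpow cocycle_kdiff) auto
  moreover have cs: "?c J = ?s J" if "J \<in> faces (insert a A) i" for J
  proof (cases "a \<in> J")
    case False
    then have J: "J \<in> faces A i" using that by (auto simp: faces_def)
    have "kdiff (n + k) ?b J = kdiff (n + k) b J" using False b by (intro kdiff_cong) auto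
    then show ?thesis using b(2)[OF J] False b(1) by (simp add: minus_eq r_neg)
  qed auto
  ultimately have cc: "cocycle (insert a A) i (n + k) ?c"
    using cocycle_cong[of "insert a A" i ?c ?s] sc by blast
  have c: "?c J \<in> carrier R" "a \<notin> J \<Longrightarrow> ?c J = \<zero>" for J using sc by auto
  obtain l e where e: "\<And>J. e J \<in> carrier R"
     "\<And>J. J \<in> faces (insert a A) i \<Longrightarrow> mpow J l \<otimes> ?c J = kdiff (n + k + l) e J"
    using acyclic_support[of ?c A a i "n + k", OF c(1) A cc c(2) fa] by blast
  then have "ev_bdry (insert a A) i (n + k) ?c" by (intro ev_bdryI[of e _ _ l]) auto
  then have "ev_bdry (insert a A) i (n + k) ?s" using cs ev_bdry_cong[of _ i ?c ?s] by blast
  moreover have "ev_bdry (insert a A) i (n + k) (kdiff (n + k) ?b)" using b by (intro ev_bdry_kdiff) auto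
  ultimately have "ev_bdry (insert a A) i (n + k) (\<lambda>J. ?s J \<oplus> kdiff (n + k) ?b J)"
    using sc b A' by (intro ev_bdry_add) auto
  also have "(\<lambda>J. ?s J \<oplus> kdiff (n + k) ?b J) = (\<lambda>J. mpow J k \<otimes> r J)"
    using r b by (simp add: minus_eq a_assoc l_neg)
  finally show ?thesis using ev_bdry_mpow[OF A' r] by simp
qed

text \<open>Injectivity of the Frobenius action on the Cech cohomology in degree \<open>i\<close>, in terms of numerators: the \<open>p\<close>-th
power of a fraction of level \<open>n\<close> has level \<open>n * p\<close>.\<close>

definition frob_inj :: "nat set \<Rightarrow> nat \<Rightarrow> bool" where
  "frob_inj A i \<longleftrightarrow> (\<forall>n r. (\<forall>J. r J \<in> carrier R) \<longrightarrow> cocycle A i n r \<longrightarrow>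
     ev_bdry A i (n * p) (\<lambda>J. r J [^] p) \<longrightarrow> ev_bdry A i n r)"

lemma frob_injD:
  assumes "frob_inj A i" "\<And>J. r J \<in> carrier R" "cocycle A i n r" "ev_bdry A i (n * p) (\<lambda>J. r J [^] p)"
  shows "ev_bdry A i n r"
  using assms unfolding frob_inj_def by blast

text \<open>Restriction to \<open>A\<close> commutes with Frobenius and is bijective on cohomology. For surjectivity, a cocycle on \<open>A\<close>
is extended by zero; its differential is supported on faces through \<open>a\<close>, so acyclicity provides a correction that
vanishes on \<open>A\<close>.\<close>

lemma frob_inj_insert:
  assumes A: "finite A" "a \<notin> A" and fa: "f a \<in> Idl (f ` A)"
  shows "frob_inj (insert a A) i \<longleftrightarrow> frob_inj A i"
proof
  assume F: "frob_inj A i"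
  show "frob_inj (insert a A) i"
    unfolding frob_inj_def
  proof (intro allI impI)
    fix n r
    assume r: "\<forall>J. r J \<in> carrier R" and cocycle: "cocycle (insert a A) i n r"
      and bd: "ev_bdry (insert a A) i (n * p) (\<lambda>J. r J [^] p)"
    have c: "cocycle A i n r" using cocycle by (rule cocycle_mono) auto
    have b: "ev_bdry A i (n * p) (\<lambda>J. r J [^] p)" using bd by (rule ev_bdry_mono) auto
    have "ev_bdry A i n r"
      using r by (intro frob_injD[OF F _ c b]) auto
    then show "ev_bdry (insert a A) i n r"
      using r cocycle A fa by (intro ev_bdry_insert) auto
  qed
next
  assume F: "frob_inj (insert a A) i"
  have A': "finite (insert a A)" using A by simp
  show "frob_inj A i"
    unfolding frob_inj_def
  proof (intro allI impI)
    fix n r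
    assume r: "\<forall>J. r J \<in> carrier R" and cocycle: "cocycle A i n r"
      and bd: "ev_bdry A i (n * p) (\<lambda>J. r J [^] p)"
    let ?r = "\<lambda>J. if a \<in> J then \<zero> else r J"
    let ?d = "\<lambda>J. if J \<in> faces (insert a A) (Suc i) then kdiff n ?r J else \<zero>"
    have rc: "?r J \<in> carrier R" for J using r by simp
    have kc: "kdiff n ?r J \<in> carrier R" for J using rc by blast
    have dc: "?d J \<in> carrier R" for J using kc by simp
    have d0: "?d J = \<zero>" if "a \<notin> J" for J
    proof (cases "J \<in> faces (insert a A) (Suc i)")
      case True
      then have J: "J \<in> faces A (Suc i)" using that by (auto simp: faces_def)
      have "kdiff n ?r J = kdiff n r J" using that r by (intro kdiff_cong) auto
      then show ?thesis using cocycle J by (simp add: cocycle_def)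
    qed simp
    have "cocycle (insert a A) (Suc i) n ?d \<longleftrightarrow> cocycle (insert a A) (Suc i) n (kdiff n ?r)"
      using kc by (intro cocycle_cong) auto
    moreover have "cocycle (insert a A) (Suc i) n (kdiff n ?r)" using r by (intro cocycle_kdiff[OF A']) auto
    ultimately have dd: "cocycle (insert a A) (Suc i) n ?d" by blast
    obtain k e where e: "\<And>J. e J \<in> carrier R" "\<And>J. a \<notin> J \<Longrightarrow> e J = \<zero>"
       "\<And>J. J \<in> faces (insert a A) (Suc i) \<Longrightarrow> mpow J k \<otimes> ?d J = kdiff (n + k) e J"
      using acyclic_support[of ?d A a "Suc i" n, OF dc A dd d0 fa] by blast
    let ?s = "\<lambda>J. mpow J k \<otimes> ?r J \<ominus> e J"
    have sc: "?s J \<in> carrier R" for J using rc e by auto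
    have cocycle_s: "cocycle (insert a A) i (n + k) ?s"
      unfolding cocycle_def
    proof
      fix J assume J: "J \<in> faces (insert a A) (Suc i)"
      have fin: "finite J" using J A' by (rule finite_faces)
      have "kdiff (n + k) ?s J = mpow J k \<otimes> kdiff n ?r J \<ominus> kdiff (n + k) e J"
        using kdiff_diff[of "\<lambda>J. mpow J k \<otimes> ?r J" e] kdiff_mpow[of ?r, OF rc fin] rc e by simp
      then show "kdiff (n + k) ?s J = \<zero>" using e(3)[OF J] kdiff_closed[of e] e(1) J by (simp add: minus_eq r_neg)
    qed
    have s: "?s J = mpow J k \<otimes> r J" if "J \<in> faces A i" for J
      using that A r e(2)[of J] by (auto simp: faces_def minus_eq)
    have "ev_bdry A i (n * p + k * p) (\<lambda>J. mpow J (k * p) \<otimes> r J [^] p)"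
      using bd r A by (subst ev_bdry_mpow) auto
    moreover have "?s J [^] p = mpow J (k * p) \<otimes> r J [^] p" if "J \<in> faces A i" for J
      using that s[OF that] r A by (auto simp: nat_pow_distrib mpow_pow finite_faces)
    ultimately have "ev_bdry A i ((n + k) * p) (\<lambda>J. ?s J [^] p)"
      using ev_bdry_cong[of A i "\<lambda>J. ?s J [^] p" "\<lambda>J. mpow J (k * p) \<otimes> r J [^] p"]
      by (simp add: add_mult_distrib)
    then have bs: "ev_bdry (insert a A) i ((n + k) * p) (\<lambda>J. ?s J [^] p)"
      using sc cocycle_s A A' fa by (intro ev_bdry_insert cocycle_frobenius) auto
    have "ev_bdry (insert a A) i (n + k) ?s" by (rule frob_injD[OF F sc cocycle_s bs])
    then have "ev_bdry A i (n + k) ?s" by (rule ev_bdry_mono) auto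
    then have "ev_bdry A i (n + k) (\<lambda>J. mpow J k \<otimes> r J)"
      using ev_bdry_cong[of A i ?s "\<lambda>J. mpow J k \<otimes> r J"] s by blast
    then show "ev_bdry A i n r" using ev_bdry_mpow[OF A(1), of r] r by blast
  qed
qed

lemma frob_inj_union:
  assumes "finite C" "finite A" "\<And>a. a \<in> C \<Longrightarrow> f a \<in> Idl (f ` A)"
  shows "frob_inj (A \<union> C) i \<longleftrightarrow> frob_inj A i"
  using assms(1,3)
proof (induction C)
  case (insert a C)
  show ?case
  proof (cases "a \<in> A")
    case True
    then have "A \<union> insert a C = A \<union> C" by auto
    then show ?thesis using insert by simp
  next
    case False
    have "Idl (f ` A) \<subseteq> Idl (f ` (A \<union> C))"
      by (rule subset_Idl_subset) auto
    then have "f a \<in> Idl (f ` (A \<union> C))" using insert by auto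
    then have "frob_inj (insert a (A \<union> C)) i \<longleftrightarrow> frob_inj (A \<union> C) i"
      using insert assms False by (intro frob_inj_insert) auto
    then show ?thesis using insert by simp
  qed
qed simp

end

text \<open>Relabelling the vertices by a translation preserves their order, hence all signs. With \<open>m = 0\<close> this also says that only
the values of the family on \<open>A\<close> matter.\<close>

lemma (in koszul_char_p) frob_inj_shift:
  assumes g: "\<And>j. g j \<in> carrier R" "\<And>j. j \<in> A \<Longrightarrow> f (m + j) = g j"
  shows "frob_inj ((+) m ` A) i \<longleftrightarrow> koszul_char_p.frob_inj R g p A i"
proof -
  interpret G: koszul_char_p R g p
    by unfold_locales (rule g)
  let ?\<phi> = "(+) m"
  have inj: "inj_on ?\<phi> J" for J by (auto simp: inj_on_def)
  have face_sign: "G.face_sign J j = face_sign (?\<phi> ` J) (m + j)" for J j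
  proof -
    have "{k \<in> ?\<phi> ` J. k < m + j} = ?\<phi> ` {k \<in> J. k < j}" by auto
    then show ?thesis by (simp add: face_sign_def G.face_sign_def card_image inj)
  qed
  have img_minus: "?\<phi> ` J - {m + j} = ?\<phi> ` (J - {j})" for J j by auto
  have kdiff: "kdiff n r (?\<phi> ` J) = G.kdiff n (\<lambda>J. r (?\<phi> ` J)) J"
    if "\<And>J. r J \<in> carrier R" "J \<in> faces A i" for n r J i
    unfolding kdiff_def G.kdiff_def using that g(2)
    by (subst finsum_reindex[OF _ inj])
      (auto intro!: finsum_cong' simp: face_sign[symmetric] img_minus faces_def subset_iff)
  have mpow: "mpow (?\<phi> ` J) n = G.mpow J n" if "J \<in> faces A i" for J n i
    unfolding mpow_def G.mpow_def using that g(2)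
    by (subst finprod_reindex[OF _ inj]) (auto intro!: finprod_cong' simp: faces_def subset_iff)
  have faces: "faces (?\<phi> ` A) i = (`) ?\<phi> ` faces A i" for i
    by (auto simp: faces_def card_image inj subset_image_iff image_iff) 
  have cocycle: "cocycle (?\<phi> ` A) i n r \<longleftrightarrow> G.cocycle A i n (\<lambda>J. r (?\<phi> ` J))" if "\<And>J. r J \<in> carrier R" for n r
    unfolding cocycle_def G.cocycle_def faces using kdiff[OF that] by simp
  have lift: "\<exists>r'. (\<forall>J. r' J \<in> carrier R) \<and> (\<lambda>J. r' (?\<phi> ` J)) = r" if "\<And>J. r J \<in> carrier R" for r
  proof (intro exI[of _ "\<lambda>K. r (?\<phi> -` K)"] conjI)
    have "?\<phi> -` ?\<phi> ` J = J" for J by (intro inj_vimage_image_eq) auto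
    then show "(\<lambda>J. r (?\<phi> -` ?\<phi> ` J)) = r" by simp
  qed (use that in auto)
  have ev_bdry: "ev_bdry (?\<phi> ` A) i n r \<longleftrightarrow> G.ev_bdry A i n (\<lambda>J. r (?\<phi> ` J))" if "\<And>J. r J \<in> carrier R" for n r
  proof
    assume "ev_bdry (?\<phi> ` A) i n r"
    then obtain k e where e: "\<And>J. e J \<in> carrier R"
      "\<And>J. J \<in> faces (?\<phi> ` A) i \<Longrightarrow> mpow J k \<otimes> r J = kdiff (n + k) e J" by (rule ev_bdryE) blast
    show "G.ev_bdry A i n (\<lambda>J. r (?\<phi> ` J))"
    proof (rule G.ev_bdryI)
      fix J assume J: "J \<in> faces A i"
      then have "?\<phi> ` J \<in> faces (?\<phi> ` A) i" by (simp add: faces)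
      from e(2)[OF this] show "G.mpow J k \<otimes> r (?\<phi> ` J) = G.kdiff (n + k) (\<lambda>J. e (?\<phi> ` J)) J"
        using kdiff[OF e(1) J] by (simp add: mpow[OF J])
    qed (use e in auto)
  next
    assume "G.ev_bdry A i n (\<lambda>J. r (?\<phi> ` J))"
    then obtain k e where e: "\<And>J. e J \<in> carrier R"
      "\<And>J. J \<in> faces A i \<Longrightarrow> G.mpow J k \<otimes> r (?\<phi> ` J) = G.kdiff (n + k) e J" by (rule G.ev_bdryE) blast
    obtain e' where e': "\<And>J. e' J \<in> carrier R" "(\<lambda>J. e' (?\<phi> ` J)) = e" using lift[of e] e by auto
    show "ev_bdry (?\<phi> ` A) i n r"
    proof (rule ev_bdryI)
      fix J assume "J \<in> faces (?\<phi> ` A) i"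
      then obtain K where K: "J = ?\<phi> ` K" "K \<in> faces A i" by (auto simp: faces)
      from e(2)[OF K(2)] show "mpow J k \<otimes> r J = kdiff (n + k) e' J"
        using kdiff[OF e'(1) K(2)] e'(2) by (simp add: mpow[OF K(2)] K(1))
    qed (use e' in auto)
  qed
  show ?thesis
  proof
    assume F: "frob_inj (?\<phi> ` A) i"
    show "G.frob_inj A i"
      unfolding G.frob_inj_def
    proof (intro allI impI)
      fix n r
      assume r: "\<forall>J. r J \<in> carrier R" and c: "G.cocycle A i n r" and b: "G.ev_bdry A i (n * p) (\<lambda>J. r J [^] p)"
      obtain r' where r': "\<And>J. r' J \<in> carrier R" "(\<lambda>J. r' (?\<phi> ` J)) = r" using lift[of r] r by auto
      have "(\<lambda>J. r' (?\<phi> ` J) [^] p) = (\<lambda>J. r J [^] p)" using r'(2) by (metis (no_types))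
      then show "G.ev_bdry A i n r"
        using frob_injD[OF F, of r' n] r' c b cocycle[of r'] ev_bdry[of r'] ev_bdry[of "\<lambda>J. r' J [^] p"] by simp
    qed
  next
    assume F: "G.frob_inj A i"
    show "frob_inj (?\<phi> ` A) i"
      unfolding frob_inj_def
      using G.frob_injD[OF F] cocycle ev_bdry by simp
  qed
qed

section \<open>Quotient modules\<close>

context module
begin

lemma submodule_abelian_subgroup:
  assumes "submodule N R M"
  shows "abelian_subgroup N M"
  using assms
  by (intro abelian_subgroupI3 additive_subgroup.intro M.abelian_group_axioms) (rule submodule.axioms(1))

lemma quot_module_carrier: "carrier (quot_module M N) = (\<lambda>u. N +>\<^bsub>M\<^esub> u) ` carrier M"
  by (auto simp: quot_module_def A_RCOSETS_def' a_r_coset_def')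

lemma quot_module_zero: "\<zero>\<^bsub>quot_module M N\<^esub> = N"
  by (simp add: quot_module_def)

context
  fixes N assumes N: "submodule N R M"
begin

interpretation N: abelian_subgroup N M
  by (rule submodule_abelian_subgroup[OF N])

lemma coset_eq_iff:
  assumes "u \<in> carrier M" "v \<in> carrier M"
  shows "N +>\<^bsub>M\<^esub> u = N +>\<^bsub>M\<^esub> v \<longleftrightarrow> u \<ominus>\<^bsub>M\<^esub> v \<in> N"
  using assms N.a_rcos_module[of v u] N.a_repr_independence'[of u v] N.a_rcos_self[of u]
  by (auto simp: M.minus_eq)

lemma coset_eq_zero_iff:
  assumes "u \<in> carrier M"
  shows "N +>\<^bsub>M\<^esub> u = N \<longleftrightarrow> u \<in> N"
  using assms N.a_rcos_const N.a_rcos_self by blast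

lemma quot_module_add:
  assumes "u \<in> carrier M" "v \<in> carrier M"
  shows "(N +>\<^bsub>M\<^esub> u) \<oplus>\<^bsub>quot_module M N\<^esub> (N +>\<^bsub>M\<^esub> v) = N +>\<^bsub>M\<^esub> (u \<oplus>\<^bsub>M\<^esub> v)"
  using N.a_rcos_sum[OF assms] by (simp add: quot_module_def)

lemma quot_module_smult:
  assumes "a \<in> carrier R" "u \<in> carrier M"
  shows "a \<odot>\<^bsub>quot_module M N\<^esub> (N +>\<^bsub>M\<^esub> u) = N +>\<^bsub>M\<^esub> (a \<odot>\<^bsub>M\<^esub> u)"
proof -
  have "N +>\<^bsub>M\<^esub> (a \<odot>\<^bsub>M\<^esub> v) = N +>\<^bsub>M\<^esub> (a \<odot>\<^bsub>M\<^esub> u)" if v: "v \<in> N +>\<^bsub>M\<^esub> u" for v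
  proof -
    have vc: "v \<in> carrier M" using v assms N.a_elemrcos_carrier by blast
    have "v \<ominus>\<^bsub>M\<^esub> u \<in> N" using v vc assms N.a_rcos_module[of u v] by (simp add: M.minus_eq)
    then have "a \<odot>\<^bsub>M\<^esub> (v \<ominus>\<^bsub>M\<^esub> u) \<in> N" using submodule.smult_closed[OF N assms(1)] by simp
    then show ?thesis using assms vc
      by (subst coset_eq_iff) (auto simp: M.minus_eq smult_r_distr smult_r_minus)
  qed
  then have "(\<Union>v\<in>N +>\<^bsub>M\<^esub> u. N +>\<^bsub>M\<^esub> (a \<odot>\<^bsub>M\<^esub> v)) = (\<Union>v\<in>N +>\<^bsub>M\<^esub> u. N +>\<^bsub>M\<^esub> (a \<odot>\<^bsub>M\<^esub> u))"
    by (intro SUP_cong) auto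
  then show ?thesis using N.a_rcos_self[OF assms(2)] by (auto simp: quot_module_def)
qed

lemma quot_module_module: "module R (quot_module M N)"
proof (rule moduleI)
  interpret Q: comm_group "M A_Mod N" by (rule N.a_factorgroup_is_comm_group)
  show "abelian_group (quot_module M N)"
    using Q.m_closed Q.m_assoc Q.m_comm Q.l_one Q.one_closed Q.l_inv_ex
    by (intro abelian_groupI) (simp_all add: quot_module_def A_FactGroup_def')
qed (auto simp: quot_module_carrier quot_module_smult quot_module_add smult_l_distr smult_r_distr
    smult_assoc1 R.is_cring)

end

end

context module
begin

lemma submodule_from_smult:
  assumes "H \<subseteq> carrier M" "\<zero>\<^bsub>M\<^esub> \<in> H"
    and add: "\<And>a b. \<lbrakk>a \<in> H; b \<in> H\<rbrakk> \<Longrightarrow> a \<oplus>\<^bsub>M\<^esub> b \<in> H"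
    and smult: "\<And>a u. \<lbrakk>a \<in> carrier R; u \<in> H\<rbrakk> \<Longrightarrow> a \<odot>\<^bsub>M\<^esub> u \<in> H"
  shows "submodule H R M"
proof (rule submoduleI)
  fix u assume u: "u \<in> H"
  then have "u \<in> carrier M" using assms(1) by auto
  then have "\<ominus>\<^bsub>M\<^esub> u = (\<ominus> \<one>) \<odot>\<^bsub>M\<^esub> u" by (simp add: smult_l_minus)
  then show "\<ominus>\<^bsub>M\<^esub> u \<in> H" using smult[OF _ u, of "\<ominus> \<one>"] by simp
qed (use assms in auto)

lemma smult_image_submodule:
  assumes "x \<in> carrier R"
  shows "submodule ((\<lambda>u. x \<odot>\<^bsub>M\<^esub> u) ` carrier M) R M"
proof (rule submodule_from_smult)
  have "\<zero>\<^bsub>M\<^esub> = x \<odot>\<^bsub>M\<^esub> \<zero>\<^bsub>M\<^esub>" using assms by simp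
  then show "\<zero>\<^bsub>M\<^esub> \<in> (\<lambda>u. x \<odot>\<^bsub>M\<^esub> u) ` carrier M" by blast
  fix a u assume a: "a \<in> carrier R" and "u \<in> (\<lambda>u. x \<odot>\<^bsub>M\<^esub> u) ` carrier M"
  then obtain v where v: "v \<in> carrier M" "u = x \<odot>\<^bsub>M\<^esub> v" by auto
  then have "a \<odot>\<^bsub>M\<^esub> u = x \<odot>\<^bsub>M\<^esub> (a \<odot>\<^bsub>M\<^esub> v)"
    using a assms by (simp add: smult_assoc1[symmetric] R.m_comm)
  then show "a \<odot>\<^bsub>M\<^esub> u \<in> (\<lambda>u. x \<odot>\<^bsub>M\<^esub> u) ` carrier M" using a v by blast
next
  fix a b assume "a \<in> (\<lambda>u. x \<odot>\<^bsub>M\<^esub> u) ` carrier M" "b \<in> (\<lambda>u. x \<odot>\<^bsub>M\<^esub> u) ` carrier M"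
  then obtain u v where "u \<in> carrier M" "v \<in> carrier M" "a = x \<odot>\<^bsub>M\<^esub> u" "b = x \<odot>\<^bsub>M\<^esub> v" by auto
  then have "a \<oplus>\<^bsub>M\<^esub> b = x \<odot>\<^bsub>M\<^esub> (u \<oplus>\<^bsub>M\<^esub> v)" "u \<oplus>\<^bsub>M\<^esub> v \<in> carrier M"
    using assms by (simp_all add: smult_r_distr)
  then show "a \<oplus>\<^bsub>M\<^esub> b \<in> (\<lambda>u. x \<odot>\<^bsub>M\<^esub> u) ` carrier M" by blast
qed (use assms in auto)

end

section \<open>Frobenius-linear maps on modules of finite length\<close>

context module
begin

text \<open>The submodule generated by \<open>K\<close> and \<open>u\<close> lies strictly above \<open>K\<close>, so it must be all of \<open>L\<close>.\<close>

lemma simple_quotient_generated: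
  assumes K: "submodule K R M" and L: "submodule L R M" and KL: "K \<subseteq> L"
    and simple: "\<not> (\<exists>P. submodule P R M \<and> K \<subset> P \<and> P \<subset> L)"
    and u: "u \<in> L" "u \<notin> K" and w: "w \<in> L"
  obtains a v where "a \<in> carrier R" "v \<in> K" "w = a \<odot>\<^bsub>M\<^esub> u \<oplus>\<^bsub>M\<^esub> v"
proof -
  note KE = submoduleE[OF K] and LE = submoduleE[OF L]
  have KC: "v \<in> carrier M" if "v \<in> K" for v using that KE(1) by auto
  have uc: "u \<in> carrier M" using u LE(1) by auto
  have K0: "\<zero>\<^bsub>M\<^esub> \<in> K" using K by (metis KE(2) KE(4) KC R.zero_closed all_not_in_conv smult_l_null)
  define P where "P = {a \<odot>\<^bsub>M\<^esub> u \<oplus>\<^bsub>M\<^esub> v | a v. a \<in> carrier R \<and> v \<in> K}"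
  have PI: "a \<odot>\<^bsub>M\<^esub> u \<oplus>\<^bsub>M\<^esub> v \<in> P" if "a \<in> carrier R" "v \<in> K" for a v
    using that by (auto simp: P_def)
  have "submodule P R M"
  proof (rule submoduleI)
    show "P \<subseteq> carrier M" using KC uc by (auto simp: P_def)
    show "\<zero>\<^bsub>M\<^esub> \<in> P" using PI[OF R.zero_closed K0] uc by simp
    show "\<ominus>\<^bsub>M\<^esub> a \<in> P" if a: "a \<in> P" for a
    proof -
      obtain b v where b: "b \<in> carrier R" "v \<in> K" "a = b \<odot>\<^bsub>M\<^esub> u \<oplus>\<^bsub>M\<^esub> v" using a by (auto simp: P_def)
      then have "\<ominus>\<^bsub>M\<^esub> a = (\<ominus> b) \<odot>\<^bsub>M\<^esub> u \<oplus>\<^bsub>M\<^esub> \<ominus>\<^bsub>M\<^esub> v" using KC uc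
        by (simp add: M.minus_add smult_l_minus)
      then show ?thesis using b KE(3) PI by auto
    qed
    show "a \<oplus>\<^bsub>M\<^esub> b \<in> P" if ab: "a \<in> P" "b \<in> P" for a b
    proof -
      obtain c v where c: "c \<in> carrier R" "v \<in> K" "a = c \<odot>\<^bsub>M\<^esub> u \<oplus>\<^bsub>M\<^esub> v" using ab by (auto simp: P_def)
      obtain d z where d: "d \<in> carrier R" "z \<in> K" "b = d \<odot>\<^bsub>M\<^esub> u \<oplus>\<^bsub>M\<^esub> z" using ab by (auto simp: P_def)
      have "a \<oplus>\<^bsub>M\<^esub> b = (c \<oplus> d) \<odot>\<^bsub>M\<^esub> u \<oplus>\<^bsub>M\<^esub> (v \<oplus>\<^bsub>M\<^esub> z)"
        using c d KC uc by (simp add: smult_l_distr M.a_ac)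
      then show ?thesis using c d KE(5) PI by auto
    qed
    show "a \<odot>\<^bsub>M\<^esub> b \<in> P" if ab: "a \<in> carrier R" "b \<in> P" for a b
    proof -
      obtain c v where c: "c \<in> carrier R" "v \<in> K" "b = c \<odot>\<^bsub>M\<^esub> u \<oplus>\<^bsub>M\<^esub> v" using ab by (auto simp: P_def)
      have "a \<odot>\<^bsub>M\<^esub> b = (a \<otimes> c) \<odot>\<^bsub>M\<^esub> u \<oplus>\<^bsub>M\<^esub> (a \<odot>\<^bsub>M\<^esub> v)"
        using c ab KC uc by (simp add: smult_r_distr smult_assoc1)
      then show ?thesis using c ab KE(4) PI by auto
    qed
  qed
  moreover have "K \<subset> P"
  proof
    show "K \<subseteq> P"
    proof
      fix v assume v: "v \<in> K"
      have "v = \<zero> \<odot>\<^bsub>M\<^esub> u \<oplus>\<^bsub>M\<^esub> v" using KC[OF v] uc by simp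
      then show "v \<in> P" using PI[OF R.zero_closed v] by simp
    qed
    have "u = \<one> \<odot>\<^bsub>M\<^esub> u \<oplus>\<^bsub>M\<^esub> \<zero>\<^bsub>M\<^esub>" using uc by simp
    then have "u \<in> P" using PI[OF R.one_closed K0] by simp
    then show "K \<noteq> P" using u by auto
  qed
  moreover have "P \<subseteq> L" using LE(4,5) u KL by (auto simp: P_def)
  ultimately have "P = L" using simple by blast
  then show thesis using w that by (auto simp: P_def)
qed

text \<open>Each \<open>a\<close> in the maximal ideal acts nilpotently on a module of finite length. Since \<open>F\<^sup>e (a u) = a\<^bsup>p^e\<^esup> F\<^sup>e u\<close>
and \<open>F\<close> is injective, it even acts as zero, so the module is a vector space over the residue field. As that field is perfect, the
image of a submodule under \<open>F\<close> is again a submodule. The images of the iterates of \<open>F\<close> form a descending chain, which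
becomes stationary; cancelling the iterate by injectivity shows that \<open>F\<close> itself is onto.

Stationarity is proved without the Jordan--Hoelder theorem: a submodule contained in another and meeting the same steps of one
fixed composition series must be equal to it.\<close>

lemma frobenius_linear_surjective:
  fixes p :: nat
  assumes fl: "finite_length R M" and I: "ideal \<mm> R"
    and unit: "\<And>a. a \<in> \<mm> \<Longrightarrow> \<one> \<ominus> a \<in> Units R"
    and perfect: "\<And>a. a \<in> carrier R \<Longrightarrow> \<exists>b\<in>carrier R. a \<ominus> b [^] p \<in> \<mm>"
    and p: "p \<ge> 2"
    and Fc: "\<And>u. u \<in> carrier M \<Longrightarrow> F u \<in> carrier M"
    and Fadd: "\<And>u v. u \<in> carrier M \<Longrightarrow> v \<in> carrier M \<Longrightarrow> F (u \<oplus>\<^bsub>M\<^esub> v) = F u \<oplus>\<^bsub>M\<^esub> F v"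
    and Fsmult: "\<And>a u. a \<in> carrier R \<Longrightarrow> u \<in> carrier M \<Longrightarrow> F (a \<odot>\<^bsub>M\<^esub> u) = a [^] p \<odot>\<^bsub>M\<^esub> F u"
    and Finj: "inj_on F (carrier M)"
  shows "F ` carrier M = carrier M"
proof -
  obtain n :: nat and N where N: "N 0 = {\<zero>\<^bsub>M\<^esub>} \<and> N n = carrier M \<and>
     (\<forall>i\<le>n. submodule (N i) R M) \<and>
     (\<forall>i<n. N i \<subset> N (Suc i) \<and>
        \<not> (\<exists>L. submodule L R M \<and> N i \<subset> L \<and> L \<subset> N (Suc i)))"
    using fl unfolding finite_length_def by (elim exE) (rule that)
  have N0: "N 0 = {\<zero>\<^bsub>M\<^esub>}" and Nn: "N n = carrier M" using N by auto
  have sub: "submodule (N i) R M" if "i \<le> n" for i using N that by auto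
  have strict: "N i \<subset> N (Suc i)" if "i < n" for i using N that by auto
  have simple: "\<not> (\<exists>L. submodule L R M \<and> N i \<subset> L \<and> L \<subset> N (Suc i))" if "i < n" for i
    using N that by simp
  have \<mm>C: "a \<in> carrier R" if "a \<in> \<mm>" for a
    using that by (rule additive_subgroup.a_Hcarr[OF ideal.axioms(1)[OF I]])
  have NC: "u \<in> carrier M" if "u \<in> N i" "i \<le> n" for u i
    using submoduleE(1)[OF sub[OF that(2)]] that by auto
  have gen: "\<exists>a\<in>carrier R. \<exists>v\<in>N i. w = a \<odot>\<^bsub>M\<^esub> u \<oplus>\<^bsub>M\<^esub> v"
    if "i < n" "u \<in> N (Suc i)" "u \<notin> N i" "w \<in> N (Suc i)" for i u w
  proof -
    have "submodule (N i) R M" "submodule (N (Suc i)) R M" "N i \<subseteq> N (Suc i)"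
      using sub strict[OF that(1)] that(1) by auto
    from simple_quotient_generated[OF this simple[OF that(1)] that(2,3,4)] show ?thesis by blast
  qed
  have \<mm>N: "a \<odot>\<^bsub>M\<^esub> u \<in> N i" if i: "i < n" and a: "a \<in> \<mm>" and u: "u \<in> N (Suc i)" for i a u
  proof (rule ccontr)
    assume na: "a \<odot>\<^bsub>M\<^esub> u \<notin> N i"
    have ac: "a \<in> carrier R" and uc: "u \<in> carrier M" using \<mm>C[OF a] NC[OF u] i by auto
    have "a \<odot>\<^bsub>M\<^esub> u \<in> N (Suc i)" using submoduleE(4)[OF sub] i ac u by auto
    then obtain b v where b: "b \<in> carrier R" "v \<in> N i" "u = b \<odot>\<^bsub>M\<^esub> (a \<odot>\<^bsub>M\<^esub> u) \<oplus>\<^bsub>M\<^esub> v"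
      using gen[OF i _ na u] by blast
    have vc: "v \<in> carrier M" using NC[OF b(2)] i by simp
    have ba: "b \<otimes> a \<in> \<mm>" by (rule ideal.I_l_closed[OF I a b(1)])
    have bac: "b \<otimes> a \<in> carrier R" using ac b by simp
    have u1: "u = (b \<otimes> a) \<odot>\<^bsub>M\<^esub> u \<oplus>\<^bsub>M\<^esub> v" using b ac uc by (simp add: smult_assoc1)
    have "(\<one> \<ominus> b \<otimes> a) \<odot>\<^bsub>M\<^esub> u = u \<oplus>\<^bsub>M\<^esub> \<ominus>\<^bsub>M\<^esub> ((b \<otimes> a) \<odot>\<^bsub>M\<^esub> u)"
      using uc bac by (simp add: R.minus_eq smult_l_distr smult_l_minus)
    also have "\<dots> = ((b \<otimes> a) \<odot>\<^bsub>M\<^esub> u \<oplus>\<^bsub>M\<^esub> v) \<oplus>\<^bsub>M\<^esub> \<ominus>\<^bsub>M\<^esub> ((b \<otimes> a) \<odot>\<^bsub>M\<^esub> u)"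
      using u1 by simp
    also have "\<dots> = v" using uc vc bac by (simp add: M.a_ac M.r_neg M.r_neg1 M.r_neg2)
    finally have v: "(\<one> \<ominus> b \<otimes> a) \<odot>\<^bsub>M\<^esub> u = v" .
    obtain c where c: "c \<in> carrier R" "c \<otimes> (\<one> \<ominus> b \<otimes> a) = \<one>"
      using unit[OF ba] by (auto simp: Units_def)
    have "u = (c \<otimes> (\<one> \<ominus> b \<otimes> a)) \<odot>\<^bsub>M\<^esub> u" using c uc by simp
    also have "\<dots> = c \<odot>\<^bsub>M\<^esub> v" using c(1) uc bac v by (simp add: smult_assoc1)
    finally have "u \<in> N i" using submoduleE(4)[OF sub] c b(2) i by auto
    then show False using na submoduleE(4)[OF sub] ac i by auto
  qed
  have nil: "a [^] n \<odot>\<^bsub>M\<^esub> u = \<zero>\<^bsub>M\<^esub>" if a: "a \<in> \<mm>" and u: "u \<in> carrier M" for a u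
  proof -
    have "a [^] j \<odot>\<^bsub>M\<^esub> u \<in> N (n - j)" if "j \<le> n" for j
      using that
    proof (induction j)
      case (Suc j)
      have "a \<odot>\<^bsub>M\<^esub> (a [^] j \<odot>\<^bsub>M\<^esub> u) \<in> N (n - Suc j)"
        by (rule \<mm>N[OF _ a]) (use Suc in \<open>auto simp: Suc_diff_Suc\<close>)
      then show ?case using \<mm>C[OF a] u by (simp add: smult_assoc1[symmetric] R.m_comm)
    qed (use u Nn in simp)
    from this[of n] show ?thesis using N0 by simp
  qed
  have F0: "F \<zero>\<^bsub>M\<^esub> = \<zero>\<^bsub>M\<^esub>"
    using Fadd[of "\<zero>\<^bsub>M\<^esub>" "\<zero>\<^bsub>M\<^esub>"] Fc[of "\<zero>\<^bsub>M\<^esub>"] by (metis M.add.l_cancel_one' M.l_zero M.zero_closed)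
  have Fec: "(F ^^ e) u \<in> carrier M" if "u \<in> carrier M" for e u
    using that Fc by (induction e) auto
  have Feinj: "inj_on (F ^^ e) (carrier M)" for e
  proof (induction e)
    case (Suc e)
    have "inj_on F ((F ^^ e) ` carrier M)" using Fec by (intro inj_on_subset[OF Finj]) auto
    with Suc.IH show ?case unfolding funpow.simps by (rule comp_inj_on)
  qed simp
  have Fe0: "(F ^^ e) \<zero>\<^bsub>M\<^esub> = \<zero>\<^bsub>M\<^esub>" for e using F0 by (induction e) auto
  have Fesmult: "(F ^^ e) (a \<odot>\<^bsub>M\<^esub> u) = a [^] (p ^ e) \<odot>\<^bsub>M\<^esub> (F ^^ e) u"
    if "a \<in> carrier R" "u \<in> carrier M" for e a u
  proof (induction e)
    case (Suc e)
    then show ?case using that Fsmult Fec by (simp add: R.nat_pow_pow mult.commute)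
  qed (use that in simp)
  have kill: "a \<odot>\<^bsub>M\<^esub> u = \<zero>\<^bsub>M\<^esub>" if a: "a \<in> \<mm>" and u: "u \<in> carrier M" for a u
  proof -
    have ac: "a \<in> carrier R" by (rule \<mm>C[OF a])
    have "n < 2 ^ n" by (rule less_exp)
    also have "\<dots> \<le> p ^ n" using p by (rule power_mono) simp
    finally have "n \<le> p ^ n" by simp
    then have "a [^] (p ^ n) = a [^] (p ^ n - n) \<otimes> a [^] n"
      using ac by (simp add: R.nat_pow_mult)
    then have "(F ^^ n) (a \<odot>\<^bsub>M\<^esub> u) = (F ^^ n) \<zero>\<^bsub>M\<^esub>"
      using ac u Fesmult[OF ac u] nil[OF a Fec[OF u]] Fe0 Fec by (simp add: smult_assoc1)
    then show ?thesis using Feinj ac u by (meson M.zero_closed inj_onD smult_closed)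
  qed
  have Fsub: "submodule (F ` P) R M" if P: "submodule P R M" for P
  proof (rule submoduleI)
    note PE = submoduleE[OF P]
    have PC: "u \<in> carrier M" if "u \<in> P" for u using that PE(1) by auto
    have P0: "\<zero>\<^bsub>M\<^esub> \<in> P" by (metis PE(2) PE(4) PC R.zero_closed all_not_in_conv smult_l_null)
    show "F ` P \<subseteq> carrier M" using PC Fc by auto
    show "\<zero>\<^bsub>M\<^esub> \<in> F ` P" using P0 F0 by (metis imageI)
    show "\<ominus>\<^bsub>M\<^esub> a \<in> F ` P" if a: "a \<in> F ` P" for a
    proof -
      obtain u where u: "u \<in> P" "a = F u" using a by auto
      have "\<ominus>\<^bsub>M\<^esub> u \<in> P" using PE(3) u by auto
      moreover have "F (\<ominus>\<^bsub>M\<^esub> u) \<oplus>\<^bsub>M\<^esub> F u = \<zero>\<^bsub>M\<^esub>"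
        using Fadd[of "\<ominus>\<^bsub>M\<^esub> u" u] PC[OF u(1)] F0 by (simp add: M.l_neg)
      then have "\<ominus>\<^bsub>M\<^esub> F u = F (\<ominus>\<^bsub>M\<^esub> u)" using PC[OF u(1)] Fc by (intro M.minus_equality) auto
      ultimately show ?thesis using u by (metis imageI)
    qed
    show "a \<oplus>\<^bsub>M\<^esub> b \<in> F ` P" if "a \<in> F ` P" "b \<in> F ` P" for a b
      using that PE(5) PC Fadd by (auto simp: image_iff) metis
    show "a \<odot>\<^bsub>M\<^esub> y \<in> F ` P" if a: "a \<in> carrier R" and y: "y \<in> F ` P" for a y
    proof -
      obtain u where u: "u \<in> P" "y = F u" using y by auto
      obtain b where b: "b \<in> carrier R" "a \<ominus> b [^] p \<in> \<mm>" using perfect[OF a] by blast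
      have "a = (a \<ominus> b [^] p) \<oplus> b [^] p" using a b by (simp add: R.minus_eq R.a_assoc R.l_neg)
      then have "a \<odot>\<^bsub>M\<^esub> y = (a \<ominus> b [^] p) \<odot>\<^bsub>M\<^esub> y \<oplus>\<^bsub>M\<^esub> b [^] p \<odot>\<^bsub>M\<^esub> y"
        using a b u PC Fc by (metis R.minus_closed R.nat_pow_closed smult_l_distr)
      also have "\<dots> = F (b \<odot>\<^bsub>M\<^esub> u)"
        using kill[OF b(2), of y] b u PC Fc Fsmult by simp
      finally show ?thesis using PE(4)[OF b(1) u(1)] by simp
    qed
  qed
  \<comment> \<open>The steps of the composition series at which \<open>P\<close> grows.\<close>
  define steps where "steps P = {i. i < n \<and> (\<exists>u\<in>P \<inter> N (Suc i). u \<notin> N i)}" for P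
  have steps_fin: "finite (steps P)" for P by (simp add: steps_def)
  \<comment> \<open>At a step where \<open>P\<close> grows too, an element of \<open>Q\<close> differs from a
    multiple of an element of \<open>P\<close> by an element of the step below, because the successive
    quotient is simple.\<close>
  have steps_eq: "P = Q" if P: "submodule P R M" and Q: "submodule Q R M" and PQ: "P \<subseteq> Q"
    and eq: "steps P = steps Q" for P Q
  proof -
    have "Q \<inter> N i \<subseteq> P" if "i \<le> n" for i
      using that
    proof (induction i)
      case 0
      have "\<zero>\<^bsub>M\<^esub> \<in> P" using submoduleE[OF P] by (metis R.zero_closed all_not_in_conv smult_l_null subset_iff)
      then show ?case using N0 by auto
    next
      case (Suc i)
      show ?case
      proof
        fix w assume w: "w \<in> Q \<inter> N (Suc i)"
        show "w \<in> P"
        proof (cases "w \<in> N i")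
          case False
          then have "i \<in> steps Q" using w Suc.prems by (auto simp: steps_def)
          then obtain u where u: "u \<in> P" "u \<in> N (Suc i)" "u \<notin> N i" using eq by (auto simp: steps_def)
          obtain a v where a: "a \<in> carrier R" "v \<in> N i" "w = a \<odot>\<^bsub>M\<^esub> u \<oplus>\<^bsub>M\<^esub> v"
            using gen[of i u w] u w Suc.prems by auto
          have c: "u \<in> carrier M" "v \<in> carrier M" "w \<in> carrier M"
            using NC[OF u(2)] NC[OF a(2)] NC[of w "Suc i"] w Suc.prems by auto
          have au: "a \<odot>\<^bsub>M\<^esub> u \<in> P" using submoduleE(4)[OF P a(1) u(1)] .
          have "v = w \<oplus>\<^bsub>M\<^esub> \<ominus>\<^bsub>M\<^esub> (a \<odot>\<^bsub>M\<^esub> u)" using a c by (simp add: M.a_ac M.r_neg M.r_neg1 M.r_neg2)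
          also have "\<dots> \<in> Q" using au PQ w submoduleE(3,5)[OF Q] by auto
          finally have "v \<in> P" using Suc a(2) by auto
          then show ?thesis using a(3) au submoduleE(5)[OF P] by auto
        qed (use Suc w in auto)
      qed
    qed
    from this[of n] show ?thesis using PQ Nn submoduleE(1)[OF Q] by auto
  qed
  define P where "P e = (F ^^ e) ` carrier M" for e
  have PSuc: "P (Suc e) = F ` P e" for e by (auto simp: P_def)
  have Psub: "submodule (P e) R M" for e
  proof (induction e)
    case 0
    show ?case using sub[of n] Nn by (simp add: P_def)
  qed (simp add: PSuc Fsub)
  have Panti: "P (Suc e) \<subseteq> P e" for e
    using Fc by (auto simp: P_def funpow_swap1)
  \<comment> \<open>The chain is stationary at a stage where the number of growing steps is minimal.\<close>
  obtain e where e: "\<And>e'. card (steps (P e)) \<le> card (steps (P e'))"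
    using ex_has_least_nat[of "\<lambda>_. True" 0 "\<lambda>e. card (steps (P e))"] by auto
  have "steps (P (Suc e)) \<subseteq> steps (P e)" using Panti[of e] by (auto simp: steps_def)
  then have "steps (P (Suc e)) = steps (P e)"
    using e[of "Suc e"] steps_fin by (intro card_subset_eq) (auto intro: antisym card_mono)
  then have Pe: "P (Suc e) = P e" by (intro steps_eq Psub Panti)
  have "u \<in> F ` carrier M" if u: "u \<in> carrier M" for u
  proof -
    have "(F ^^ e) u \<in> P (Suc e)" unfolding Pe using u by (auto simp: P_def)
    then obtain w where w: "w \<in> carrier M" "(F ^^ e) u = (F ^^ e) (F w)"
      by (auto simp: P_def funpow_swap1)
    then have "u = F w" using Feinj[of e] u Fc by (auto dest: inj_onD)
    then show ?thesis using w by auto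
  qed
  then show ?thesis using Fc by auto
qed

end

context module
begin

text \<open>A Frobenius-linear map upstairs that preserves and reflects the kernel of a surjection \<open>\<phi>\<close> descends to an injective
map, to which the previous lemma applies.\<close>

lemma frobenius_linear_surjective_along:
  fixes p :: nat and \<phi> :: "'u \<Rightarrow> 'c" and Z :: "('a, 'u, 'z) module_scheme"
  assumes Z: "module R Z"
    and \<phi>_surj: "\<phi> ` carrier Z = carrier M"
    and \<phi>_add: "\<And>u v. u \<in> carrier Z \<Longrightarrow> v \<in> carrier Z \<Longrightarrow> \<phi> (u \<oplus>\<^bsub>Z\<^esub> v) = \<phi> u \<oplus>\<^bsub>M\<^esub> \<phi> v"
    and \<phi>_smult: "\<And>a u. a \<in> carrier R \<Longrightarrow> u \<in> carrier Z \<Longrightarrow> \<phi> (a \<odot>\<^bsub>Z\<^esub> u) = a \<odot>\<^bsub>M\<^esub> \<phi> u"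
    and fl: "finite_length R M" and I: "ideal \<mm> R"
    and unit: "\<And>a. a \<in> \<mm> \<Longrightarrow> \<one> \<ominus> a \<in> Units R"
    and perfect: "\<And>a. a \<in> carrier R \<Longrightarrow> \<exists>b\<in>carrier R. a \<ominus> b [^] p \<in> \<mm>"
    and p: "p \<ge> 2"
    and Fc: "\<And>u. u \<in> carrier Z \<Longrightarrow> F u \<in> carrier Z"
    and Fadd: "\<And>u v. u \<in> carrier Z \<Longrightarrow> v \<in> carrier Z \<Longrightarrow> F (u \<oplus>\<^bsub>Z\<^esub> v) = F u \<oplus>\<^bsub>Z\<^esub> F v"
    and Fsmult: "\<And>a u. a \<in> carrier R \<Longrightarrow> u \<in> carrier Z \<Longrightarrow> F (a \<odot>\<^bsub>Z\<^esub> u) = a [^] p \<odot>\<^bsub>Z\<^esub> F u"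
    and Fker: "\<And>u. u \<in> carrier Z \<Longrightarrow> \<phi> (F u) = \<zero>\<^bsub>M\<^esub> \<longleftrightarrow> \<phi> u = \<zero>\<^bsub>M\<^esub>"
    and v: "v \<in> carrier Z"
  shows "\<exists>w\<in>carrier Z. \<phi> (F w) = \<phi> v"
proof -
  interpret Z: module R Z by (rule Z)
  have \<phi>c: "\<phi> u \<in> carrier M" if "u \<in> carrier Z" for u using \<phi>_surj that by auto
  have diff: "\<exists>d\<in>carrier Z. u = d \<oplus>\<^bsub>Z\<^esub> w" if "u \<in> carrier Z" "w \<in> carrier Z" for u w
    using that by (intro bexI[of _ "u \<ominus>\<^bsub>Z\<^esub> w"]) (auto simp: Z.minus_eq Z.M.a_assoc Z.M.l_neg)
  have F_eq: "\<phi> (F u) = \<phi> (F w) \<longleftrightarrow> \<phi> u = \<phi> w" if uw: "u \<in> carrier Z" "w \<in> carrier Z" for u w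
  proof -
    obtain d where d: "d \<in> carrier Z" "u = d \<oplus>\<^bsub>Z\<^esub> w" using diff[OF uw] by blast
    have "\<phi> u = \<phi> w \<longleftrightarrow> \<phi> d = \<zero>\<^bsub>M\<^esub>"
      using d uw \<phi>c by (simp add: \<phi>_add)
    moreover have "\<phi> (F u) = \<phi> (F w) \<longleftrightarrow> \<phi> (F d) = \<zero>\<^bsub>M\<^esub>"
      using d uw \<phi>c Fc by (simp add: \<phi>_add Fadd)
    ultimately show ?thesis using Fker[OF d(1)] by simp
  qed
  define G where "G q = \<phi> (F (SOME u. u \<in> carrier Z \<and> \<phi> u = q))" for q
  have G: "G (\<phi> u) = \<phi> (F u)" if u: "u \<in> carrier Z" for u
  proof -
    have "(SOME w. w \<in> carrier Z \<and> \<phi> w = \<phi> u) \<in> carrier Z \<and> \<phi> (SOME w. w \<in> carrier Z \<and> \<phi> w = \<phi> u) = \<phi> u"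
      using u by (intro someI[of "\<lambda>w. w \<in> carrier Z \<and> \<phi> w = \<phi> u" u]) auto
    then show ?thesis unfolding G_def using F_eq u by blast
  qed
  have lift: "\<exists>u\<in>carrier Z. q = \<phi> u" if "q \<in> carrier M" for q using that \<phi>_surj by auto
  have "G ` carrier M = carrier M"
  proof (rule frobenius_linear_surjective[OF fl I unit perfect p])
    show "G q \<in> carrier M" if "q \<in> carrier M" for q using lift[OF that] G Fc \<phi>c by auto
    show "G (q \<oplus>\<^bsub>M\<^esub> q') = G q \<oplus>\<^bsub>M\<^esub> G q'" if q: "q \<in> carrier M" "q' \<in> carrier M" for q q'
    proof -
      obtain u where u: "u \<in> carrier Z" "q = \<phi> u" using lift[OF q(1)] by blast
      obtain w where w: "w \<in> carrier Z" "q' = \<phi> w" using lift[OF q(2)] by blast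
      have "G (q \<oplus>\<^bsub>M\<^esub> q') = \<phi> (F (u \<oplus>\<^bsub>Z\<^esub> w))" using u w G[of "u \<oplus>\<^bsub>Z\<^esub> w"] \<phi>_add by simp
      then show ?thesis using u w G Fadd \<phi>_add Fc by simp
    qed
    show "G (a \<odot>\<^bsub>M\<^esub> q) = a [^] p \<odot>\<^bsub>M\<^esub> G q" if a: "a \<in> carrier R" and q: "q \<in> carrier M" for a q
    proof -
      obtain u where u: "u \<in> carrier Z" "q = \<phi> u" using lift[OF q] by blast
      have "G (a \<odot>\<^bsub>M\<^esub> q) = \<phi> (F (a \<odot>\<^bsub>Z\<^esub> u))" using u G[of "a \<odot>\<^bsub>Z\<^esub> u"] \<phi>_smult a by simp
      then show ?thesis using u a G Fsmult \<phi>_smult Fc by simp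
    qed
    show "inj_on G (carrier M)"
    proof (rule inj_onI)
      fix q q' assume q: "q \<in> carrier M" "q' \<in> carrier M" and e: "G q = G q'"
      obtain u where u: "u \<in> carrier Z" "q = \<phi> u" using lift[OF q(1)] by blast
      obtain w where w: "w \<in> carrier Z" "q' = \<phi> w" using lift[OF q(2)] by blast
      show "q = q'" using u w e G F_eq by simp
    qed
  qed
  then obtain q where "q \<in> carrier M" "G q = \<phi> v" using \<phi>c[OF v] by (metis imageE)
  then show ?thesis using lift G by metis
qed

end

section \<open>Local rings\<close>

context noetherian_local_ring
begin

lemma maximal_ideal_maximalideal: "maximalideal (maximal_ideal R) R"
  unfolding maximal_ideal_def by (rule theI'[OF unique_maximal])

text \<open>Chains of ideals have a largest member in a Noetherian ring, so Zorn's lemma yields a maximal ideal above the given one, and there is only one.\<close>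

lemma proper_ideal_subset_maximal:
  assumes "ideal I R" "\<one> \<notin> I"
  shows "I \<subseteq> maximal_ideal R"
proof -
  let ?A = "{J. ideal J R \<and> I \<subseteq> J \<and> \<one> \<notin> J}"
  have "\<exists>M\<in>?A. \<forall>X\<in>?A. M \<subseteq> X \<longrightarrow> X = M"
  proof (rule subset_Zorn_nonempty)
    show "?A \<noteq> {}" using assms by auto
    fix C assume C: "C \<noteq> {}" "subset.chain ?A C"
    then have "subset.chain {I. ideal I R} C" by (auto simp: pred_on.chain_def)
    then have "\<Union>C \<in> C" using C(1) by (intro ideal_chain_is_trivial)
    then show "\<Union>C \<in> ?A" using C(2) by (auto simp: pred_on.chain_def)
  qed
  then obtain M where M: "ideal M R" "I \<subseteq> M" "\<one> \<notin> M"
    and max: "\<And>X. ideal X R \<Longrightarrow> \<one> \<notin> X \<Longrightarrow> M \<subseteq> X \<Longrightarrow> X = M"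
    by (auto 4 4)
  have "maximalideal M R"
  proof (rule maximalidealI[OF M(1)])
    show "carrier R \<noteq> M" using M(3) by auto
    show "J = M \<or> J = carrier R" if "ideal J R" "M \<subseteq> J" for J
      using max[OF that(1)] that ideal.one_imp_carrier by blast
  qed
  then have "M = maximal_ideal R" using maximal_ideal_maximalideal unique_maximal by blast
  then show ?thesis using M by simp
qed

lemma one_minus_maximal_unit:
  assumes "a \<in> maximal_ideal R"
  shows "\<one> \<ominus> a \<in> Units R"
proof (rule ccontr)
  assume nu: "\<one> \<ominus> a \<notin> Units R"
  interpret m: maximalideal "maximal_ideal R" R by (rule maximal_ideal_maximalideal)
  have ac: "a \<in> carrier R" using assms by auto
  have "\<one> \<notin> PIdl (\<one> \<ominus> a)"
  proof
    assume "\<one> \<in> PIdl (\<one> \<ominus> a)"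
    then obtain c where "c \<in> carrier R" "\<one> = c \<otimes> (\<one> \<ominus> a)" by (auto simp: cgenideal_def)
    then show False using nu ac by (auto simp: Units_def m_comm)
  qed
  then have "PIdl (\<one> \<ominus> a) \<subseteq> maximal_ideal R"
    using ac by (intro proper_ideal_subset_maximal cgenideal_ideal) auto
  then have "\<one> \<ominus> a \<in> maximal_ideal R" using cgenideal_self[of "\<one> \<ominus> a"] ac by auto
  then have "(\<one> \<ominus> a) \<oplus> a \<in> maximal_ideal R" using assms by (rule m.a_closed)
  then have "\<one> \<in> maximal_ideal R" using ac by (simp add: minus_eq a_assoc l_neg)
  then show False using m.I_notcarr m.one_imp_carrier by auto
qed

end

section \<open>Localizations\<close>

text \<open>The operations of a localization are unions over all representatives of a fraction; this reduces them to one
representative once all representatives give the same value.\<close>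

lemma UN_constant:
  assumes "x \<in> A" "\<And>u. u \<in> A \<Longrightarrow> f u = c"
  shows "(\<Union>u\<in>A. f u) = c"
proof -
  have "(\<Union>u\<in>A. f u) = (\<Union>u\<in>A. c)" using assms(2) by (intro SUP_cong) auto
  then show ?thesis using assms(1) by auto
qed

locale mult_set = cring R for R (structure) +
  fixes W
  assumes W_carrier: "W \<subseteq> carrier R" and W_one: "\<one> \<in> W"
    and W_mult: "\<lbrakk>s \<in> W; t \<in> W\<rbrakk> \<Longrightarrow> s \<otimes> t \<in> W"
begin

lemma W_closed [simp]: "s \<in> W \<Longrightarrow> s \<in> carrier R"
  using W_carrier by auto

lemma equiv_frac_rel: "equiv (carrier R \<times> W) (frac_rel R W)"
proof (rule equivI)
  show "frac_rel R W \<subseteq> (carrier R \<times> W) \<times> (carrier R \<times> W)" by (auto simp: frac_rel_def)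
  show "refl_on (carrier R \<times> W) (frac_rel R W)"
    using W_one by (auto simp: frac_rel_def refl_on_def)
  show "sym (frac_rel R W)"
    by (rule symI) (auto simp: frac_rel_def intro: sym)
  show "trans (frac_rel R W)"
  proof (rule transI)
    fix x y z assume xy: "(x, y) \<in> frac_rel R W" and yz: "(y, z) \<in> frac_rel R W"
    obtain r s r' s' r'' s'' where e: "x = (r, s)" "y = (r', s')" "z = (r'', s'')"
      by (metis surj_pair)
    obtain t u where c: "r \<in> carrier R" "s \<in> W" "r' \<in> carrier R" "s' \<in> W" "r'' \<in> carrier R" "s'' \<in> W"
      and t: "t \<in> W" "t \<otimes> (s' \<otimes> r) = t \<otimes> (s \<otimes> r')"
      and u: "u \<in> W" "u \<otimes> (s'' \<otimes> r') = u \<otimes> (s' \<otimes> r'')"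
      using xy yz by (auto simp: frac_rel_def e)
    have "(t \<otimes> u \<otimes> s') \<otimes> (s'' \<otimes> r) = (u \<otimes> s'') \<otimes> (t \<otimes> (s' \<otimes> r))"
      using c t(1) u(1) by (simp add: m_ac)
    also have "\<dots> = (t \<otimes> s) \<otimes> (u \<otimes> (s'' \<otimes> r'))"
      unfolding t(2) using c t(1) u(1) by (simp add: m_ac)
    also have "\<dots> = (t \<otimes> u \<otimes> s') \<otimes> (s \<otimes> r'')"
      unfolding u(2) using c t(1) u(1) by (simp add: m_ac)
    finally show "(x, z) \<in> frac_rel R W"
      using c t(1) u(1) W_mult by (auto simp: frac_rel_def e)
  qed
qed

lemma loc_frac_eq_iff:
  assumes "r \<in> carrier R" "s \<in> W" "r' \<in> carrier R" "s' \<in> W"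
  shows "loc_frac R W r s = loc_frac R W r' s' \<longleftrightarrow> (\<exists>t\<in>W. t \<otimes> (s' \<otimes> r) = t \<otimes> (s \<otimes> r'))"
  unfolding loc_frac_def using assms
  by (subst eq_equiv_class_iff[OF equiv_frac_rel]) (auto simp: frac_rel_def)

lemma loc_frac_self:
  assumes "r \<in> carrier R" "s \<in> W"
  shows "(r, s) \<in> loc_frac R W r s"
  unfolding loc_frac_def using equiv_class_self[OF equiv_frac_rel] assms by auto

lemma loc_frac_memD:
  assumes "(a, b) \<in> loc_frac R W r s"
  shows "a \<in> carrier R" "b \<in> W" "\<exists>t\<in>W. t \<otimes> (b \<otimes> r) = t \<otimes> (s \<otimes> a)"
  using assms by (auto simp: loc_frac_def frac_rel_def)

lemma localization_carrier:
  "U \<in> carrier (localization R W) \<longleftrightarrow> (\<exists>r\<in>carrier R. \<exists>s\<in>W. U = loc_frac R W r s)"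
  by (auto simp: localization_def quotient_def loc_frac_def)

lemma localization_mult:
  assumes c: "r \<in> carrier R" "s \<in> W" "r' \<in> carrier R" "s' \<in> W"
  shows "loc_frac R W r s \<otimes>\<^bsub>localization R W\<^esub> loc_frac R W r' s' = loc_frac R W (r \<otimes> r') (s \<otimes> s')"
proof -
  have "loc_frac R W (a \<otimes> a') (b \<otimes> b') = loc_frac R W (r \<otimes> r') (s \<otimes> s')"
    if ab: "(a, b) \<in> loc_frac R W r s" and ab': "(a', b') \<in> loc_frac R W r' s'" for a b a' b'
  proof -
    note d = loc_frac_memD(1,2)[OF ab] loc_frac_memD(1,2)[OF ab']
    obtain t where t: "t \<in> W" "t \<otimes> (b \<otimes> r) = t \<otimes> (s \<otimes> a)" using loc_frac_memD(3)[OF ab] by blast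
    obtain u where u: "u \<in> W" "u \<otimes> (b' \<otimes> r') = u \<otimes> (s' \<otimes> a')" using loc_frac_memD(3)[OF ab'] by blast
    have "(t \<otimes> u) \<otimes> ((s \<otimes> s') \<otimes> (a \<otimes> a')) = (t \<otimes> (s \<otimes> a)) \<otimes> (u \<otimes> (s' \<otimes> a'))"
      using c d t(1) u(1) by (simp add: m_ac)
    also have "\<dots> = (t \<otimes> u) \<otimes> ((b \<otimes> b') \<otimes> (r \<otimes> r'))"
      unfolding t(2)[symmetric] u(2)[symmetric] using c d t(1) u(1) by (simp add: m_ac)
    finally show ?thesis
      using c d t(1) u(1) W_mult by (subst loc_frac_eq_iff) auto
  qed
  then show ?thesis
    unfolding localization_def
    by simp (rule UN_constant[OF loc_frac_self[OF c(1,2)]], clarsimp,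
      rule UN_constant[OF loc_frac_self[OF c(3,4)]], clarsimp)
qed

lemma localization_add:
  assumes c: "r \<in> carrier R" "s \<in> W" "r' \<in> carrier R" "s' \<in> W"
  shows "loc_frac R W r s \<oplus>\<^bsub>localization R W\<^esub> loc_frac R W r' s' =
    loc_frac R W (r \<otimes> s' \<oplus> r' \<otimes> s) (s \<otimes> s')"
proof -
  have "loc_frac R W (a \<otimes> b' \<oplus> a' \<otimes> b) (b \<otimes> b') = loc_frac R W (r \<otimes> s' \<oplus> r' \<otimes> s) (s \<otimes> s')"
    if ab: "(a, b) \<in> loc_frac R W r s" and ab': "(a', b') \<in> loc_frac R W r' s'" for a b a' b'
  proof -
    note d = loc_frac_memD(1,2)[OF ab] loc_frac_memD(1,2)[OF ab']
    obtain t where t: "t \<in> W" "t \<otimes> (b \<otimes> r) = t \<otimes> (s \<otimes> a)" using loc_frac_memD(3)[OF ab] by blast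
    obtain u where u: "u \<in> W" "u \<otimes> (b' \<otimes> r') = u \<otimes> (s' \<otimes> a')" using loc_frac_memD(3)[OF ab'] by blast
    have "(t \<otimes> u) \<otimes> ((s \<otimes> s') \<otimes> (a \<otimes> b' \<oplus> a' \<otimes> b)) =
        (u \<otimes> s' \<otimes> b') \<otimes> (t \<otimes> (s \<otimes> a)) \<oplus> (t \<otimes> s \<otimes> b) \<otimes> (u \<otimes> (s' \<otimes> a'))"
      using c d t(1) u(1) by (simp add: r_distr m_ac)
    also have "\<dots> = (t \<otimes> u) \<otimes> ((b \<otimes> b') \<otimes> (r \<otimes> s' \<oplus> r' \<otimes> s))"
      unfolding t(2)[symmetric] u(2)[symmetric] using c d t(1) u(1) by (simp add: r_distr m_ac)
    finally show ?thesis
      using c d t(1) u(1) W_mult by (subst loc_frac_eq_iff) auto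
  qed
  then show ?thesis
    unfolding localization_def
    by simp (rule UN_constant[OF loc_frac_self[OF c(1,2)]], clarsimp,
      rule UN_constant[OF loc_frac_self[OF c(3,4)]], clarsimp)
qed

lemma localization_zero: "\<zero>\<^bsub>localization R W\<^esub> = loc_frac R W \<zero> \<one>"
  by (simp add: localization_def)

lemma localization_one: "\<one>\<^bsub>localization R W\<^esub> = loc_frac R W \<one> \<one>"
  by (simp add: localization_def)

lemma loc_map_loc_frac:
  assumes V: "mult_set R V" "W \<subseteq> V" and c: "r \<in> carrier R" "s \<in> W"
  shows "loc_map R V (loc_frac R W r s) = loc_frac R V r s"
proof -
  interpret V: mult_set R V by fact
  have "loc_frac R V a b = loc_frac R V r s" if ab: "(a, b) \<in> loc_frac R W r s" for a b
  proof -
    obtain t where t: "t \<in> W" "t \<otimes> (b \<otimes> r) = t \<otimes> (s \<otimes> a)" using loc_frac_memD(3)[OF ab] by blast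
    show ?thesis
      using loc_frac_memD(1,2)[OF ab] c V(2) t
      by (subst V.loc_frac_eq_iff) (auto intro!: bexI[of _ t])
  qed
  then show ?thesis
    unfolding loc_map_def by (intro UN_constant[OF loc_frac_self[OF c]]) clarsimp
qed

end

section \<open>The Cech complex\<close>

lemma eventually_common_bound:
  assumes "finite S" "\<And>x. x \<in> S \<Longrightarrow> \<exists>N. \<forall>n\<ge>N. P x (n::nat)"
  obtains N where "\<And>n x. n \<ge> N \<Longrightarrow> x \<in> S \<Longrightarrow> P x n"
proof -
  have "\<forall>\<^sub>F n in sequentially. \<forall>x\<in>S. P x n"
    using assms by (intro eventually_ball_finite) (auto simp: eventually_sequentially)
  then show thesis using that by (auto simp: eventually_sequentially)
qed

locale cech_ring = cring R for R (structure) +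
  fixes xs :: "'a list"
  assumes xs_carrier: "set xs \<subseteq> carrier R"
begin

text \<open>The value beyond the list is chosen only to make the family total, so that closedness holds without side conditions.\<close>

definition gen :: "nat \<Rightarrow> 'a" where
  "gen j = (if j < length xs then xs ! j else \<zero>)"

sublocale koszul R gen
  by unfold_locales (use xs_carrier in \<open>auto simp: gen_def\<close>)

abbreviation A where "A \<equiv> {..<length xs}"

lemma cech_index_eq: "cech_index xs i = faces A i"
  by (simp add: cech_index_def faces_def)

lemma faces_subset: "J \<in> faces A i \<Longrightarrow> J \<subseteq> A"
  by (simp add: faces_def)

lemma finite_J: "J \<subseteq> A \<Longrightarrow> finite J"
  by (auto intro: finite_subset)

lemma finite_faces_set: "finite (faces A i)"
  by (rule finite_subset[of _ "Pow A"]) (auto simp: faces_def)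

lemma cech_denoms_eq:
  assumes "J \<subseteq> A"
  shows "cech_denoms R xs J = range (\<lambda>e :: nat \<Rightarrow> nat. \<Otimes>j\<in>J. gen j [^] e j)"
proof -
  have "(\<Otimes>j\<in>J. (xs ! j) [^] e j) = (\<Otimes>j\<in>J. gen j [^] e j)" for e :: "nat \<Rightarrow> nat"
    using assms xs_carrier by (intro finprod_cong') (auto simp: gen_def subset_iff)
  then show ?thesis by (simp add: cech_denoms_def)
qed

lemma denoms_mult_set:
  assumes "J \<subseteq> A"
  shows "mult_set R (cech_denoms R xs J)"
proof
  show "cech_denoms R xs J \<subseteq> carrier R" by (auto simp: cech_denoms_eq[OF assms])
  have "\<one> = (\<Otimes>j\<in>J. gen j [^] (0::nat))" by simp
  then show "\<one> \<in> cech_denoms R xs J" unfolding cech_denoms_eq[OF assms]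
    by (intro image_eqI[of _ _ "\<lambda>_. 0"]) auto
  fix s t assume "s \<in> cech_denoms R xs J" "t \<in> cech_denoms R xs J"
  then obtain d e where de: "s = (\<Otimes>j\<in>J. gen j [^] (d j :: nat))" "t = (\<Otimes>j\<in>J. gen j [^] (e j :: nat))"
    by (auto simp: cech_denoms_eq[OF assms])
  have "s \<otimes> t = (\<Otimes>j\<in>J. gen j [^] (d j + e j))"
    unfolding de by (subst finprod_multf[symmetric]) (auto simp: nat_pow_mult)
  then show "s \<otimes> t \<in> cech_denoms R xs J" unfolding cech_denoms_eq[OF assms]
    by (intro image_eqI[of _ _ "\<lambda>j. d j + e j"]) auto
qed

lemma mpow_denoms: "J \<subseteq> A \<Longrightarrow> mpow J n \<in> cech_denoms R xs J"
  unfolding mpow_def cech_denoms_eq by (rule image_eqI[of _ _ "\<lambda>_. n"]) auto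

lemma denoms_mono:
  assumes "K \<subseteq> J" "J \<subseteq> A"
  shows "cech_denoms R xs K \<subseteq> cech_denoms R xs J"
proof
  have K: "K \<subseteq> A" using assms by auto
  fix s assume "s \<in> cech_denoms R xs K"
  then obtain e where s: "s = (\<Otimes>j\<in>K. gen j [^] (e j :: nat))" by (auto simp: cech_denoms_eq[OF K])
  have "s = (\<Otimes>j\<in>J. gen j [^] (if j \<in> K then e j else 0))"
    unfolding s using assms finite_J[OF assms(2)] by (intro finprod_mono_neutral_cong_left) auto
  then show "s \<in> cech_denoms R xs J" unfolding cech_denoms_eq[OF assms(2)]
    by (intro image_eqI[of _ _ "\<lambda>j. if j \<in> K then e j else 0"]) auto
qed

text \<open>Every denominator can be completed to a power of the product of the generators, with equal exponents.\<close>

lemma denoms_dvd_mpow: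
  assumes "J \<subseteq> A" "s \<in> cech_denoms R xs J"
  shows "\<exists>N. \<forall>n\<ge>N. \<exists>c\<in>carrier R. s \<otimes> c = mpow J n"
proof -
  obtain e where s: "s = (\<Otimes>j\<in>J. gen j [^] (e j :: nat))"
    using assms(2) by (auto simp: cech_denoms_eq[OF assms(1)])
  have le: "e j \<le> (\<Sum>j\<in>J. e j)" if "j \<in> J" for j
    using that finite_J[OF assms(1)] by (intro member_le_sum) auto
  show ?thesis
  proof (intro exI allI impI)
    fix n assume n: "n \<ge> (\<Sum>j\<in>J. e j)"
    have "s \<otimes> (\<Otimes>j\<in>J. gen j [^] (n - e j)) = (\<Otimes>j\<in>J. gen j [^] (e j) \<otimes> gen j [^] (n - e j))"
      unfolding s by (subst finprod_multf) auto
    also have "\<dots> = mpow J n"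
      unfolding mpow_def
    proof (intro finprod_cong')
      fix j assume "j \<in> J"
      then have "e j \<le> n" using le[of j] n by linarith
      then show "gen j [^] (e j) \<otimes> gen j [^] (n - e j) = gen j [^] n" by (simp add: nat_pow_mult)
    qed auto
    finally show "\<exists>c\<in>carrier R. s \<otimes> c = mpow J n" by (intro bexI) auto
  qed
qed

text \<open>The fraction \<open>r / (\<Prod>j\<in>J. x\<^sub>j)\<^sup>n\<close>.\<close>

text \<open>The fraction \<open>r / (\<Prod>j\<in>J. gen j)\<^sup>n\<close> as an equivalence class.\<close>

definition fraction :: "nat set \<Rightarrow> 'a \<Rightarrow> nat \<Rightarrow> ('a \<times> 'a) set" where
  "fraction J r n = loc_frac R (cech_denoms R xs J) r (mpow J n)"

lemma fraction_closed:
  assumes "J \<subseteq> A" "r \<in> carrier R"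
  shows "fraction J r n \<in> carrier (cech_loc R xs J)"
proof -
  interpret mult_set R "cech_denoms R xs J" by (rule denoms_mult_set[OF assms(1)])
  show ?thesis unfolding cech_loc_def localization_carrier fraction_def
    using assms(2) mpow_denoms[OF assms(1)] by blast
qed

text \<open>Equality of fractions may be tested with powers of the product of the generators, since these are cofinal among the
denominators.\<close>

lemma fraction_eq_iff:
  assumes J: "J \<subseteq> A" and r: "r \<in> carrier R" "r' \<in> carrier R"
  shows "fraction J r n = fraction J r' m \<longleftrightarrow> (\<exists>k. mpow J (k + m) \<otimes> r = mpow J (k + n) \<otimes> r')"
proof -
  interpret mult_set R "cech_denoms R xs J" by (rule denoms_mult_set[OF J])
  note fin = finite_J[OF J]
  have "fraction J r n = fraction J r' m \<longleftrightarrow>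
      (\<exists>t\<in>cech_denoms R xs J. t \<otimes> (mpow J m \<otimes> r) = t \<otimes> (mpow J n \<otimes> r'))"
    unfolding fraction_def using r mpow_denoms[OF J] by (subst loc_frac_eq_iff) auto
  also have "\<dots> \<longleftrightarrow> (\<exists>k. mpow J (k + m) \<otimes> r = mpow J (k + n) \<otimes> r')"
  proof safe
    fix t assume t: "t \<in> cech_denoms R xs J" "t \<otimes> (mpow J m \<otimes> r) = t \<otimes> (mpow J n \<otimes> r')"
    obtain k c where c: "c \<in> carrier R" "t \<otimes> c = mpow J k" using denoms_dvd_mpow[OF J t(1)] by blast
    have "mpow J (k + m) \<otimes> r = c \<otimes> (t \<otimes> (mpow J m \<otimes> r))"
      unfolding mpow_add[OF fin] c(2)[symmetric] using c(1) t(1) r by (simp add: m_ac)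
    also have "\<dots> = mpow J (k + n) \<otimes> r'"
      unfolding mpow_add[OF fin] c(2)[symmetric] t(2) using c(1) t(1) r by (simp add: m_ac)
    finally show "\<exists>k. mpow J (k + m) \<otimes> r = mpow J (k + n) \<otimes> r'" by blast
  next
    fix k assume "mpow J (k + m) \<otimes> r = mpow J (k + n) \<otimes> r'"
    then show "\<exists>t\<in>cech_denoms R xs J. t \<otimes> (mpow J m \<otimes> r) = t \<otimes> (mpow J n \<otimes> r')"
      using r mpow_denoms[OF J] by (intro bexI[of _ "mpow J k"]) (auto simp: mpow_add fin m_assoc)
  qed
  finally show ?thesis .
qed

lemma fraction_raise:
  assumes J: "J \<subseteq> A" and r: "r \<in> carrier R"
  shows "fraction J (mpow J k \<otimes> r) (n + k) = fraction J r n"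
  using assms by (subst fraction_eq_iff) (auto simp: mpow_add finite_J m_ac intro!: exI[of _ 0])

lemma fraction_exists:
  assumes J: "J \<subseteq> A" and U: "U \<in> carrier (cech_loc R xs J)"
  shows "\<exists>N. \<forall>n\<ge>N. \<exists>r\<in>carrier R. U = fraction J r n"
proof -
  interpret mult_set R "cech_denoms R xs J" by (rule denoms_mult_set[OF J])
  obtain r s where r: "r \<in> carrier R" "s \<in> cech_denoms R xs J" "U = loc_frac R (cech_denoms R xs J) r s"
    using U by (auto simp: cech_loc_def localization_carrier)
  obtain N where N: "\<And>n. n \<ge> N \<Longrightarrow> \<exists>c\<in>carrier R. s \<otimes> c = mpow J n"
    using denoms_dvd_mpow[OF J r(2)] by blast
  show ?thesis
  proof (intro exI allI impI)
    fix n assume "n \<ge> N"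
    then obtain c where c: "c \<in> carrier R" "s \<otimes> c = mpow J n" using N by blast
    have "U = fraction J (c \<otimes> r) n"
      unfolding r(3) fraction_def using r(1,2) c mpow_denoms[OF J, of n] W_one
      by (subst loc_frac_eq_iff) (auto intro!: bexI[of _ \<one>] simp: m_ac c(2)[symmetric])
    then show "\<exists>r\<in>carrier R. U = fraction J r n" using c r by blast
  qed
qed

lemma fraction_add:
  assumes J: "J \<subseteq> A" and r: "r \<in> carrier R" "s \<in> carrier R"
  shows "fraction J r n \<oplus>\<^bsub>cech_loc R xs J\<^esub> fraction J s n = fraction J (r \<oplus> s) n"
proof -
  interpret mult_set R "cech_denoms R xs J" by (rule denoms_mult_set[OF J])
  have "fraction J r n \<oplus>\<^bsub>cech_loc R xs J\<^esub> fraction J s n = fraction J (r \<otimes> mpow J n \<oplus> s \<otimes> mpow J n) (n + n)"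
    unfolding fraction_def cech_loc_def using r mpow_denoms[OF J]
    by (subst localization_add) (auto simp: mpow_add finite_J[OF J])
  also have "\<dots> = fraction J (mpow J n \<otimes> (r \<oplus> s)) (n + n)" using r by (simp add: l_distr m_comm[of "mpow J n"])
  also have "\<dots> = fraction J (r \<oplus> s) n" using r J by (intro fraction_raise) auto
  finally show ?thesis .
qed

lemma fraction_mult:
  assumes J: "J \<subseteq> A" and r: "r \<in> carrier R" "s \<in> carrier R"
  shows "fraction J r n \<otimes>\<^bsub>cech_loc R xs J\<^esub> fraction J s m = fraction J (r \<otimes> s) (n + m)"
proof -
  interpret mult_set R "cech_denoms R xs J" by (rule denoms_mult_set[OF J])
  show ?thesis
    unfolding fraction_def cech_loc_def using r mpow_denoms[OF J]
    by (subst localization_mult) (auto simp: mpow_add finite_J[OF J])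
qed

lemma fraction_scalar: "loc_frac R (cech_denoms R xs J) a \<one> = fraction J a 0"
  by (simp add: fraction_def)

lemma fraction_zero:
  assumes J: "J \<subseteq> A"
  shows "\<zero>\<^bsub>cech_loc R xs J\<^esub> = fraction J \<zero> n"
proof -
  interpret mult_set R "cech_denoms R xs J" by (rule denoms_mult_set[OF J])
  have "\<zero>\<^bsub>cech_loc R xs J\<^esub> = fraction J \<zero> 0" by (simp add: cech_loc_def localization_zero fraction_scalar)
  also have "\<dots> = fraction J \<zero> n" using J by (subst fraction_eq_iff) auto
  finally show ?thesis .
qed

lemma fraction_one:
  assumes J: "J \<subseteq> A"
  shows "\<one>\<^bsub>cech_loc R xs J\<^esub> = fraction J \<one> 0"
proof -
  interpret mult_set R "cech_denoms R xs J" by (rule denoms_mult_set[OF J])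
  show ?thesis by (simp add: cech_loc_def localization_one fraction_scalar)
qed

lemma fraction_pow:
  assumes J: "J \<subseteq> A" and r: "r \<in> carrier R"
  shows "fraction J r n [^]\<^bsub>cech_loc R xs J\<^esub> (m::nat) = fraction J (r [^] m) (n * m)"
proof (induction m)
  case 0
  then show ?case using fraction_one[OF J] by (simp add: nat_pow_def)
next
  case (Suc m)
  have "fraction J r n [^]\<^bsub>cech_loc R xs J\<^esub> Suc m =
      (fraction J r n [^]\<^bsub>cech_loc R xs J\<^esub> m) \<otimes>\<^bsub>cech_loc R xs J\<^esub> fraction J r n"
    by (simp add: nat_pow_def)
  then show ?case using Suc fraction_mult[OF J, of "r [^] m" r] r by (simp add: add.commute)
qed

lemma fraction_common:
  assumes J: "J \<subseteq> A" and U: "finite U" "U \<subseteq> carrier (cech_loc R xs J)"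
  obtains n where "\<And>u. u \<in> U \<Longrightarrow> \<exists>r\<in>carrier R. u = fraction J r n"
proof -
  obtain N where "\<And>n u. n \<ge> N \<Longrightarrow> u \<in> U \<Longrightarrow> \<exists>r\<in>carrier R. u = fraction J r n"
    using eventually_common_bound[OF U(1), of "\<lambda>u n. \<exists>r\<in>carrier R. u = fraction J r n"] fraction_exists[OF J] U(2)
    by blast
  then show thesis using that by blast
qed

lemma cech_loc_abelian_group:
  assumes J: "J \<subseteq> A"
  shows "abelian_group (cech_loc R xs J)"
proof (rule abelian_groupI)
  let ?L = "cech_loc R xs J"
  show "\<zero>\<^bsub>?L\<^esub> \<in> carrier ?L" using fraction_zero[OF J, of 0] fraction_closed[OF J zero_closed] by simp
  show "u \<oplus>\<^bsub>?L\<^esub> v \<in> carrier ?L" "u \<oplus>\<^bsub>?L\<^esub> v = v \<oplus>\<^bsub>?L\<^esub> u"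
    if uv: "u \<in> carrier ?L" "v \<in> carrier ?L" for u v
  proof -
    obtain n where n: "\<And>w. w \<in> {u, v} \<Longrightarrow> \<exists>r\<in>carrier R. w = fraction J r n"
      using fraction_common[OF J, of "{u, v}"] uv by blast
    obtain r s where "r \<in> carrier R" "s \<in> carrier R" "u = fraction J r n" "v = fraction J s n"
      using n[of u] n[of v] by auto
    then show "u \<oplus>\<^bsub>?L\<^esub> v \<in> carrier ?L" "u \<oplus>\<^bsub>?L\<^esub> v = v \<oplus>\<^bsub>?L\<^esub> u"
      by (simp_all add: fraction_add[OF J] fraction_closed[OF J] a_comm)
  qed
  show "u \<oplus>\<^bsub>?L\<^esub> v \<oplus>\<^bsub>?L\<^esub> w = u \<oplus>\<^bsub>?L\<^esub> (v \<oplus>\<^bsub>?L\<^esub> w)"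
    if uvw: "u \<in> carrier ?L" "v \<in> carrier ?L" "w \<in> carrier ?L" for u v w
  proof -
    obtain n where n: "\<And>z. z \<in> {u, v, w} \<Longrightarrow> \<exists>r\<in>carrier R. z = fraction J r n"
      using fraction_common[OF J, of "{u, v, w}"] uvw by blast
    obtain r s t where "r \<in> carrier R" "s \<in> carrier R" "t \<in> carrier R" "u = fraction J r n" "v = fraction J s n" "w = fraction J t n"
      using n[of u] n[of v] n[of w] by auto
    then show ?thesis by (simp add: fraction_add[OF J] a_assoc)
  qed
  show "\<zero>\<^bsub>?L\<^esub> \<oplus>\<^bsub>?L\<^esub> u = u" if u: "u \<in> carrier ?L" for u
  proof -
    obtain r n where "r \<in> carrier R" "u = fraction J r n" using fraction_exists[OF J u] by blast
    then show ?thesis using fraction_zero[OF J, of n] by (simp add: fraction_add[OF J])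
  qed
  show "\<exists>v\<in>carrier ?L. v \<oplus>\<^bsub>?L\<^esub> u = \<zero>\<^bsub>?L\<^esub>" if u: "u \<in> carrier ?L" for u
  proof -
    obtain r n where "r \<in> carrier R" "u = fraction J r n" using fraction_exists[OF J u] by blast
    then show ?thesis using fraction_zero[OF J, of n]
      by (intro bexI[of _ "fraction J (\<ominus> r) n"]) (simp_all add: fraction_add[OF J] fraction_closed[OF J] l_neg)
  qed
qed

lemma fraction_minus:
  assumes J: "J \<subseteq> A" and r: "r \<in> carrier R"
  shows "\<ominus>\<^bsub>cech_loc R xs J\<^esub> fraction J r n = fraction J (\<ominus> r) n"
proof -
  interpret L: abelian_group "cech_loc R xs J" by (rule cech_loc_abelian_group[OF J])
  have "fraction J (\<ominus> r) n \<oplus>\<^bsub>cech_loc R xs J\<^esub> fraction J r n = \<zero>\<^bsub>cech_loc R xs J\<^esub>"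
    using r fraction_zero[OF J, of n] by (simp add: fraction_add[OF J] l_neg)
  then show ?thesis using r J by (intro L.minus_equality) (auto intro: fraction_closed)
qed

lemma fraction_finsum:
  assumes J: "J \<subseteq> A" and S: "finite S" "\<And>j. j \<in> S \<Longrightarrow> g j \<in> carrier R"
  shows "(\<Oplus>\<^bsub>cech_loc R xs J\<^esub>j\<in>S. fraction J (g j) n) = fraction J (\<Oplus>j\<in>S. g j) n"
proof -
  interpret L: abelian_group "cech_loc R xs J" by (rule cech_loc_abelian_group[OF J])
  show ?thesis
    using S
  proof (induction S)
    case empty
    then show ?case using fraction_zero[OF J, of n] by simp
  next
    case (insert j S)
    then show ?case using J by (simp add: Pi_iff fraction_closed fraction_add)
  qed
qed

lemma fraction_loc_map:
  assumes J: "J \<subseteq> A" and j: "j \<in> J" and r: "r \<in> carrier R"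
  shows "loc_map R (cech_denoms R xs J) (fraction (J - {j}) r n) = fraction J (gen j [^] n \<otimes> r) n"
proof -
  have K: "J - {j} \<subseteq> A" using J by auto
  interpret J: mult_set R "cech_denoms R xs J" by (rule denoms_mult_set[OF J])
  interpret K: mult_set R "cech_denoms R xs (J - {j})" by (rule denoms_mult_set[OF K])
  have "cech_denoms R xs (J - {j}) \<subseteq> cech_denoms R xs J" using J by (intro denoms_mono) auto
  then have "loc_map R (cech_denoms R xs J) (fraction (J - {j}) r n) =
      loc_frac R (cech_denoms R xs J) r (mpow (J - {j}) n)"
    unfolding fraction_def using r mpow_denoms[OF K] J.mult_set_axioms
    by (intro K.loc_map_loc_frac)
  also have "\<dots> = fraction J (gen j [^] n \<otimes> r) n"
  proof -
    have m: "mpow (J - {j}) n \<in> cech_denoms R xs J"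
      using mpow_denoms[OF K] denoms_mono[of "J - {j}" J] J by auto
    have "\<one> \<otimes> (mpow J n \<otimes> r) = \<one> \<otimes> (mpow (J - {j}) n \<otimes> (gen j [^] n \<otimes> r))"
      using mpow_remove[OF finite_J[OF J] j, of n] r by (simp add: m_ac)
    then show ?thesis
      unfolding fraction_def J.loc_frac_eq_iff[OF r m m_closed[OF nat_pow_closed[OF f_closed] r] mpow_denoms[OF J]]
      using J.W_one by blast
  qed
  finally show ?thesis .
qed

subsection \<open>Cochains\<close>

definition cochain :: "nat \<Rightarrow> (nat set \<Rightarrow> 'a) \<Rightarrow> nat \<Rightarrow> nat set \<Rightarrow> ('a \<times> 'a) set" where
  "cochain i r n = (\<lambda>J\<in>faces A i. fraction J (r J) n)"

lemma cochain_closed: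
  assumes "\<And>J. r J \<in> carrier R"
  shows "cochain i r n \<in> carrier (cech R xs i)"
  using assms by (auto simp: cochain_def cech_def cech_index_eq faces_subset fraction_closed)

text \<open>The components of a cochain are finite in number, so all sufficiently large levels serve as a common denominator.\<close>

lemma cochain_exists:
  assumes c: "c \<in> carrier (cech R xs i)"
  shows "\<exists>N. \<forall>n\<ge>N. \<exists>r. (\<forall>J. r J \<in> carrier R) \<and> c = cochain i r n"
proof -
  have cJ: "c J \<in> carrier (cech_loc R xs J)" if "J \<in> faces A i" for J
    using c that by (auto simp: cech_def cech_index_eq)
  have ext: "c \<in> extensional (faces A i)"
    using c by (auto simp: cech_def cech_index_eq PiE_def)
  obtain N where N: "\<And>n J. n \<ge> N \<Longrightarrow> J \<in> faces A i \<Longrightarrow> \<exists>r\<in>carrier R. c J = fraction J r n"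
    using eventually_common_bound[OF finite_faces_set, of i "\<lambda>J n. \<exists>r\<in>carrier R. c J = fraction J r n"]
      fraction_exists[OF faces_subset cJ] by blast
  show ?thesis
  proof (rule exI[of _ N], intro allI impI)
    fix n assume "n \<ge> N"
    then obtain r where r: "\<And>J. J \<in> faces A i \<Longrightarrow> r J \<in> carrier R \<and> c J = fraction J (r J) n"
      using N by metis
    show "\<exists>r. (\<forall>J. r J \<in> carrier R) \<and> c = cochain i r n"
    proof (intro exI conjI)
      show "\<forall>J. (if J \<in> faces A i then r J else \<zero>) \<in> carrier R" using r by auto
      show "c = cochain i (\<lambda>J. if J \<in> faces A i then r J else \<zero>) n"
        using ext r by (intro extensionalityI[of _ "faces A i"]) (auto simp: cochain_def)
    qed
  qed
qed

lemma cochain_eq_iff: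
  assumes r: "\<And>J. r J \<in> carrier R" "\<And>J. r' J \<in> carrier R"
  shows "cochain i r n = cochain i r' m \<longleftrightarrow> (\<exists>k. \<forall>J\<in>faces A i. mpow J (k + m) \<otimes> r J = mpow J (k + n) \<otimes> r' J)"
proof -
  have "cochain i r n = cochain i r' m \<longleftrightarrow> (\<forall>J\<in>faces A i. fraction J (r J) n = fraction J (r' J) m)"
    by (auto simp: cochain_def restrict_def fun_eq_iff)
  also have "\<dots> \<longleftrightarrow> (\<forall>J\<in>faces A i. \<exists>k. mpow J (k + m) \<otimes> r J = mpow J (k + n) \<otimes> r' J)"
    using fraction_eq_iff[OF faces_subset r] by simp
  also have "\<dots> \<longleftrightarrow> (\<exists>k. \<forall>J\<in>faces A i. mpow J (k + m) \<otimes> r J = mpow J (k + n) \<otimes> r' J)"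
  proof
    assume L: "\<forall>J\<in>faces A i. \<exists>k. mpow J (k + m) \<otimes> r J = mpow J (k + n) \<otimes> r' J"
    have "\<exists>N. \<forall>k\<ge>N. mpow J (k + m) \<otimes> r J = mpow J (k + n) \<otimes> r' J" if J: "J \<in> faces A i" for J
    proof -
      note fin = finite_J[OF faces_subset[OF J]]
      obtain N where N: "mpow J (N + m) \<otimes> r J = mpow J (N + n) \<otimes> r' J" using L J by blast
      have "mpow J (N + l + m) \<otimes> r J = mpow J (N + l + n) \<otimes> r' J" for l
      proof -
        have "mpow J (N + l + m) \<otimes> r J = mpow J l \<otimes> (mpow J (N + m) \<otimes> r J)"
          using r by (simp add: mpow_add[OF fin] m_ac)
        also have "\<dots> = mpow J (N + l + n) \<otimes> r' J"
          unfolding N using r by (simp add: mpow_add[OF fin] m_ac)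
        finally show ?thesis .
      qed
      then show ?thesis by (metis le_Suc_ex)
    qed
    then obtain N where "\<And>k J. k \<ge> N \<Longrightarrow> J \<in> faces A i \<Longrightarrow> mpow J (k + m) \<otimes> r J = mpow J (k + n) \<otimes> r' J"
      using eventually_common_bound[OF finite_faces_set, of i "\<lambda>J k. mpow J (k + m) \<otimes> r J = mpow J (k + n) \<otimes> r' J"]
      by blast
    then show "\<exists>k. \<forall>J\<in>faces A i. mpow J (k + m) \<otimes> r J = mpow J (k + n) \<otimes> r' J" by blast
  qed auto
  finally show ?thesis .
qed

lemma cochain_raise:
  assumes r: "\<And>J. r J \<in> carrier R"
  shows "cochain i (\<lambda>J. mpow J k \<otimes> r J) (n + k) = cochain i r n"
  unfolding cochain_def using r by (intro restrict_ext) (auto intro!: fraction_raise[OF faces_subset])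

lemma cochain_add:
  assumes "\<And>J. r J \<in> carrier R" "\<And>J. s J \<in> carrier R"
  shows "cochain i r n \<oplus>\<^bsub>cech R xs i\<^esub> cochain i s n = cochain i (\<lambda>J. r J \<oplus> s J) n"
  unfolding cochain_def cech_def cech_index_eq using assms
  by (auto intro!: restrict_ext simp: fraction_add faces_subset)

lemma cochain_smult:
  assumes "\<And>J. r J \<in> carrier R" "a \<in> carrier R"
  shows "a \<odot>\<^bsub>cech R xs i\<^esub> cochain i r n = cochain i (\<lambda>J. a \<otimes> r J) n"
  unfolding cochain_def cech_def cech_index_eq using assms
  by (auto intro!: restrict_ext simp: fraction_scalar fraction_mult faces_subset)

lemma cochain_zero: "\<zero>\<^bsub>cech R xs i\<^esub> = cochain i (\<lambda>_. \<zero>) n"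
  unfolding cochain_def cech_def cech_index_eq by (auto intro!: restrict_ext fraction_zero[OF faces_subset])

lemma cochain_pow:
  assumes r: "\<And>J. r J \<in> carrier R"
  shows "cochain i r n [^]\<^bsub>cech R xs i\<^esub> (m::nat) = cochain i (\<lambda>J. r J [^] m) (n * m)"
proof -
  have "c [^]\<^bsub>cech R xs i\<^esub> (m::nat) = (\<lambda>J\<in>faces A i. c J [^]\<^bsub>cech_loc R xs J\<^esub> m)" for c m
    by (induction m) (auto simp: nat_pow_def cech_def cech_index_eq restrict_def fun_eq_iff)
  then show ?thesis
    using r by (auto simp: cochain_def fraction_pow faces_subset intro!: restrict_ext)
qed

lemma cech_diff_cochain:
  assumes r: "\<And>J. r J \<in> carrier R"
  shows "cech_diff R xs i (cochain i r n) = cochain (Suc i) (kdiff n r) n"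
  unfolding cech_diff_def cech_index_eq cochain_def[of "Suc i"]
proof (intro restrict_ext)
  fix J assume J: "J \<in> faces A (Suc i)"
  note JA = faces_subset[OF J] and fin = finite_J[OF faces_subset[OF J]]
  interpret L: abelian_group "cech_loc R xs J" by (rule cech_loc_abelian_group[OF JA])
  let ?y = "\<lambda>j. loc_map R (cech_denoms R xs J) (cochain i r n (J - {j}))"
  have y: "?y j = fraction J (gen j [^] n \<otimes> r (J - {j})) n" if "j \<in> J" for j
    using faces_remove[OF J that] r by (simp add: cochain_def fraction_loc_map[OF JA that])
  have "(\<Oplus>\<^bsub>cech_loc R xs J\<^esub>j\<in>J. let y = ?y j in
      if even (card {k \<in> J. k < j}) then y else \<ominus>\<^bsub>cech_loc R xs J\<^esub> y) =
    (\<Oplus>\<^bsub>cech_loc R xs J\<^esub>j\<in>J. fraction J (face_sign J j \<otimes> (gen j [^] n \<otimes> r (J - {j}))) n)"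
    using r JA by (intro L.finsum_cong') (auto simp: y face_sign_def fraction_minus l_minus fraction_closed)
  also have "\<dots> = fraction J (kdiff n r J) n"
    unfolding kdiff_def using r by (intro fraction_finsum[OF JA fin]) auto
  finally show "(\<Oplus>\<^bsub>cech_loc R xs J\<^esub>j\<in>J. let y = ?y j in
      if even (card {k \<in> J. k < j}) then y else \<ominus>\<^bsub>cech_loc R xs J\<^esub> y) = fraction J (kdiff n r J) n" .
qed

lemma cochain_common:
  assumes "finite C" "C \<subseteq> carrier (cech R xs i)"
  obtains n where "\<And>c. c \<in> C \<Longrightarrow> \<exists>r. (\<forall>J. r J \<in> carrier R) \<and> c = cochain i r n"
proof -
  obtain N where "\<And>n c. n \<ge> N \<Longrightarrow> c \<in> C \<Longrightarrow> \<exists>r. (\<forall>J. r J \<in> carrier R) \<and> c = cochain i r n"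
    using eventually_common_bound[OF assms(1), of "\<lambda>c n. \<exists>r. (\<forall>J. r J \<in> carrier R) \<and> c = cochain i r n"]
      cochain_exists assms(2) by blast
  then show thesis using that by blast
qed

lemma cech_module: "module R (cech R xs i)"
proof (rule moduleI)
  let ?C = "cech R xs i"
  have two: "\<exists>r s n. (\<forall>J. r J \<in> carrier R) \<and> (\<forall>J. s J \<in> carrier R) \<and> u = cochain i r n \<and> v = cochain i s n"
    if uv: "u \<in> carrier ?C" "v \<in> carrier ?C" for u v
  proof -
    obtain n where n: "\<And>w. w \<in> {u, v} \<Longrightarrow> \<exists>r. (\<forall>J. r J \<in> carrier R) \<and> w = cochain i r n"
      using cochain_common[of "{u, v}" i] uv by blast
    obtain r where r: "\<forall>J. r J \<in> carrier R" "u = cochain i r n" using n[of u] by auto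
    obtain s where s: "\<forall>J. s J \<in> carrier R" "v = cochain i s n" using n[of v] by auto
    show ?thesis using r s by (intro exI[of _ r] exI[of _ s] exI[of _ n]) simp
  qed
  have one: "\<exists>r n. (\<forall>J. r J \<in> carrier R) \<and> u = cochain i r n" if u: "u \<in> carrier ?C" for u
    using cochain_exists[OF u] by blast
  show "abelian_group ?C"
  proof (rule abelian_groupI)
    show "\<zero>\<^bsub>?C\<^esub> \<in> carrier ?C" unfolding cochain_zero[of i 0] by (rule cochain_closed) simp
    show "u \<oplus>\<^bsub>?C\<^esub> v \<in> carrier ?C" "u \<oplus>\<^bsub>?C\<^esub> v = v \<oplus>\<^bsub>?C\<^esub> u"
      if uv: "u \<in> carrier ?C" "v \<in> carrier ?C" for u v
      using two[OF uv] by (auto simp: cochain_add cochain_closed a_comm)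
    show "u \<oplus>\<^bsub>?C\<^esub> v \<oplus>\<^bsub>?C\<^esub> w = u \<oplus>\<^bsub>?C\<^esub> (v \<oplus>\<^bsub>?C\<^esub> w)"
      if uvw: "u \<in> carrier ?C" "v \<in> carrier ?C" "w \<in> carrier ?C" for u v w
    proof -
      obtain n where n: "\<And>z. z \<in> {u, v, w} \<Longrightarrow> \<exists>r. (\<forall>J. r J \<in> carrier R) \<and> z = cochain i r n"
        using cochain_common[of "{u, v, w}" i] uvw by blast
      obtain r where r: "\<forall>J. r J \<in> carrier R" "u = cochain i r n" using n[of u] by auto
      obtain s where s: "\<forall>J. s J \<in> carrier R" "v = cochain i s n" using n[of v] by auto
      obtain t where t: "\<forall>J. t J \<in> carrier R" "w = cochain i t n" using n[of w] by auto
      show ?thesis using r s t by (simp add: cochain_add a_assoc)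
    qed
    show "\<zero>\<^bsub>?C\<^esub> \<oplus>\<^bsub>?C\<^esub> u = u" if u: "u \<in> carrier ?C" for u
    proof -
      obtain r n where "\<And>J. r J \<in> carrier R" "u = cochain i r n" using one[OF u] by blast
      then show ?thesis by (simp add: cochain_zero[of i n] cochain_add)
    qed
    show "\<exists>v\<in>carrier ?C. v \<oplus>\<^bsub>?C\<^esub> u = \<zero>\<^bsub>?C\<^esub>" if u: "u \<in> carrier ?C" for u
    proof -
      obtain r n where "\<And>J. r J \<in> carrier R" "u = cochain i r n" using one[OF u] by blast
      then show ?thesis
        by (intro bexI[of _ "cochain i (\<lambda>J. \<ominus> r J) n"]) (simp_all add: cochain_zero[of i n] cochain_add cochain_closed l_neg)
    qed
  qed
  show "a \<odot>\<^bsub>?C\<^esub> u \<in> carrier ?C" if "a \<in> carrier R" "u \<in> carrier ?C" for a u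
    using one[OF that(2)] that(1) by (auto simp: cochain_smult cochain_closed)
  show "(a \<oplus> b) \<odot>\<^bsub>?C\<^esub> u = (a \<odot>\<^bsub>?C\<^esub> u) \<oplus>\<^bsub>?C\<^esub> (b \<odot>\<^bsub>?C\<^esub> u)"
    if "a \<in> carrier R" "b \<in> carrier R" "u \<in> carrier ?C" for a b u
    using one[OF that(3)] that(1,2) by (auto simp: cochain_smult cochain_add l_distr)
  show "a \<odot>\<^bsub>?C\<^esub> (u \<oplus>\<^bsub>?C\<^esub> v) = (a \<odot>\<^bsub>?C\<^esub> u) \<oplus>\<^bsub>?C\<^esub> (a \<odot>\<^bsub>?C\<^esub> v)"
    if "a \<in> carrier R" "u \<in> carrier ?C" "v \<in> carrier ?C" for a u v
    using two[OF that(2,3)] that(1) by (auto simp: cochain_smult cochain_add r_distr)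
  show "(a \<otimes> b) \<odot>\<^bsub>?C\<^esub> u = a \<odot>\<^bsub>?C\<^esub> (b \<odot>\<^bsub>?C\<^esub> u)"
    if "a \<in> carrier R" "b \<in> carrier R" "u \<in> carrier ?C" for a b u
    using one[OF that(3)] that(1,2) by (auto simp: cochain_smult m_assoc)
  show "\<one> \<odot>\<^bsub>?C\<^esub> u = u" if "u \<in> carrier ?C" for u
    using one[OF that] by (auto simp: cochain_smult)
qed (rule is_cring)

subsection \<open>Cocycles and coboundaries\<close>

lemma cochain_is_cocycle:
  assumes r: "\<And>J. r J \<in> carrier R" and cocycle: "cocycle A i n r"
  shows "cochain i r n \<in> cech_cocycles R xs i"
proof -
  have "cochain (Suc i) (kdiff n r) n = \<zero>\<^bsub>cech R xs (Suc i)\<^esub>"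
    unfolding cochain_zero[of _ n] using cocycle by (auto simp: cochain_def cocycle_def intro!: restrict_ext)
  then show ?thesis using r cochain_closed[of r] by (simp add: cech_cocycles_def cech_diff_cochain)
qed

text \<open>A Cech cocycle only gives numerators whose Koszul differential is killed by a power of the product of the
generators; raising the level by that power makes the differential vanish identically.\<close>

lemma cocycle_exists:
  assumes c: "c \<in> cech_cocycles R xs i"
  shows "\<exists>N. \<forall>n\<ge>N. \<exists>r. (\<forall>J. r J \<in> carrier R) \<and> cocycle A i n r \<and> c = cochain i r n"
proof -
  have "c \<in> carrier (cech R xs i)" using c by (simp add: cech_cocycles_def)
  then obtain r n where r: "\<And>J. r J \<in> carrier R" and cr: "c = cochain i r n"
    using cochain_exists[of c i] by blast
  have "cochain (Suc i) (kdiff n r) n = cochain (Suc i) (\<lambda>_. \<zero>) 0"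
    using c r by (simp add: cech_cocycles_def cr cech_diff_cochain cochain_zero[of _ 0])
  then obtain k where k: "\<And>J. J \<in> faces A (Suc i) \<Longrightarrow> mpow J k \<otimes> kdiff n r J = \<zero>"
    using cochain_eq_iff[of "kdiff n r" "\<lambda>_. \<zero>" "Suc i" n 0] kdiff_closed[of r] r by auto
  have 1: "cocycle A i (n + k) (\<lambda>J. mpow J k \<otimes> r J)"
    using k r by (simp add: cocycle_def kdiff_mpow finite_faces)
  have 2: "c = cochain i (\<lambda>J. mpow J k \<otimes> r J) (n + k)" using cochain_raise[of r i k n] r cr by simp
  show ?thesis
  proof (rule exI[of _ "n + k"], intro allI impI)
    fix m assume "m \<ge> n + k"
    then obtain l where m: "m = n + k + l" by (metis le_Suc_ex)
    let ?s = "\<lambda>J. mpow J k \<otimes> r J"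
    have "cocycle A i m (\<lambda>J. mpow J l \<otimes> ?s J)" unfolding m by (rule cocycle_mpow[OF _ _ 1]) (use r in auto)
    moreover have "c = cochain i (\<lambda>J. mpow J l \<otimes> ?s J) m" using 2 cochain_raise[of ?s i l "n + k"] r m by simp
    ultimately show "\<exists>r. (\<forall>J. r J \<in> carrier R) \<and> cocycle A i m r \<and> c = cochain i r m"
      using r by (intro exI[of _ "\<lambda>J. mpow J l \<otimes> ?s J"]) auto
  qed
qed

lemma cochain_coboundary_iff:
  assumes r: "\<And>J. r J \<in> carrier R"
  shows "cochain i r n \<in> cech_coboundaries R xs i \<longleftrightarrow> ev_bdry A i n r"
proof (cases i)
  case 0
  have "cochain 0 r n \<in> cech_coboundaries R xs 0 \<longleftrightarrow> cochain 0 r n = cochain 0 (\<lambda>_. \<zero>) 0"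
    by (simp add: cochain_zero[of _ 0])
  also have "\<dots> \<longleftrightarrow> (\<exists>k. \<forall>J\<in>faces A 0. mpow J k \<otimes> r J = \<zero>)"
    using r by (subst cochain_eq_iff) auto
  also have "\<dots> \<longleftrightarrow> ev_bdry A 0 n r"
  proof -
    have "kdiff m e J = \<zero>" if "J \<in> faces A 0" for J m e
      using that finite_J[of J] by (auto simp: faces_def kdiff_def)
    then show ?thesis by (auto simp: ev_bdry_def intro!: exI[of _ "\<lambda>_. \<zero>"])
  qed
  finally show ?thesis using 0 by simp
next
  case (Suc h)
  show ?thesis
  proof
    assume "cochain i r n \<in> cech_coboundaries R xs i"
    then obtain c where c: "c \<in> carrier (cech R xs h)" "cochain i r n = cech_diff R xs h c"
      by (auto simp: Suc)
    obtain e m where e: "\<And>J. e J \<in> carrier R" "c = cochain h e m" using cochain_exists[OF c(1)] by blast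
    have "cochain i r n = cochain i (kdiff m e) m" using c e by (simp add: Suc cech_diff_cochain)
    then obtain k where k: "\<And>J. J \<in> faces A i \<Longrightarrow> mpow J (k + m) \<otimes> r J = mpow J (k + n) \<otimes> kdiff m e J"
      using cochain_eq_iff[of r "kdiff m e" i n m] kdiff_closed[of e] r e by auto
    show "ev_bdry A i n r"
    proof (rule ev_bdryI)
      fix J assume J: "J \<in> faces A i"
      have "mpow J (k + m) \<otimes> r J = kdiff (m + (k + n)) (\<lambda>J. mpow J (k + n) \<otimes> e J) J"
        unfolding k[OF J] using e J by (subst kdiff_mpow) (auto intro: finite_faces)
      then show "mpow J (k + m) \<otimes> r J = kdiff (n + (k + m)) (\<lambda>J. mpow J (k + n) \<otimes> e J) J"
        by (simp add: ac_simps)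
    qed (use e in auto)
  next
    assume "ev_bdry A i n r"
    then obtain k e where e: "\<And>J. e J \<in> carrier R"
      "\<And>J. J \<in> faces A i \<Longrightarrow> mpow J k \<otimes> r J = kdiff (n + k) e J" by (rule ev_bdryE) blast
    have "cochain i r n = cochain i (kdiff (n + k) e) (n + k)"
      using r e kdiff_closed[of e]
      by (subst cochain_eq_iff) (auto intro!: exI[of _ 0] simp: mpow_add finite_faces m_assoc)
    also have "\<dots> = cech_diff R xs h (cochain h e (n + k))" using e by (simp add: Suc cech_diff_cochain)
    finally show "cochain i r n \<in> cech_coboundaries R xs i" using e(1) cochain_closed[of e h] by (auto simp: Suc)
  qed
qed

end

section \<open>Cech cohomology and its Frobenius action\<close>

context cech_ring
begin

abbreviation cocycle_module where
  "cocycle_module i \<equiv> (cech R xs i)\<lparr>carrier := cech_cocycles R xs i\<rparr>"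

lemma cocycle_pair_obtain:
  assumes "c \<in> cech_cocycles R xs i" "d \<in> cech_cocycles R xs i"
  obtains n r s where "\<And>J. r J \<in> carrier R" "cocycle A i n r" "c = cochain i r n"
    "\<And>J. s J \<in> carrier R" "cocycle A i n s" "d = cochain i s n"
proof -
  obtain N where N: "\<And>n. n \<ge> N \<Longrightarrow> \<exists>r. (\<forall>J. r J \<in> carrier R) \<and> cocycle A i n r \<and> c = cochain i r n"
    using cocycle_exists[OF assms(1)] by blast
  obtain N' where N': "\<And>n. n \<ge> N' \<Longrightarrow> \<exists>r. (\<forall>J. r J \<in> carrier R) \<and> cocycle A i n r \<and> d = cochain i r n"
    using cocycle_exists[OF assms(2)] by blast
  obtain r where r: "\<forall>J. r J \<in> carrier R" "cocycle A i (max N N') r" "c = cochain i r (max N N')"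
    using N[of "max N N'"] by auto
  obtain s where s: "\<forall>J. s J \<in> carrier R" "cocycle A i (max N N') s" "d = cochain i s (max N N')"
    using N'[of "max N N'"] by auto
  show thesis by (rule that[of r "max N N'" s]) (use r s in auto)
qed

lemma cocycle_obtain:
  assumes "c \<in> cech_cocycles R xs i"
  obtains n r where "\<And>J. r J \<in> carrier R" "cocycle A i n r" "c = cochain i r n"
  using cocycle_exists[OF assms] by blast

lemma cocycles_submodule: "submodule (cech_cocycles R xs i) R (cech R xs i)"
proof -
  interpret C: module R "cech R xs i" by (rule cech_module)
  show ?thesis
  proof (rule C.submodule_from_smult)
    show "cech_cocycles R xs i \<subseteq> carrier (cech R xs i)" by (auto simp: cech_cocycles_def)
    show "\<zero>\<^bsub>cech R xs i\<^esub> \<in> cech_cocycles R xs i"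
      unfolding cochain_zero[of i 0] by (rule cochain_is_cocycle) (auto simp: cocycle_def kdiff_def)
    show "c \<oplus>\<^bsub>cech R xs i\<^esub> d \<in> cech_cocycles R xs i"
      if cd: "c \<in> cech_cocycles R xs i" "d \<in> cech_cocycles R xs i" for c d
      using cd by (rule cocycle_pair_obtain) (simp add: cochain_add cochain_is_cocycle cocycle_add)
    show "a \<odot>\<^bsub>cech R xs i\<^esub> c \<in> cech_cocycles R xs i"
      if a: "a \<in> carrier R" and c: "c \<in> cech_cocycles R xs i" for a c
      using c by (rule cocycle_obtain) (use a in \<open>simp add: cochain_smult cochain_is_cocycle cocycle_smult\<close>)
  qed
qed

lemma cocycle_module_module: "module R (cocycle_module i)"
  by (rule submodule.submodule_is_module[OF cocycles_submodule cech_module])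

lemma coboundary_cocycle:
  assumes "c \<in> cech_coboundaries R xs i"
  shows "c \<in> cech_cocycles R xs i"
proof (cases i)
  case 0
  then show ?thesis using assms submodule.axioms(1)[OF cocycles_submodule[of i]]
    by (auto dest: subgroup.one_closed)
next
  case (Suc h)
  then obtain b where b: "b \<in> carrier (cech R xs h)" "c = cech_diff R xs h b" using assms by auto
  obtain e m where e: "\<And>J. e J \<in> carrier R" "b = cochain h e m" using cochain_exists[OF b(1)] by blast
  have "c = cochain i (kdiff m e) m" using b e by (simp add: Suc cech_diff_cochain)
  then show ?thesis using e(1) by (auto intro: cochain_is_cocycle cocycle_kdiff)
qed

lemma coboundaries_submodule: "submodule (cech_coboundaries R xs i) R (cocycle_module i)"
proof -
  interpret Z: module R "cocycle_module i" by (rule cocycle_module_module)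
  show ?thesis
  proof (rule Z.submodule_from_smult)
    show "cech_coboundaries R xs i \<subseteq> carrier (cocycle_module i)"
      using coboundary_cocycle by auto
    have "cochain i (\<lambda>_. \<zero>) 0 \<in> cech_coboundaries R xs i"
      by (subst cochain_coboundary_iff) (auto simp: ev_bdry_def kdiff_def intro!: exI[of _ 0] exI[of _ "\<lambda>_. \<zero>"])
    then show "\<zero>\<^bsub>cocycle_module i\<^esub> \<in> cech_coboundaries R xs i"
      using cochain_zero[of i 0] by simp
    show "c \<oplus>\<^bsub>cocycle_module i\<^esub> d \<in> cech_coboundaries R xs i"
      if cd: "c \<in> cech_coboundaries R xs i" "d \<in> cech_coboundaries R xs i" for c d
      using cd by (rule cocycle_pair_obtain[OF coboundary_cocycle coboundary_cocycle])
        (use cd in \<open>simp add: cochain_add cochain_coboundary_iff ev_bdry_add\<close>)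
    show "a \<odot>\<^bsub>cocycle_module i\<^esub> c \<in> cech_coboundaries R xs i"
      if a: "a \<in> carrier R" and c: "c \<in> cech_coboundaries R xs i" for a c
      using c by (rule cocycle_obtain[OF coboundary_cocycle])
        (use a c in \<open>simp add: cochain_smult cochain_coboundary_iff ev_bdry_smult\<close>)
  qed
qed

lemma cech_cohomology_module: "module R (cech_cohomology R xs i)"
  unfolding cech_cohomology_def
  by (rule module.quot_module_module[OF cocycle_module_module coboundaries_submodule])

text \<open>The cohomology class of the fractions with numerators \<open>r\<close> at level \<open>n\<close>, for a Koszul cocycle \<open>r\<close>.\<close>

definition coh_class :: "nat \<Rightarrow> (nat set \<Rightarrow> 'a) \<Rightarrow> nat \<Rightarrow> (nat set \<Rightarrow> ('a \<times> 'a) set) set" where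
  "coh_class i r n = cech_coboundaries R xs i +>\<^bsub>cech R xs i\<^esub> cochain i r n"

lemma coset_restrict: "N +>\<^bsub>cocycle_module i\<^esub> u = N +>\<^bsub>cech R xs i\<^esub> u"
  by (simp add: a_r_coset_def')

lemma cohomology_carrier:
  "U \<in> carrier (cech_cohomology R xs i) \<longleftrightarrow>
    (\<exists>c\<in>cech_cocycles R xs i. U = cech_coboundaries R xs i +>\<^bsub>cech R xs i\<^esub> c)"
  unfolding cech_cohomology_def module.quot_module_carrier[OF cocycle_module_module] coset_restrict
  by auto

lemma coh_class_closed:
  assumes "\<And>J. r J \<in> carrier R" "cocycle A i n r"
  shows "coh_class i r n \<in> carrier (cech_cohomology R xs i)"
  unfolding cohomology_carrier coh_class_def using cochain_is_cocycle[OF assms] by blast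

lemma coh_class_eq_iff:
  assumes r: "\<And>J. r J \<in> carrier R" "cocycle A i n r" and s: "\<And>J. s J \<in> carrier R" "cocycle A i n s"
  shows "coh_class i r n = coh_class i s n \<longleftrightarrow> ev_bdry A i n (\<lambda>J. r J \<ominus> s J)"
proof -
  interpret Z: module R "cocycle_module i" by (rule cocycle_module_module)
  have c: "cochain i r n \<in> cech_cocycles R xs i" "cochain i s n \<in> cech_cocycles R xs i"
    using cochain_is_cocycle[OF r] cochain_is_cocycle[OF s] by auto
  have "\<ominus>\<^bsub>cocycle_module i\<^esub> cochain i s n = (\<ominus> \<one>) \<odot>\<^bsub>cocycle_module i\<^esub> cochain i s n"
    using c Z.smult_l_minus[of \<one> "cochain i s n"] Z.smult_one[of "cochain i s n"] by simp
  also have "\<dots> = cochain i (\<lambda>J. \<ominus> s J) n" using s by (simp add: cochain_smult l_minus)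
  finally have m: "cochain i r n \<ominus>\<^bsub>cocycle_module i\<^esub> cochain i s n = cochain i (\<lambda>J. r J \<ominus> s J) n"
    using r s by (simp add: Z.M.minus_eq cochain_add minus_eq)
  show ?thesis
    unfolding coh_class_def coset_restrict[symmetric]
    using Z.coset_eq_iff[OF coboundaries_submodule, of "cochain i r n" "cochain i s n"] c r s
    by (simp add: m cochain_coboundary_iff)
qed

lemma coh_class_zero_iff:
  assumes r: "\<And>J. r J \<in> carrier R" "cocycle A i n r"
  shows "coh_class i r n = cech_coboundaries R xs i \<longleftrightarrow> ev_bdry A i n r"
  unfolding coh_class_def coset_restrict[symmetric]
  using module.coset_eq_zero_iff[OF cocycle_module_module coboundaries_submodule, of "cochain i r n"]
    cochain_is_cocycle[OF r] r by (simp add: cochain_coboundary_iff)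

lemma coh_class_raise:
  assumes "\<And>J. r J \<in> carrier R"
  shows "coh_class i (\<lambda>J. mpow J k \<otimes> r J) (n + k) = coh_class i r n"
  using cochain_raise[of r] assms by (simp add: coh_class_def)

lemma coh_class_smult:
  assumes "\<And>J. r J \<in> carrier R" "cocycle A i n r" "a \<in> carrier R"
  shows "a \<odot>\<^bsub>cech_cohomology R xs i\<^esub> coh_class i r n = coh_class i (\<lambda>J. a \<otimes> r J) n"
  unfolding cech_cohomology_def coh_class_def coset_restrict[symmetric]
  using module.quot_module_smult[OF cocycle_module_module coboundaries_submodule, of a "cochain i r n"]
    cochain_is_cocycle assms by (simp add: cochain_smult)

lemma coh_class_add:
  assumes "\<And>J. r J \<in> carrier R" "cocycle A i n r" "\<And>J. s J \<in> carrier R" "cocycle A i n s"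
  shows "coh_class i r n \<oplus>\<^bsub>cech_cohomology R xs i\<^esub> coh_class i s n = coh_class i (\<lambda>J. r J \<oplus> s J) n"
  unfolding cech_cohomology_def coh_class_def coset_restrict[symmetric]
  using module.quot_module_add[OF cocycle_module_module coboundaries_submodule, of "cochain i r n" _ "cochain i s n"]
    cochain_is_cocycle assms by (simp add: cochain_add)

lemma coh_class_minus:
  assumes r: "\<And>J. r J \<in> carrier R" "cocycle A i n r" and s: "\<And>J. s J \<in> carrier R" "cocycle A i n s"
  shows "coh_class i r n \<ominus>\<^bsub>cech_cohomology R xs i\<^esub> coh_class i s n = coh_class i (\<lambda>J. r J \<ominus> s J) n"
proof -
  interpret H: module R "cech_cohomology R xs i" by (rule cech_cohomology_module)
  have "\<ominus>\<^bsub>cech_cohomology R xs i\<^esub> coh_class i s n = (\<ominus> \<one>) \<odot>\<^bsub>cech_cohomology R xs i\<^esub> coh_class i s n"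
    using coh_class_closed[OF s] by (simp add: H.smult_l_minus)
  also have "\<dots> = coh_class i (\<lambda>J. \<ominus> \<one> \<otimes> s J) n" by (rule coh_class_smult[OF s]) simp
  finally have "coh_class i r n \<ominus>\<^bsub>cech_cohomology R xs i\<^esub> coh_class i s n = coh_class i (\<lambda>J. r J \<oplus> \<ominus> \<one> \<otimes> s J) n"
    using coh_class_add[OF r, of "\<lambda>J. \<ominus> \<one> \<otimes> s J"] cocycle_smult[OF s(1) _ s(2), of "\<ominus> \<one>"] s(1)
    by (simp add: H.M.minus_eq)
  then show ?thesis using s(1) by (simp add: minus_eq l_minus)
qed

lemma class_pair_obtain:
  assumes "U \<in> carrier (cech_cohomology R xs i)" "V \<in> carrier (cech_cohomology R xs i)"
  obtains n r s where "\<And>J. r J \<in> carrier R" "cocycle A i n r" "U = coh_class i r n"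
    "\<And>J. s J \<in> carrier R" "cocycle A i n s" "V = coh_class i s n"
proof -
  obtain c where c: "c \<in> cech_cocycles R xs i" "U = cech_coboundaries R xs i +>\<^bsub>cech R xs i\<^esub> c"
    using assms(1) unfolding cohomology_carrier by blast
  obtain d where d: "d \<in> cech_cocycles R xs i" "V = cech_coboundaries R xs i +>\<^bsub>cech R xs i\<^esub> d"
    using assms(2) unfolding cohomology_carrier by blast
  show thesis
    by (rule cocycle_pair_obtain[OF c(1) d(1)], rule that) (simp_all add: c(2) d(2) coh_class_def)
qed

end

locale cech_char_p = cech_ring R xs + char_p_ring R p for R (structure) and xs p
begin

sublocale koszul_char_p R gen p
  by unfold_locales

text \<open>The action is the union over all representatives of a class. They differ by coboundaries, and the
\<open>p\<close>-th power of a difference is the difference of the \<open>p\<close>-th powers, so Frobenius maps them to cohomologous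
cocycles.\<close>

lemma cech_frobenius_coh_class:
  assumes r: "\<And>J. r J \<in> carrier R" "cocycle A i n r"
  shows "cech_frobenius p R xs i (coh_class i r n) = coh_class i (\<lambda>J. r J [^] p) (n * p)"
proof -
  interpret Z: module R "cocycle_module i" by (rule cocycle_module_module)
  interpret B: abelian_subgroup "cech_coboundaries R xs i" "cocycle_module i"
    by (rule Z.submodule_abelian_subgroup[OF coboundaries_submodule])
  let ?c = "cochain i r n"
  have c: "?c \<in> carrier (cocycle_module i)" using cochain_is_cocycle[OF r] by simp
  have self: "?c \<in> coh_class i r n"
    using B.a_rcos_self[OF c] by (simp add: coh_class_def coset_restrict)
  have "cech_coboundaries R xs i +>\<^bsub>cech R xs i\<^esub> (d [^]\<^bsub>cech R xs i\<^esub> p) = coh_class i (\<lambda>J. r J [^] p) (n * p)"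
    if d: "d \<in> coh_class i r n" for d
  proof -
    have d': "d \<in> cech_coboundaries R xs i +>\<^bsub>cocycle_module i\<^esub> ?c"
      using d by (simp add: coh_class_def coset_restrict)
    have dc: "d \<in> cech_cocycles R xs i" using B.a_elemrcos_carrier[OF c d'] by simp
    have eq: "coh_class i r n = cech_coboundaries R xs i +>\<^bsub>cech R xs i\<^esub> d"
      using B.a_repr_independence'[OF d' c] by (simp add: coh_class_def coset_restrict)
    obtain N where N: "\<And>n. n \<ge> N \<Longrightarrow> \<exists>r. (\<forall>J. r J \<in> carrier R) \<and> cocycle A i n r \<and> d = cochain i r n"
      using cocycle_exists[OF dc] by blast
    let ?m = "n + N"
    let ?r = "\<lambda>J. mpow J N \<otimes> r J"
    obtain s where s: "\<And>J. s J \<in> carrier R" "cocycle A i ?m s" "d = cochain i s ?m" using N[of ?m] by auto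
    have r': "?r J \<in> carrier R" for J using r by simp
    have cr: "cocycle A i ?m ?r" by (rule cocycle_mpow) (use r in auto)
    have "coh_class i ?r ?m = coh_class i s ?m"
      using eq coh_class_raise[of r i N n] r s(3) by (simp add: coh_class_def)
    then have "ev_bdry A i ?m (\<lambda>J. ?r J \<ominus> s J)" using coh_class_eq_iff[OF r' cr s(1,2)] by simp
    then have "ev_bdry A i (?m * p) (\<lambda>J. (?r J \<ominus> s J) [^] p)"
      using r' s(1) by (intro ev_bdry_frobenius) auto
    then have "ev_bdry A i (?m * p) (\<lambda>J. ?r J [^] p \<ominus> s J [^] p)"
      using r' s(1) by (simp add: frobenius_diff)
    then have "coh_class i (\<lambda>J. ?r J [^] p) (?m * p) = coh_class i (\<lambda>J. s J [^] p) (?m * p)"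
      using r' s(1,2) cr by (subst coh_class_eq_iff) (auto intro!: cocycle_frobenius)
    moreover have "cochain i (\<lambda>J. ?r J [^] p) (?m * p) = cochain i (\<lambda>J. r J [^] p) (n * p)"
      using cochain_pow[of ?r i ?m p, OF r'] cochain_pow[of r i n p, OF r(1)] cochain_raise[of r i N n, OF r(1)] by simp
    ultimately show ?thesis using s(1) by (simp add: coh_class_def s(3) cochain_pow)
  qed
  then show ?thesis unfolding cech_frobenius_def by (intro UN_constant[OF self])
qed

lemma coboundaries_in_cohomology:
  "cech_coboundaries R xs i \<in> carrier (cech_cohomology R xs i)"
  "cech_coboundaries R xs i = coh_class i (\<lambda>_. \<zero>) 0"
proof -
  have 1: "cocycle A i 0 (\<lambda>_. \<zero>)" by (auto simp: cocycle_def kdiff_def)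
  have "ev_bdry A i 0 (\<lambda>_. \<zero>)" by (rule ev_bdryI[of "\<lambda>_. \<zero>"]) (auto simp: kdiff_def)
  then show 2: "cech_coboundaries R xs i = coh_class i (\<lambda>_. \<zero>) 0"
    using coh_class_zero_iff[of "\<lambda>_. \<zero>" i 0] 1 by simp
  show "cech_coboundaries R xs i \<in> carrier (cech_cohomology R xs i)"
    unfolding 2 using 1 by (intro coh_class_closed) auto
qed

lemma frob_inj_of_cech_frobenius_inj:
  assumes inj: "inj_on (cech_frobenius p R xs i) (carrier (cech_cohomology R xs i))"
  shows "frob_inj A i"
  unfolding frob_inj_def
proof (intro allI impI)
  fix n r assume r: "\<forall>J. r J \<in> carrier R" and cocycle: "cocycle A i n r"
    and bd: "ev_bdry A i (n * p) (\<lambda>J. r J [^] p)"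
  let ?B = "cech_coboundaries R xs i"
  have r': "\<And>J. r J \<in> carrier R" using r by auto
  have "cech_frobenius p R xs i (coh_class i r n) = coh_class i (\<lambda>J. r J [^] p) (n * p)"
    by (rule cech_frobenius_coh_class[OF r' cocycle])
  also have "\<dots> = ?B"
    using bd coh_class_zero_iff[of "\<lambda>J. r J [^] p" i "n * p"] r' cocycle_frobenius[OF _ r' cocycle] by simp
  also have "\<dots> = cech_frobenius p R xs i ?B"
    unfolding coboundaries_in_cohomology(2)
    by (subst cech_frobenius_coh_class) (auto simp: cocycle_def kdiff_def)
  finally have "coh_class i r n = ?B"
    using inj_onD[OF inj] coh_class_closed[OF r' cocycle] coboundaries_in_cohomology(1) by blast
  then show "ev_bdry A i n r" using coh_class_zero_iff[OF r' cocycle] by simp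
qed

lemma cech_frobenius_smult_inj:
  assumes a: "a \<in> carrier R"
    and bd: "\<And>n r. \<lbrakk>\<And>J. r J \<in> carrier R; cocycle A i n r; ev_bdry A i (n * p) (\<lambda>J. a \<otimes> r J [^] p)\<rbrakk> \<Longrightarrow> ev_bdry A i n r"
  shows "inj_on (\<lambda>u. a \<odot>\<^bsub>cech_cohomology R xs i\<^esub> cech_frobenius p R xs i u)
    (carrier (cech_cohomology R xs i))"
proof (rule inj_onI)
  fix U V assume UV: "U \<in> carrier (cech_cohomology R xs i)" "V \<in> carrier (cech_cohomology R xs i)"
    and eq: "a \<odot>\<^bsub>cech_cohomology R xs i\<^esub> cech_frobenius p R xs i U =
      a \<odot>\<^bsub>cech_cohomology R xs i\<^esub> cech_frobenius p R xs i V"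
  obtain n r s where r: "\<And>J. r J \<in> carrier R" "cocycle A i n r" "U = coh_class i r n"
    and s: "\<And>J. s J \<in> carrier R" "cocycle A i n s" "V = coh_class i s n"
    using UV by (rule class_pair_obtain) blast
  have F: "a \<odot>\<^bsub>cech_cohomology R xs i\<^esub> cech_frobenius p R xs i (coh_class i t n) =
      coh_class i (\<lambda>J. a \<otimes> t J [^] p) (n * p)" if t: "\<And>J. t J \<in> carrier R" "cocycle A i n t" for t
    using cech_frobenius_coh_class[OF t] coh_class_smult[of "\<lambda>J. t J [^] p" i "n * p" a] t a
      cocycle_frobenius[OF _ t] by simp
  have "coh_class i (\<lambda>J. a \<otimes> r J [^] p) (n * p) = coh_class i (\<lambda>J. a \<otimes> s J [^] p) (n * p)"
    using eq F[OF r(1,2)] F[OF s(1,2)] r(3) s(3) by simp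
  then have *: "ev_bdry A i (n * p) (\<lambda>J. a \<otimes> r J [^] p \<ominus> a \<otimes> s J [^] p)"
    using r s a by (subst (asm) coh_class_eq_iff) (auto intro!: cocycle_smult cocycle_frobenius)
  have "(\<lambda>J. a \<otimes> r J [^] p \<ominus> a \<otimes> s J [^] p) = (\<lambda>J. a \<otimes> (r J \<ominus> s J) [^] p)"
    using r s a by (intro ext, subst frobenius_diff) (simp_all add: minus_eq r_distr r_minus)
  with * have **: "ev_bdry A i (n * p) (\<lambda>J. a \<otimes> (r J \<ominus> s J) [^] p)" by simp
  have "ev_bdry A i n (\<lambda>J. r J \<ominus> s J)"
    by (rule bd[OF _ cocycle_diff[OF r(1) s(1) r(2) s(2)] **]) (use r s in auto)
  then show "U = V" using coh_class_eq_iff[OF r(1,2) s(1,2)] r(3) s(3) by simp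
qed

end

section \<open>Reduction modulo a regular element\<close>

locale koszul_hom = ring_hom_cring R S h + koszul R f for R (structure) and S (structure) and h and f
begin

sublocale target: koszul S "\<lambda>j. h (f j)"
  by unfold_locales auto

lemma hom_kdiff:
  assumes "\<And>J. r J \<in> carrier R"
  shows "target.kdiff n (\<lambda>J. h (r J)) J = h (kdiff n r J)"
proof -
  have "h (face_sign J j) = target.face_sign J j" for J j by (simp add: face_sign_def target.face_sign_def)
  then show ?thesis
    unfolding kdiff_def target.kdiff_def using assms
    by (subst hom_finsum) (auto intro!: S.finsum_cong')
qed

lemma hom_mpow: "target.mpow J n = h (mpow J n)"
  unfolding mpow_def target.mpow_def by (subst hom_finprod) (auto intro!: S.finprod_cong')

end

locale deformation = cech_char_p R xs p for R (structure) and xs p +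
  fixes x
  assumes x_closed [simp, intro]: "x \<in> carrier R"
    and x_regular: "\<And>a. \<lbrakk>a \<in> carrier R; x \<otimes> a = \<zero>\<rbrakk> \<Longrightarrow> a = \<zero>"
begin

lemma x_cancel:
  assumes "a \<in> carrier R" "b \<in> carrier R" "x \<otimes> a = x \<otimes> b"
  shows "a = b"
proof -
  have "x \<otimes> (a \<ominus> b) = \<zero>" using assms by (simp add: minus_eq r_distr r_minus r_neg)
  then have "a \<ominus> b = \<zero>" by (rule x_regular[rotated]) (use assms(1,2) in simp)
  then show ?thesis using assms(1,2) by simp
qed

text \<open>The condition that the class of \<open>r\<close> vanishes in the cohomology of the quotient by \<open>x\<close>, phrased by lifts:
\<open>e\<close> lifts a primitive and \<open>x \<otimes> g J\<close> is the resulting error.\<close>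

definition bdry_mod_x :: "nat \<Rightarrow> nat \<Rightarrow> (nat set \<Rightarrow> 'a) \<Rightarrow> bool" where
  "bdry_mod_x i n r \<longleftrightarrow> (\<exists>k e g. (\<forall>J. e J \<in> carrier R) \<and> (\<forall>J. g J \<in> carrier R) \<and>
     (\<forall>J\<in>faces A i. mpow J k \<otimes> r J = kdiff (n + k) e J \<oplus> x \<otimes> g J))"

definition cocycle_mod_x :: "nat \<Rightarrow> nat \<Rightarrow> (nat set \<Rightarrow> 'a) \<Rightarrow> bool" where
  "cocycle_mod_x i n r \<longleftrightarrow> (\<forall>J\<in>faces A (Suc i). kdiff n r J \<in> PIdl x)"

lemma bdry_mod_xI:
  assumes "\<And>J. e J \<in> carrier R" "\<And>J. g J \<in> carrier R"
    "\<And>J. J \<in> faces A i \<Longrightarrow> mpow J k \<otimes> r J = kdiff (n + k) e J \<oplus> x \<otimes> g J"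
  shows "bdry_mod_x i n r"
  using assms unfolding bdry_mod_x_def by blast

lemma bdry_mod_xE:
  assumes "bdry_mod_x i n r"
  obtains k e g where "\<And>J. e J \<in> carrier R" "\<And>J. g J \<in> carrier R"
    "\<And>J. J \<in> faces A i \<Longrightarrow> mpow J k \<otimes> r J = kdiff (n + k) e J \<oplus> x \<otimes> g J"
  using assms unfolding bdry_mod_x_def by blast

lemma kdiff_mod_x:
  assumes e: "\<And>J. e J \<in> carrier R" and g: "\<And>J. g J \<in> carrier R" and J: "J \<in> faces A (Suc i)"
    and r: "\<And>K. K \<in> faces A i \<Longrightarrow> r K = kdiff n e K \<oplus> x \<otimes> g K"
  shows "kdiff n r J = x \<otimes> kdiff n g J"
proof -
  have fin: "finite J" using J by (auto intro: finite_faces)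
  have "kdiff n r J = kdiff n (\<lambda>K. kdiff n e K \<oplus> x \<otimes> g K) J"
    using r faces_remove[OF J] e g by (intro kdiff_cong) auto
  also have "\<dots> = kdiff n (kdiff n e) J \<oplus> x \<otimes> kdiff n g J"
    using e g by (simp add: kdiff_add kdiff_smult)
  finally show ?thesis using kdiff_kdiff[OF e fin] g by simp
qed

lemma bdry_mod_x_frobenius:
  assumes r: "\<And>J. r J \<in> carrier R" and bd: "bdry_mod_x i n r"
  shows "bdry_mod_x i (n * p) (\<lambda>J. r J [^] p)"
proof -
  obtain k e g where e: "\<And>J. e J \<in> carrier R" and g: "\<And>J. g J \<in> carrier R"
    and eq: "\<And>J. J \<in> faces A i \<Longrightarrow> mpow J k \<otimes> r J = kdiff (n + k) e J \<oplus> x \<otimes> g J"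
    using bd by (rule bdry_mod_xE) blast
  show ?thesis
  proof (rule bdry_mod_xI)
    fix J assume J: "J \<in> faces A i"
    then have fin: "finite J" by (auto intro: finite_faces)
    have "x [^] p = x \<otimes> x [^] (p - 1)"
      using prime_gt_0_nat[OF p_prime] by (metis Suc_pred' nat_pow_Suc2 x_closed)
    then have xg: "(x \<otimes> g J) [^] p = x \<otimes> (x [^] (p - 1) \<otimes> g J [^] p)"
      using g by (simp add: nat_pow_distrib m_assoc)
    have "mpow J (k * p) \<otimes> r J [^] p = (mpow J k \<otimes> r J) [^] p"
      using fin r by (simp add: nat_pow_distrib mpow_pow)
    also have "\<dots> = kdiff (n + k) e J [^] p \<oplus> (x \<otimes> g J) [^] p"
      unfolding eq[OF J] using e g kdiff_closed[OF e] by (intro frobenius_add) auto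
    also have "\<dots> = kdiff ((n + k) * p) (\<lambda>J. e J [^] p) J \<oplus> x \<otimes> (x [^] (p - 1) \<otimes> g J [^] p)"
      unfolding xg using kdiff_frobenius[OF e fin] by simp
    finally show "mpow J (k * p) \<otimes> r J [^] p =
        kdiff (n * p + k * p) (\<lambda>J. e J [^] p) J \<oplus> x \<otimes> (x [^] (p - 1) \<otimes> g J [^] p)"
      by (simp add: add_mult_distrib)
  qed (use e g in auto)
qed

text \<open>Exactness at the middle of \<open>H\<^sup>i(R) \<rightarrow> H\<^sup>i(R) \<rightarrow> H\<^sup>i(R/x)\<close>, where the first map is multiplication by
\<open>x\<close>: applying the differential to \<open>kdiff e + x g\<close> and cancelling the regular element \<open>x\<close> shows that \<open>g\<close> is
itself a cocycle.\<close>

lemma coh_class_multiple_of_x_iff: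
  assumes r: "\<And>J. r J \<in> carrier R" and cocycle: "cocycle A i n r"
  shows "coh_class i r n \<in> (\<lambda>u. x \<odot>\<^bsub>cech_cohomology R xs i\<^esub> u) ` carrier (cech_cohomology R xs i) \<longleftrightarrow> bdry_mod_x i n r"
proof
  let ?H = "cech_cohomology R xs i"
  assume "coh_class i r n \<in> (\<lambda>u. x \<odot>\<^bsub>?H\<^esub> u) ` carrier ?H"
  then obtain V where V: "V \<in> carrier ?H" "coh_class i r n = x \<odot>\<^bsub>?H\<^esub> V" by auto
  obtain m s where s: "\<And>J. s J \<in> carrier R" "cocycle A i m s" "V = coh_class i s m"
    using V(1) by (rule class_pair_obtain[of V _ V]) (use V in blast)+
  let ?r = "\<lambda>J. mpow J m \<otimes> r J" and ?s = "\<lambda>J. mpow J n \<otimes> s J"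
  have rc: "?r J \<in> carrier R" "?s J \<in> carrier R" "x \<otimes> ?s J \<in> carrier R" for J using r s(1) by auto
  have cr: "cocycle A i (n + m) ?r" by (rule cocycle_mpow) (use r cocycle in auto)
  have cs: "cocycle A i (m + n) ?s" by (rule cocycle_mpow) (use s in auto)
  then have cs: "cocycle A i (n + m) ?s" by (simp add: add.commute)
  have cxs: "cocycle A i (n + m) (\<lambda>J. x \<otimes> ?s J)" by (rule cocycle_smult) (use rc cs in auto)
  have "coh_class i ?r (n + m) = x \<odot>\<^bsub>?H\<^esub> coh_class i ?s (m + n)"
    using V(2) s(3) coh_class_raise[of r i m n] coh_class_raise[of s i n m] r s(1) by simp
  also have "\<dots> = coh_class i (\<lambda>J. x \<otimes> ?s J) (n + m)"
    using coh_class_smult[of ?s i "n + m" x] rc cs by (simp add: add.commute)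
  finally have "ev_bdry A i (n + m) (\<lambda>J. ?r J \<ominus> x \<otimes> ?s J)"
    using coh_class_eq_iff[of ?r i "n + m" "\<lambda>J. x \<otimes> ?s J", OF rc(1) cr rc(3) cxs] by simp
  then obtain k e where e: "\<And>J. e J \<in> carrier R"
    "\<And>J. J \<in> faces A i \<Longrightarrow> mpow J k \<otimes> (?r J \<ominus> x \<otimes> ?s J) = kdiff (n + m + k) e J" by (rule ev_bdryE) blast
  show "bdry_mod_x i n r"
  proof (rule bdry_mod_xI)
    fix J assume J: "J \<in> faces A i"
    have fin: "finite J" using J by (auto intro: finite_faces)
    have "?r J = (?r J \<ominus> x \<otimes> ?s J) \<oplus> x \<otimes> ?s J"
      using rc by (simp add: minus_eq a_assoc l_neg)
    then have "mpow J k \<otimes> ?r J = mpow J k \<otimes> (?r J \<ominus> x \<otimes> ?s J) \<oplus> mpow J k \<otimes> (x \<otimes> ?s J)"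
      using rc by (metis r_distr minus_closed mpow_closed)
    then have "mpow J k \<otimes> ?r J = kdiff (n + m + k) e J \<oplus> x \<otimes> (mpow J k \<otimes> ?s J)"
      unfolding e(2)[OF J] using s(1) by (simp add: m_lcomm)
    then show "mpow J (m + k) \<otimes> r J = kdiff (n + (m + k)) e J \<oplus> x \<otimes> (mpow J k \<otimes> ?s J)"
      using r by (simp add: mpow_add fin m_ac add.assoc)
  qed (use e rc in auto)
next
  let ?H = "cech_cohomology R xs i"
  assume "bdry_mod_x i n r"
  then obtain k e g where e: "\<And>J. e J \<in> carrier R" and g: "\<And>J. g J \<in> carrier R"
    and eq: "\<And>J. J \<in> faces A i \<Longrightarrow> mpow J k \<otimes> r J = kdiff (n + k) e J \<oplus> x \<otimes> g J"
    by (rule bdry_mod_xE) blast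
  let ?r = "\<lambda>J. mpow J k \<otimes> r J"
  have rc: "?r J \<in> carrier R" "x \<otimes> g J \<in> carrier R" for J using r g by auto
  have cr: "cocycle A i (n + k) ?r" by (rule cocycle_mpow) (use r cocycle in auto)
  have cg: "cocycle A i (n + k) g"
    unfolding cocycle_def
  proof
    fix J assume J: "J \<in> faces A (Suc i)"
    have "x \<otimes> kdiff (n + k) g J = kdiff (n + k) ?r J"
      by (rule kdiff_mod_x[OF e g J, symmetric]) (rule eq)
    then have "x \<otimes> kdiff (n + k) g J = \<zero>" using cr J by (simp add: cocycle_def)
    then show "kdiff (n + k) g J = \<zero>" by (rule x_regular[rotated]) (rule kdiff_closed, rule g)
  qed
  have cxg: "cocycle A i (n + k) (\<lambda>J. x \<otimes> g J)" by (rule cocycle_smult) (use g cg in auto)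
  have "?r J \<ominus> x \<otimes> g J = kdiff (n + k) e J" if J: "J \<in> faces A i" for J
    unfolding eq[OF J] using kdiff_closed[of e, OF e] g by (simp add: minus_eq a_assoc r_neg)
  then have "ev_bdry A i (n + k) (\<lambda>J. ?r J \<ominus> x \<otimes> g J)"
    using ev_bdry_kdiff[of e A i "n + k"] ev_bdry_cong[of A i "\<lambda>J. ?r J \<ominus> x \<otimes> g J" "kdiff (n + k) e"] e by blast
  then have "coh_class i ?r (n + k) = coh_class i (\<lambda>J. x \<otimes> g J) (n + k)"
    using coh_class_eq_iff[of ?r i "n + k" "\<lambda>J. x \<otimes> g J", OF rc(1) cr rc(2) cxg] by simp
  then have "coh_class i r n = x \<odot>\<^bsub>?H\<^esub> coh_class i g (n + k)"
    using coh_class_raise[of r i k n] coh_class_smult[of g i "n + k" x] r g cg by simp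
  then show "coh_class i r n \<in> (\<lambda>u. x \<odot>\<^bsub>?H\<^esub> u) ` carrier ?H"
    using coh_class_closed[OF g cg] by blast
qed

text \<open>The cokernel of \<open>x\<close> on \<open>H\<^sup>i(R)\<close> embeds into \<open>H\<^sup>i(R/x)\<close>, so Frobenius is injective on it, and by finite length
it is surjective: every class is the Frobenius image of a class modulo multiples of \<open>x\<close>. The level \<open>m\<close> of the
preimage can be taken arbitrarily large, which is what allows the levels to be matched in the application.\<close>

lemma frobenius_surjective_mod_x:
  assumes fl: "finite_length R (coker_mult (cech_cohomology R xs i) x)" and I: "ideal \<mm> R"
    and unit: "\<And>a. a \<in> \<mm> \<Longrightarrow> \<one> \<ominus> a \<in> Units R"
    and perfect: "\<And>a. a \<in> carrier R \<Longrightarrow> \<exists>b\<in>carrier R. a \<ominus> b [^] p \<in> \<mm>"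
    and inj: "\<And>n r. \<lbrakk>\<And>J. r J \<in> carrier R; cocycle A i n r; bdry_mod_x i (n * p) (\<lambda>J. r J [^] p)\<rbrakk> \<Longrightarrow> bdry_mod_x i n r"
    and z: "\<And>J. z J \<in> carrier R" "cocycle A i n z"
  shows "\<exists>N. \<forall>m\<ge>N. \<exists>w l. (\<forall>J. w J \<in> carrier R) \<and> cocycle A i m w \<and> n + l = m * p \<and>
    bdry_mod_x i (m * p) (\<lambda>J. mpow J l \<otimes> z J \<ominus> w J [^] p)"
proof -
  let ?H = "cech_cohomology R xs i" and ?Z = "cocycle_module i"
  let ?X = "(\<lambda>u. x \<odot>\<^bsub>?H\<^esub> u) ` carrier ?H"
  interpret H: module R ?H by (rule cech_cohomology_module)
  interpret Z: module R ?Z by (rule cocycle_module_module)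
  have X: "submodule ?X R ?H" by (rule H.smult_image_submodule) simp
  interpret Q: module R "coker_mult ?H x"
    unfolding coker_mult_def by (rule H.quot_module_module[OF X])
  define \<phi> where "\<phi> c = ?X +>\<^bsub>?H\<^esub> (cech_coboundaries R xs i +>\<^bsub>cech R xs i\<^esub> c)" for c
  have \<phi>_cochain: "\<phi> (cochain i r n) = ?X +>\<^bsub>?H\<^esub> coh_class i r n" for r n by (simp add: \<phi>_def coh_class_def)
  have \<phi>_zero: "\<phi> (cochain i r n) = \<zero>\<^bsub>coker_mult ?H x\<^esub> \<longleftrightarrow> bdry_mod_x i n r"
    if r: "\<And>J. r J \<in> carrier R" "cocycle A i n r" for r n
    unfolding \<phi>_cochain coker_mult_def H.quot_module_zero
    using H.coset_eq_zero_iff[OF X coh_class_closed[OF r]] coh_class_multiple_of_x_iff[OF r] by simp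
  define F where "F c = c [^]\<^bsub>cech R xs i\<^esub> p" for c
  have "\<exists>w\<in>carrier ?Z. \<phi> (F w) = \<phi> (cochain i z n)"
  proof (rule Q.frobenius_linear_surjective_along[of ?Z \<phi> \<mm> p F, OF Z.module_axioms _ _ _ fl I unit perfect])
    have "carrier ?H = (\<lambda>c. cech_coboundaries R xs i +>\<^bsub>cech R xs i\<^esub> c) ` cech_cocycles R xs i"
      using cohomology_carrier[of _ i] by auto
    then show "\<phi> ` carrier ?Z = carrier (coker_mult ?H x)"
      by (auto simp: coker_mult_def H.quot_module_carrier \<phi>_def)
    show "\<phi> (c \<oplus>\<^bsub>?Z\<^esub> d) = \<phi> c \<oplus>\<^bsub>coker_mult ?H x\<^esub> \<phi> d" "F (c \<oplus>\<^bsub>?Z\<^esub> d) = F c \<oplus>\<^bsub>?Z\<^esub> F d"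
      if "c \<in> carrier ?Z" "d \<in> carrier ?Z" for c d
    proof -
      have cd: "c \<in> cech_cocycles R xs i" "d \<in> cech_cocycles R xs i" using that by auto
      obtain n r s where r: "\<And>J. r J \<in> carrier R" "cocycle A i n r" "c = cochain i r n"
        and s: "\<And>J. s J \<in> carrier R" "cocycle A i n s" "d = cochain i s n"
        by (rule cocycle_pair_obtain[OF cd]) blast
      show "\<phi> (c \<oplus>\<^bsub>?Z\<^esub> d) = \<phi> c \<oplus>\<^bsub>coker_mult ?H x\<^esub> \<phi> d"
        using r s coh_class_add[OF r(1,2) s(1,2)] H.quot_module_add[OF X, of "coh_class i r n" "coh_class i s n"] coh_class_closed
        by (simp add: cochain_add \<phi>_cochain coker_mult_def)
      show "F (c \<oplus>\<^bsub>?Z\<^esub> d) = F c \<oplus>\<^bsub>?Z\<^esub> F d"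
        using r s by (simp add: F_def cochain_add cochain_pow frobenius_add)
    qed
    show "\<phi> (a \<odot>\<^bsub>?Z\<^esub> c) = a \<odot>\<^bsub>coker_mult ?H x\<^esub> \<phi> c" "F (a \<odot>\<^bsub>?Z\<^esub> c) = a [^] p \<odot>\<^bsub>?Z\<^esub> F c"
      if a: "a \<in> carrier R" and "c \<in> carrier ?Z" for a c
    proof -
      have c: "c \<in> cech_cocycles R xs i" using that by auto
      obtain n r where r: "\<And>J. r J \<in> carrier R" "cocycle A i n r" "c = cochain i r n"
        by (rule cocycle_obtain[OF c]) blast
      show "\<phi> (a \<odot>\<^bsub>?Z\<^esub> c) = a \<odot>\<^bsub>coker_mult ?H x\<^esub> \<phi> c"
        using r a coh_class_smult[OF r(1,2) a] H.quot_module_smult[OF X a, of "coh_class i r n"] coh_class_closed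
        by (simp add: cochain_smult \<phi>_cochain coker_mult_def)
      show "F (a \<odot>\<^bsub>?Z\<^esub> c) = a [^] p \<odot>\<^bsub>?Z\<^esub> F c"
        using r a by (simp add: F_def cochain_smult cochain_pow nat_pow_distrib)
    qed
    show "2 \<le> p" using prime_ge_2_nat[OF p_prime] .
    show "F c \<in> carrier ?Z" "\<phi> (F c) = \<zero>\<^bsub>coker_mult ?H x\<^esub> \<longleftrightarrow> \<phi> c = \<zero>\<^bsub>coker_mult ?H x\<^esub>"
      if "c \<in> carrier ?Z" for c
    proof -
      have c: "c \<in> cech_cocycles R xs i" using that by auto
      obtain n r where r: "\<And>J. r J \<in> carrier R" "cocycle A i n r" "c = cochain i r n"
        by (rule cocycle_obtain[OF c]) blast
      have rp: "\<And>J. r J [^] p \<in> carrier R" "cocycle A i (n * p) (\<lambda>J. r J [^] p)"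
        using r by (auto intro!: cocycle_frobenius)
      have Fc: "F (cochain i r n) = cochain i (\<lambda>J. r J [^] p) (n * p)" using r by (simp add: F_def cochain_pow)
      show "F c \<in> carrier ?Z" using cochain_is_cocycle[OF rp] by (simp add: Fc r(3))
      show "\<phi> (F c) = \<zero>\<^bsub>coker_mult ?H x\<^esub> \<longleftrightarrow> \<phi> c = \<zero>\<^bsub>coker_mult ?H x\<^esub>"
        unfolding r(3) Fc \<phi>_zero[of "\<lambda>J. r J [^] p", OF rp] \<phi>_zero[OF r(1,2)]
        using inj[OF r(1,2)] bdry_mod_x_frobenius[of r i n, OF r(1)] by blast
    qed
    show "cochain i z n \<in> carrier ?Z" using cochain_is_cocycle[OF z] by simp
  qed
  then obtain w where w: "w \<in> cech_cocycles R xs i" "\<phi> (F w) = \<phi> (cochain i z n)" by auto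
  obtain N where N: "\<And>m. m \<ge> N \<Longrightarrow> \<exists>r. (\<forall>J. r J \<in> carrier R) \<and> cocycle A i m r \<and> w = cochain i r m"
    using cocycle_exists[OF w(1)] by blast
  show ?thesis
  proof (rule exI[of _ "max N n"], intro allI impI)
    fix m assume m: "m \<ge> max N n"
    obtain r where r: "\<And>J. r J \<in> carrier R" "cocycle A i m r" "w = cochain i r m" using N[of m] m by auto
    have "n \<le> m * p" using m prime_gt_0_nat[OF p_prime] by (auto intro: order.trans[of _ m])
    then obtain l where l: "n + l = m * p" by (metis le_Suc_ex)
    let ?z = "\<lambda>J. mpow J l \<otimes> z J" and ?r = "\<lambda>J. r J [^] p"
    have zc: "?z J \<in> carrier R" "?r J \<in> carrier R" for J using z r by auto
    have "cocycle A i (n + l) ?z" by (rule cocycle_mpow) (use z in auto)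
    then have cz: "cocycle A i (m * p) ?z" by (simp add: l)
    have cr: "cocycle A i (m * p) ?r" using r by (intro cocycle_frobenius) auto
    have "?X +>\<^bsub>?H\<^esub> coh_class i ?z (m * p) = ?X +>\<^bsub>?H\<^esub> coh_class i ?r (m * p)"
      using w(2) r coh_class_raise[of z i l n] z by (simp add: F_def cochain_pow \<phi>_cochain l)
    then have "coh_class i ?z (m * p) \<ominus>\<^bsub>?H\<^esub> coh_class i ?r (m * p) \<in> ?X"
      using H.coset_eq_iff[OF X coh_class_closed[OF zc(1) cz] coh_class_closed[OF zc(2) cr]] by simp
    then have "coh_class i (\<lambda>J. ?z J \<ominus> ?r J) (m * p) \<in> ?X"
      using coh_class_minus[of ?z i "m * p" ?r, OF zc(1) cz zc(2) cr] by simp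
    then have "bdry_mod_x i (m * p) (\<lambda>J. ?z J \<ominus> ?r J)"
      using coh_class_multiple_of_x_iff[of "\<lambda>J. ?z J \<ominus> ?r J" i "m * p"] zc
        cocycle_diff[of ?z ?r, OF zc(1) zc(2) cz cr] by blast
    then show "\<exists>w l. (\<forall>J. w J \<in> carrier R) \<and> cocycle A i m w \<and> n + l = m * p \<and>
        bdry_mod_x i (m * p) (\<lambda>J. mpow J l \<otimes> z J \<ominus> w J [^] p)"
      using r l by blast
  qed
qed

text \<open>The diagram chase with the connecting map, for a class \<open>u\<close> killed by \<open>x\<close> and already written so that
\<open>x u\<close> is a boundary at its own level. The cochain \<open>v\<close> is a cocycle modulo \<open>x\<close>, and \<open>u\<close> is the image
of its class under the connecting map. The hypothesis \<open>surj\<close> is the conclusion of \<open>frobenius_surjective_mod_x\<close>, and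
\<open>inj\<close> says that Frobenius is injective on the cohomology of the quotient by \<open>x\<close>.\<close>

lemma connecting_step_aligned:
  assumes surj: "\<And>h n z. \<lbrakk>\<And>J. z J \<in> carrier R; cocycle A h n z\<rbrakk> \<Longrightarrow>
      \<exists>N. \<forall>m\<ge>N. \<exists>w l. (\<forall>J. w J \<in> carrier R) \<and> cocycle A h m w \<and> n + l = m * p \<and>
        bdry_mod_x h (m * p) (\<lambda>J. mpow J l \<otimes> z J \<ominus> w J [^] p)"
    and inj: "\<And>h n r. \<lbrakk>\<And>J. r J \<in> carrier R; cocycle_mod_x h n r; bdry_mod_x h (n * p) (\<lambda>J. r J [^] p)\<rbrakk> \<Longrightarrow> bdry_mod_x h n r"
    and u: "\<And>J. u J \<in> carrier R" and v: "\<And>J. v J \<in> carrier R"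
    and uv: "\<And>J. J \<in> faces A i \<Longrightarrow> x \<otimes> u J = kdiff n v J"
    and F: "ev_bdry A i (n * p) (\<lambda>J. x [^] (p - 1) \<otimes> u J [^] p)"
  shows "ev_bdry A i n u"
proof (cases i)
  case 0
  \<comment> \<open>In degree 0 the boundary \<open>kdiff n v\<close> is zero, and \<open>x\<close> is
    regular.\<close>
  have "u J = \<zero>" if J: "J \<in> faces A i" for J
  proof -
    have "J = {}" using J finite_J[OF faces_subset[OF J]] by (simp add: 0 faces_def)
    then have "x \<otimes> u J = \<zero>" using uv[OF J] by (simp add: kdiff_def)
    then show ?thesis using x_regular[OF u] by blast
  qed
  moreover have "kdiff m (\<lambda>_. \<zero>) J = \<zero>" for m J
    unfolding kdiff_def by (intro add.finprod_one_eqI) auto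
  ultimately show ?thesis by (intro ev_bdryI[of "\<lambda>_. \<zero>" _ _ 0]) auto
next
  case (Suc h)
  obtain k w where w: "\<And>J. w J \<in> carrier R"
    and kw: "\<And>J. J \<in> faces A i \<Longrightarrow> mpow J k \<otimes> (x [^] (p - 1) \<otimes> u J [^] p) = kdiff (n * p + k) w J"
    using F by (rule ev_bdryE) blast
  have xp: "x [^] p = x \<otimes> x [^] (p - 1)"
    using prime_gt_0_nat[OF p_prime] by (metis Suc_pred' nat_pow_Suc2 x_closed)
  \<comment> \<open>Since \<open>x\<^sup>p u\<^sup>p\<close> is both \<open>kdiff (v\<^sup>p)\<close> and
    \<open>x kdiff w\<close>, this is a cocycle over \<open>R\<close>; modulo \<open>x\<close> it is the
    Frobenius image of the class of \<open>v\<close>.\<close>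
  define z where "z J = mpow J k \<otimes> v J [^] p \<ominus> x \<otimes> w J" for J
  have zc: "z J \<in> carrier R" for J using v w by (simp add: z_def)
  have z: "cocycle A h (n * p + k) z"
    unfolding cocycle_def
  proof
    fix J assume "J \<in> faces A (Suc h)"
    then have J: "J \<in> faces A i" by (simp add: Suc)
    have fin: "finite J" using J by (auto intro: finite_faces)
    have "kdiff (n * p + k) (\<lambda>J. mpow J k \<otimes> v J [^] p) J = mpow J k \<otimes> kdiff n v J [^] p"
      using v fin kdiff_mpow[of "\<lambda>J. v J [^] p" J "n * p" k] kdiff_frobenius[OF v fin] by simp
    also have "\<dots> = x \<otimes> (mpow J k \<otimes> (x [^] (p - 1) \<otimes> u J [^] p))"
      unfolding uv[OF J, symmetric] using u by (simp add: nat_pow_distrib xp m_ac)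
    also have "\<dots> = kdiff (n * p + k) (\<lambda>J. x \<otimes> w J) J"
      unfolding kw[OF J] using w by (simp add: kdiff_smult)
    finally have eq: "kdiff (n * p + k) (\<lambda>J. mpow J k \<otimes> v J [^] p) J = kdiff (n * p + k) (\<lambda>J. x \<otimes> w J) J" .
    have "kdiff (n * p + k) z J =
        kdiff (n * p + k) (\<lambda>J. mpow J k \<otimes> v J [^] p) J \<ominus> kdiff (n * p + k) (\<lambda>J. x \<otimes> w J) J"
      unfolding z_def using v w by (intro kdiff_diff) auto
    also have "\<dots> = \<zero>" unfolding eq using w by (simp add: minus_eq r_neg)
    finally show "kdiff (n * p + k) z J = \<zero>" .
  qed
  obtain N where N: "\<And>m. m \<ge> N \<Longrightarrow> \<exists>w l. (\<forall>J. w J \<in> carrier R) \<and> cocycle A h m w \<and> n * p + k + l = m * p \<and>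
      bdry_mod_x h (m * p) (\<lambda>J. mpow J l \<otimes> z J \<ominus> w J [^] p)"
    using surj[of z, OF zc z] by blast
  \<comment> \<open>The preimage under Frobenius is taken at a level at least that of \<open>v\<close>, so
    that the two can be subtracted.\<close>
  define m where "m = n + N"
  obtain y l where y: "\<And>J. y J \<in> carrier R" "cocycle A h m y" and l: "n * p + k + l = m * p"
    and zy: "bdry_mod_x h (m * p) (\<lambda>J. mpow J l \<otimes> z J \<ominus> y J [^] p)"
    using N[of m] by (auto simp: m_def)
  have kl: "k + l = N * p" using l by (simp add: m_def add_mult_distrib)
  \<comment> \<open>The difference of \<open>v\<close> and the preimage: a cocycle modulo \<open>x\<close>
    whose Frobenius image vanishes modulo \<open>x\<close>.\<close>
  define q where "q J = mpow J N \<otimes> v J \<ominus> y J" for J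
  have qc: "q J \<in> carrier R" for J using v y by (simp add: q_def)
  have kdiff_q: "kdiff m q J = x \<otimes> (mpow J N \<otimes> u J)" if J: "J \<in> faces A i" for J
  proof -
    have fin: "finite J" using J by (auto intro: finite_faces)
    have "kdiff m q J = kdiff m (\<lambda>J. mpow J N \<otimes> v J) J \<ominus> kdiff m y J"
      unfolding q_def using v y by (intro kdiff_diff) auto
    also have "kdiff m y J = \<zero>" using y(2) J by (simp add: cocycle_def Suc)
    also have "kdiff m (\<lambda>J. mpow J N \<otimes> v J) J = mpow J N \<otimes> (x \<otimes> u J)"
      unfolding uv[OF J] m_def using v fin by (intro kdiff_mpow) auto
    finally show ?thesis using u by (simp add: minus_eq m_lcomm)
  qed
  have "cocycle_mod_x h m q"
    unfolding cocycle_mod_x_def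
  proof
    fix J assume "J \<in> faces A (Suc h)"
    then have "kdiff m q J = (mpow J N \<otimes> u J) \<otimes> x" using kdiff_q u by (simp add: Suc m_comm)
    then show "kdiff m q J \<in> PIdl x" unfolding cgenideal_def using u by blast
  qed
  moreover have "bdry_mod_x h (m * p) (\<lambda>J. q J [^] p)"
  proof -
    obtain c e g where e: "\<And>J. e J \<in> carrier R" and g: "\<And>J. g J \<in> carrier R"
      and eq: "\<And>J. J \<in> faces A h \<Longrightarrow> mpow J c \<otimes> (mpow J l \<otimes> z J \<ominus> y J [^] p) = kdiff (m * p + c) e J \<oplus> x \<otimes> g J"
      using zy by (rule bdry_mod_xE) blast
    let ?g = "\<lambda>J. g J \<oplus> mpow J c \<otimes> (mpow J l \<otimes> w J)"
    show ?thesis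
    proof (rule bdry_mod_xI)
      fix J assume J: "J \<in> faces A h"
      have fin: "finite J" using J by (auto intro: finite_faces)
      have "mpow J l \<otimes> z J = mpow J l \<otimes> (mpow J k \<otimes> v J [^] p) \<ominus> x \<otimes> (mpow J l \<otimes> w J)"
        unfolding z_def using v w by (simp add: minus_eq r_distr r_minus m_lcomm)
      also have "mpow J l \<otimes> (mpow J k \<otimes> v J [^] p) = (mpow J N \<otimes> v J) [^] p"
        using v by (simp add: nat_pow_distrib mpow_pow[OF fin] kl[symmetric] mpow_add[OF fin] m_ac)
      finally have lz: "mpow J l \<otimes> z J = (mpow J N \<otimes> v J) [^] p \<ominus> x \<otimes> (mpow J l \<otimes> w J)" .
      have qp: "q J [^] p = (mpow J N \<otimes> v J) [^] p \<ominus> y J [^] p"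
        unfolding q_def using v y by (intro frobenius_diff) auto
      have cl: "(mpow J N \<otimes> v J) [^] p \<in> carrier R" "y J [^] p \<in> carrier R" "mpow J l \<otimes> w J \<in> carrier R"
        using v y w by auto
      have shift: "a \<ominus> b = (a \<ominus> c \<ominus> b) \<oplus> c" if "a \<in> carrier R" "b \<in> carrier R" "c \<in> carrier R" for a b c
        using that by algebra
      have "q J [^] p = (mpow J l \<otimes> z J \<ominus> y J [^] p) \<oplus> x \<otimes> (mpow J l \<otimes> w J)"
        unfolding lz qp by (rule shift) (use cl in auto)
      then have "mpow J c \<otimes> q J [^] p =
          mpow J c \<otimes> (mpow J l \<otimes> z J \<ominus> y J [^] p) \<oplus> mpow J c \<otimes> (x \<otimes> (mpow J l \<otimes> w J))"
        using cl zc by (simp add: r_distr)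
      also have "\<dots> = kdiff (m * p + c) e J \<oplus> x \<otimes> ?g J"
        unfolding eq[OF J] using cl(3) g kdiff_closed[of e, OF e] by (simp add: r_distr a_assoc m_lcomm)
      finally show "mpow J c \<otimes> q J [^] p = kdiff (m * p + c) e J \<oplus> x \<otimes> ?g J" .
    qed (use e g w in auto)
  qed
  ultimately have "bdry_mod_x h m q" by (rule inj[OF qc])
  then obtain c e g where e: "\<And>J. e J \<in> carrier R" and g: "\<And>J. g J \<in> carrier R"
    and eq: "\<And>J. J \<in> faces A h \<Longrightarrow> mpow J c \<otimes> q J = kdiff (m + c) e J \<oplus> x \<otimes> g J"
    by (rule bdry_mod_xE) blast
  show ?thesis
  proof (rule ev_bdryI)
    fix J assume J: "J \<in> faces A i"
    have fin: "finite J" using J by (auto intro: finite_faces)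
    have "x \<otimes> (mpow J (N + c) \<otimes> u J) = mpow J c \<otimes> kdiff m q J"
      unfolding kdiff_q[OF J] using u by (simp add: mpow_add[OF fin] m_ac)
    also have "\<dots> = kdiff (m + c) (\<lambda>J. mpow J c \<otimes> q J) J" by (rule kdiff_mpow[symmetric, OF qc fin])
    also have "\<dots> = x \<otimes> kdiff (m + c) g J"
      by (rule kdiff_mod_x[OF e g J[unfolded Suc] eq])
    finally have *: "x \<otimes> (mpow J (N + c) \<otimes> u J) = x \<otimes> kdiff (m + c) g J" .
    have "mpow J (N + c) \<otimes> u J = kdiff (m + c) g J"
      by (rule x_cancel[OF _ kdiff_closed[of g, OF g] *]) (use u in simp)
    then show "mpow J (N + c) \<otimes> u J = kdiff (n + (N + c)) g J" by (simp add: m_def add.assoc)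
  qed (rule g)
qed

lemma ev_bdry_frobenius_raise:
  assumes u: "\<And>J. u J \<in> carrier R" and a: "a \<in> carrier R"
    and F: "ev_bdry A i (n * p) (\<lambda>J. a \<otimes> u J [^] p)"
  shows "ev_bdry A i ((n + k) * p) (\<lambda>J. a \<otimes> (mpow J k \<otimes> u J) [^] p)"
proof -
  have "ev_bdry A i (n * p + k * p) (\<lambda>J. mpow J (k * p) \<otimes> (a \<otimes> u J [^] p))"
    using F u a by (subst ev_bdry_mpow) auto
  moreover have "mpow J (k * p) \<otimes> (a \<otimes> u J [^] p) = a \<otimes> (mpow J k \<otimes> u J) [^] p" if "J \<in> faces A i" for J
    using u a finite_J[OF faces_subset[OF that]] by (simp add: nat_pow_distrib mpow_pow m_lcomm)
  ultimately show ?thesis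
    using ev_bdry_cong[of A i "\<lambda>J. mpow J (k * p) \<otimes> (a \<otimes> u J [^] p)" "\<lambda>J. a \<otimes> (mpow J k \<otimes> u J) [^] p"]
    by (simp add: add_mult_distrib)
qed

lemma frobenius_deformation:
  assumes surj: "\<And>h n z. \<lbrakk>\<And>J. z J \<in> carrier R; cocycle A h n z\<rbrakk> \<Longrightarrow>
      \<exists>N. \<forall>m\<ge>N. \<exists>w l. (\<forall>J. w J \<in> carrier R) \<and> cocycle A h m w \<and> n + l = m * p \<and>
        bdry_mod_x h (m * p) (\<lambda>J. mpow J l \<otimes> z J \<ominus> w J [^] p)"
    and inj: "\<And>h n r. \<lbrakk>\<And>J. r J \<in> carrier R; cocycle_mod_x h n r; bdry_mod_x h (n * p) (\<lambda>J. r J [^] p)\<rbrakk> \<Longrightarrow> bdry_mod_x h n r"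
    and x: "x \<in> Idl (gen ` A)"
    and u: "\<And>J. u J \<in> carrier R" "cocycle A i n u"
    and F: "ev_bdry A i (n * p) (\<lambda>J. x [^] (p - 1) \<otimes> u J [^] p)"
  shows "ev_bdry A i n u"
proof -
  have step: "ev_bdry A i n s"
    if s: "\<And>J. s J \<in> carrier R" and xs: "ev_bdry A i n (\<lambda>J. x \<otimes> s J)"
      and Fs: "ev_bdry A i (n * p) (\<lambda>J. x [^] (p - 1) \<otimes> s J [^] p)" for s
  proof -
    obtain k e where e: "\<And>J. e J \<in> carrier R"
      and k: "\<And>J. J \<in> faces A i \<Longrightarrow> mpow J k \<otimes> (x \<otimes> s J) = kdiff (n + k) e J"
      using xs by (rule ev_bdryE) blast
    let ?s = "\<lambda>J. mpow J k \<otimes> s J"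
    have sc: "?s J \<in> carrier R" for J using s by simp
    have se: "x \<otimes> ?s J = kdiff (n + k) e J" if "J \<in> faces A i" for J
      using k[OF that] s by (simp add: m_lcomm)
    have "ev_bdry A i ((n + k) * p) (\<lambda>J. x [^] (p - 1) \<otimes> ?s J [^] p)"
      by (rule ev_bdry_frobenius_raise[OF s _ Fs]) simp
    with surj inj sc e se have "ev_bdry A i (n + k) ?s" by (rule connecting_step_aligned)
    then show ?thesis using ev_bdry_mpow[of A s i n k] s by simp
  qed
  \<comment> \<open>Descent along the powers of \<open>x\<close> that multiply \<open>u\<close>, starting from
    one that kills the class of \<open>u\<close>.\<close>
  have power: "ev_bdry A i n s \<Longrightarrow> ev_bdry A i n u" if "s = (\<lambda>J. x [^] (t::nat) \<otimes> u J)" for s t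
    using that
  proof (induction t arbitrary: s)
    case 0
    then show ?case using u by simp
  next
    case (Suc t)
    let ?s = "\<lambda>J. x [^] t \<otimes> u J"
    have "(\<lambda>J. x \<otimes> ?s J) = s" using u by (simp add: Suc.prems(2) m_ac)
    then have 1: "ev_bdry A i n (\<lambda>J. x \<otimes> ?s J)" using Suc.prems(1) by simp
    have "ev_bdry A i (n * p) (\<lambda>J. (x [^] t) [^] p \<otimes> (x [^] (p - 1) \<otimes> u J [^] p))"
      by (rule ev_bdry_smult[OF _ _ F]) (use u in auto)
    also have "(\<lambda>J. (x [^] t) [^] p \<otimes> (x [^] (p - 1) \<otimes> u J [^] p)) = (\<lambda>J. x [^] (p - 1) \<otimes> ?s J [^] p)"
      using u by (simp add: nat_pow_distrib m_lcomm)
    finally have 2: "ev_bdry A i (n * p) (\<lambda>J. x [^] (p - 1) \<otimes> ?s J [^] p)" .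
    have "ev_bdry A i n ?s" by (rule step[OF _ 1 2]) (use u in simp)
    then show ?case by (rule Suc.IH) simp
  qed
  have "\<exists>q e. (\<forall>J. e J \<in> carrier R) \<and> (\<forall>J. \<not> {} \<subseteq> J \<longrightarrow> e J = \<zero>) \<and>
      (\<forall>J\<in>faces A i. x [^] (q::nat) \<otimes> u J = kdiff n e J)"
    by (rule power_kills_cocycle[OF u(1) _ u(2)]) (use x in auto)
  then obtain q e where e: "\<forall>J. e J \<in> carrier R" "\<forall>J\<in>faces A i. x [^] (q::nat) \<otimes> u J = kdiff n e J"
    by blast
  have "ev_bdry A i n (\<lambda>J. x [^] q \<otimes> u J)"
    by (rule ev_bdryI[of e _ _ 0]) (use e u in auto)
  then show ?thesis by (rule power[OF refl])
qed

text \<open>Numerators over the quotient lift to \<open>R\<close>, so vanishing of a class over the quotient is the same as \<open>bdry_mod_x\<close>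
for any lift.\<close>

lemma inj_mod_x_of_quotient:
  assumes F: "koszul_char_p.frob_inj (R Quot PIdl x) (\<lambda>j. PIdl x +> gen j) p A h"
    and r: "\<And>J. r J \<in> carrier R" and cocycle: "cocycle_mod_x h n r" and bd: "bdry_mod_x h (n * p) (\<lambda>J. r J [^] p)"
  shows "bdry_mod_x h n r"
proof -
  let ?S = "R Quot PIdl x" and ?\<pi> = "\<lambda>a. PIdl x +> a"
  interpret I: ideal "PIdl x" R by (rule cgenideal_ideal) simp
  have zero: "?\<pi> a = \<zero>\<^bsub>?S\<^esub> \<longleftrightarrow> a \<in> PIdl x" if a: "a \<in> carrier R" for a
  proof
    assume "?\<pi> a = \<zero>\<^bsub>?S\<^esub>"
    then show "a \<in> PIdl x" using I.a_rcos_self[OF a] by (simp add: FactRing_def)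
  next
    assume "a \<in> PIdl x"
    then show "?\<pi> a = \<zero>\<^bsub>?S\<^esub>" by (simp add: FactRing_def I.a_rcos_const)
  qed
  interpret \<pi>: ring_hom_cring R ?S ?\<pi> by (rule I.rcos_ring_hom_cring[OF is_cring])
  interpret K: koszul_hom R ?S ?\<pi> gen
    by (intro koszul_hom.intro \<pi>.ring_hom_cring_axioms koszul_axioms)
  have "[p] \<cdot>\<^bsub>?S\<^esub> \<one>\<^bsub>?S\<^esub> = ?\<pi> ([p] \<cdot> \<one>)"
    by (induction p) auto
  then have p1: "[p] \<cdot>\<^bsub>?S\<^esub> \<one>\<^bsub>?S\<^esub> = \<zero>\<^bsub>?S\<^esub>" by (simp add: p_one)
  interpret T: koszul_char_p ?S "\<lambda>j. ?\<pi> (gen j)" p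
    by (intro koszul_char_p.intro K.target.koszul_axioms char_p_ring.intro char_p_ring_axioms.intro
      I.quotient_is_cring is_cring p_prime p1)
  have \<pi>x: "?\<pi> (x \<otimes> a) = \<zero>\<^bsub>?S\<^esub>" if "a \<in> carrier R" for a
    using I.I_r_closed[OF cgenideal_self[OF x_closed] that] zero[of "x \<otimes> a"] that by blast
  have c: "K.target.cocycle A h n (\<lambda>J. ?\<pi> (r J))"
    unfolding K.target.cocycle_def
  proof
    fix J assume "J \<in> faces A (Suc h)"
    then have "kdiff n r J \<in> PIdl x" using cocycle by (simp add: cocycle_mod_x_def)
    then show "K.target.kdiff n (\<lambda>J. ?\<pi> (r J)) J = \<zero>\<^bsub>?S\<^esub>"
      using K.hom_kdiff[of r, OF r] zero[OF kdiff_closed[of r, OF r]] by simp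
  qed
  obtain k e g where e: "\<And>J. e J \<in> carrier R" and g: "\<And>J. g J \<in> carrier R"
    and eq: "\<And>J. J \<in> faces A h \<Longrightarrow> mpow J k \<otimes> r J [^] p = kdiff (n * p + k) e J \<oplus> x \<otimes> g J"
    using bd by (rule bdry_mod_xE) blast
  have b: "K.target.ev_bdry A h (n * p) (\<lambda>J. ?\<pi> (r J) [^]\<^bsub>?S\<^esub> p)"
  proof (rule K.target.ev_bdryI)
    fix J assume J: "J \<in> faces A h"
    have "K.target.mpow J k \<otimes>\<^bsub>?S\<^esub> ?\<pi> (r J) [^]\<^bsub>?S\<^esub> p = ?\<pi> (mpow J k \<otimes> r J [^] p)"
      using r by (simp add: K.hom_mpow ring_hom_ring.hom_nat_pow[OF I.rcos_ring_hom_ring])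
    also have "\<dots> = ?\<pi> (kdiff (n * p + k) e J)"
      unfolding eq[OF J] using kdiff_closed[of e, OF e] g \<pi>x by simp
    also have "\<dots> = K.target.kdiff (n * p + k) (\<lambda>J. ?\<pi> (e J)) J"
      using K.hom_kdiff[of e, OF e] by simp
    finally show "K.target.mpow J k \<otimes>\<^bsub>?S\<^esub> ?\<pi> (r J) [^]\<^bsub>?S\<^esub> p = K.target.kdiff (n * p + k) (\<lambda>J. ?\<pi> (e J)) J" .
  qed (use e in auto)
  have "K.target.ev_bdry A h n (\<lambda>J. ?\<pi> (r J))" by (rule T.frob_injD[OF F _ c b]) (use r in auto)
  then obtain l e' where e': "\<And>J. e' J \<in> carrier ?S"
    and eq': "\<And>J. J \<in> faces A h \<Longrightarrow> K.target.mpow J l \<otimes>\<^bsub>?S\<^esub> ?\<pi> (r J) = K.target.kdiff (n + l) e' J"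
    by (rule K.target.ev_bdryE) blast
  have "\<exists>a\<in>carrier R. e' J = ?\<pi> a" for J
    using e'[of J] by (auto simp: FactRing_def A_RCOSETS_def' a_r_coset_def')
  then obtain d where d: "\<And>J. d J \<in> carrier R" "\<And>J. e' J = ?\<pi> (d J)" by metis
  have "\<exists>b\<in>carrier R. mpow J l \<otimes> r J = kdiff (n + l) d J \<oplus> x \<otimes> b" if J: "J \<in> faces A h" for J
  proof -
    have c: "mpow J l \<otimes> r J \<in> carrier R" "kdiff (n + l) d J \<in> carrier R" using r kdiff_closed[of d, OF d(1)] by auto
    have "e' = (\<lambda>J. ?\<pi> (d J))" using d(2) by auto
    then have "?\<pi> (mpow J l \<otimes> r J) = ?\<pi> (kdiff (n + l) d J)"
      using eq'[OF J] r K.hom_kdiff[of d, OF d(1)] by (simp add: K.hom_mpow)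
    then have "?\<pi> (mpow J l \<otimes> r J \<ominus> kdiff (n + l) d J) = \<zero>\<^bsub>?S\<^esub>"
      using c by (simp add: minus_eq \<pi>.S.r_neg del: \<pi>.hom_mult)
    then have "mpow J l \<otimes> r J \<ominus> kdiff (n + l) d J \<in> PIdl x"
      using zero[OF minus_closed[OF c]] by blast
    then obtain b where b: "b \<in> carrier R" "mpow J l \<otimes> r J \<ominus> kdiff (n + l) d J = b \<otimes> x"
      unfolding cgenideal_def by blast
    have "mpow J l \<otimes> r J = kdiff (n + l) d J \<oplus> (mpow J l \<otimes> r J \<ominus> kdiff (n + l) d J)"
      using c by algebra
    then have "mpow J l \<otimes> r J = kdiff (n + l) d J \<oplus> x \<otimes> b"
      unfolding b(2) using m_comm[OF b(1) x_closed] by argo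
    then show ?thesis using b(1) by blast
  qed
  then obtain b where b: "\<And>J. J \<in> faces A h \<Longrightarrow> b J \<in> carrier R \<and> mpow J l \<otimes> r J = kdiff (n + l) d J \<oplus> x \<otimes> b J"
    by metis
  show ?thesis
    by (rule bdry_mod_xI[of d "\<lambda>J. if J \<in> faces A h then b J else \<zero>" _ l]) (use d b in auto)
qed

end

section \<open>Characteristic and quotients\<close>

text \<open>The characteristic is the additive order of the unit element.\<close>

lemma (in ring) multiple_one_eq_zero_iff: "[(n::nat)] \<cdot> \<one> = \<zero> \<longleftrightarrow> ring_char R dvd n"
proof -
  define d where "d = group.ord (add_monoid R) \<one>"
  have eq: "[n] \<cdot> \<one> = \<zero> \<longleftrightarrow> d dvd n" for n :: nat
    using group.pow_eq_id[OF a_group, of \<one> n] by (simp add: add_pow_def d_def)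
  have "Gcd {n. d dvd n} = d"
    by (rule dvd_antisym) (auto intro: Gcd_greatest)
  then have "ring_char R = d" unfolding ring_char_def eq by simp
  then show ?thesis using eq by simp
qed

lemma quotient_coset_zero_iff:
  assumes "ideal I R" "a \<in> carrier R"
  shows "I +>\<^bsub>R\<^esub> a = \<zero>\<^bsub>R Quot I\<^esub> \<longleftrightarrow> a \<in> I"
proof -
  interpret ideal I R by (rule assms(1))
  have "\<zero>\<^bsub>R Quot I\<^esub> = I" by (simp add: FactRing_def)
  then show ?thesis using a_rcos_const[of a] a_rcos_self[OF assms(2)] by metis
qed

lemma quotient_ring_char:
  assumes R: "cring R" and p: "Factorial_Ring.prime (p :: nat)" "ring_char R = p"
    and I: "ideal I R" "\<one>\<^bsub>R\<^esub> \<notin> I"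
  shows "ring_char (R Quot I) = p"
proof -
  interpret R: cring R by (rule R)
  interpret I: ideal I R by (rule I(1))
  interpret S: ring "R Quot I" by (rule I.quotient_is_ring)
  interpret \<pi>: ring_hom_ring R "R Quot I" "\<lambda>a. I +>\<^bsub>R\<^esub> a" by (rule I.rcos_ring_hom_ring)
  have "[n] \<cdot>\<^bsub>R Quot I\<^esub> \<one>\<^bsub>R Quot I\<^esub> = I +>\<^bsub>R\<^esub> ([n] \<cdot>\<^bsub>R\<^esub> \<one>\<^bsub>R\<^esub>)" for n :: nat
    by (induction n) auto
  then have "ring_char (R Quot I) dvd p"
    using R.multiple_one_eq_zero_iff[of p] p(2) by (simp add: S.multiple_one_eq_zero_iff[symmetric])
  moreover have "ring_char (R Quot I) \<noteq> 1"
  proof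
    assume "ring_char (R Quot I) = 1"
    then have "\<one>\<^bsub>R Quot I\<^esub> = \<zero>\<^bsub>R Quot I\<^esub>"
      using S.multiple_one_eq_zero_iff[of 1] by simp
    then have "I +>\<^bsub>R\<^esub> \<one>\<^bsub>R\<^esub> = \<zero>\<^bsub>R Quot I\<^esub>" using \<pi>.hom_one by metis
    then show False using quotient_coset_zero_iff[OF I(1) R.one_closed] I(2) by blast
  qed
  ultimately show ?thesis using p(1) by (auto simp: prime_nat_iff)
qed

lemma quotient_carrier: "carrier (R Quot I) = (\<lambda>a. I +>\<^bsub>R\<^esub> a) ` carrier R"
  by (auto simp: FactRing_def A_RCOSETS_def' a_r_coset_def')

lemma perfect_residue_field:
  assumes R: "cring R" and p: "Factorial_Ring.prime (p :: nat)" "ring_char R = p"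
    and M: "maximalideal M R" and perf: "perfect_field (R Quot M)" and a: "a \<in> carrier R"
  shows "\<exists>b\<in>carrier R. a \<ominus>\<^bsub>R\<^esub> b [^]\<^bsub>R\<^esub> p \<in> M"
proof -
  interpret R: cring R by (rule R)
  interpret M: maximalideal M R by (rule M)
  interpret \<pi>: ring_hom_ring R "R Quot M" "\<lambda>a. M +>\<^bsub>R\<^esub> a" by (rule M.rcos_ring_hom_ring)
  have "\<one>\<^bsub>R\<^esub> \<notin> M" using M.I_notcarr M.one_imp_carrier by auto
  then have "ring_char (R Quot M) = p" by (intro quotient_ring_char[OF R p M.ideal_axioms])
  then have "\<exists>B\<in>carrier (R Quot M). B [^]\<^bsub>R Quot M\<^esub> p = M +>\<^bsub>R\<^esub> a"
    using perf a p(1) by (auto simp: perfect_field_def)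
  then obtain b where b: "b \<in> carrier R" "(M +>\<^bsub>R\<^esub> b) [^]\<^bsub>R Quot M\<^esub> p = M +>\<^bsub>R\<^esub> a"
    unfolding quotient_carrier by blast
  then have "M +>\<^bsub>R\<^esub> (b [^]\<^bsub>R\<^esub> p) = M +>\<^bsub>R\<^esub> a" by (simp add: \<pi>.hom_nat_pow)
  then have "a \<in> M +>\<^bsub>R\<^esub> (b [^]\<^bsub>R\<^esub> p)" using M.a_rcos_self[OF a] by simp
  then have "a \<ominus>\<^bsub>R\<^esub> b [^]\<^bsub>R\<^esub> p \<in> M"
    using M.a_rcos_module_minus[OF R.ring_axioms, of "b [^]\<^bsub>R\<^esub> p" a] a b(1) by simp
  then show ?thesis using b(1) by blast
qed

context noetherian_local_ring
begin

context
  fixes I assumes I: "ideal I R" "I \<subseteq> maximal_ideal R"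
begin

interpretation I: ideal I R by (rule I(1))
interpretation \<mm>: maximalideal "maximal_ideal R" R by (rule maximal_ideal_maximalideal)

text \<open>Any proper ideal of the quotient has a proper preimage, which lies in the maximal ideal of the ring; so the image of the
maximal ideal contains every proper ideal.\<close>

lemma quotient_maximal_ideal:
  "maximal_ideal (R Quot I) = (\<lambda>a. I +> a) ` maximal_ideal R" (is "_ = ?\<pi> ` ?\<mm>")
proof -
  let ?S = "R Quot I"
  interpret \<pi>: ring_hom_ring R ?S ?\<pi> by (rule I.rcos_ring_hom_ring)
  have img: "ideal (?\<pi> ` ?\<mm>) ?S" by (rule ring_ideal_imp_quot_ideal[OF I(1) \<mm>.ideal_axioms])
  \<comment> \<open>The maximal ideal is saturated with respect to the quotient map, because it contains
    \<open>I\<close>.\<close>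
  have mem: "a \<in> ?\<mm>" if a: "a \<in> carrier R" "?\<pi> a \<in> ?\<pi> ` ?\<mm>" for a
  proof -
    obtain b where b: "b \<in> ?\<mm>" "?\<pi> a = ?\<pi> b" using a(2) by blast
    have "a \<in> I +> b" using I.a_rcos_self[OF a(1)] b(2) by simp
    then have "a \<ominus> b \<in> ?\<mm>"
      using I.a_rcos_module_minus[OF ring_axioms, of b a] a(1) b(1) I(2) \<mm>.a_Hcarr by blast
    then have "(a \<ominus> b) \<oplus> b \<in> ?\<mm>" using b(1) by (rule \<mm>.a_closed)
    then show ?thesis using a(1) \<mm>.a_Hcarr[OF b(1)] by (simp add: minus_eq a_assoc l_neg)
  qed
  have one: "\<one> \<notin> ?\<mm>" using \<mm>.I_notcarr \<mm>.one_imp_carrier by auto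
  have proper: "J \<subseteq> ?\<pi> ` ?\<mm>" if J: "ideal J ?S" "J \<noteq> carrier ?S" for J
  proof -
    let ?P = "{r \<in> carrier R. ?\<pi> r \<in> J}"
    have P: "ideal ?P R" by (rule \<pi>.ideal_vimage[OF J(1)])
    have "\<one> \<notin> ?P"
    proof
      assume "\<one> \<in> ?P"
      then have "\<one>\<^bsub>?S\<^esub> \<in> J" by simp
      then show False using ideal.one_imp_carrier[OF J(1)] J(2) by simp
    qed
    then have "?P \<subseteq> ?\<mm>" by (rule proper_ideal_subset_maximal[OF P])
    moreover have "J \<subseteq> ?\<pi> ` ?P"
    proof
      fix B assume B: "B \<in> J"
      have "J \<subseteq> carrier ?S" using ideal.axioms(1)[OF J(1)] additive_subgroup.a_subset by blast
      then obtain b where "b \<in> carrier R" "B = ?\<pi> b" using B unfolding quotient_carrier by blast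
      then show "B \<in> ?\<pi> ` ?P" using B by blast
    qed
    ultimately show ?thesis by blast
  qed
  have not_all: "carrier ?S \<noteq> ?\<pi> ` ?\<mm>"
  proof
    assume "carrier ?S = ?\<pi> ` ?\<mm>"
    then have "?\<pi> \<one> \<in> ?\<pi> ` ?\<mm>" using quotient_carrier[of R I] by blast
    then show False using mem[of \<one>] one by simp
  qed
  have max: "maximalideal (?\<pi> ` ?\<mm>) ?S"
  proof (rule maximalidealI[OF img not_all])
    fix J assume "ideal J ?S" "?\<pi> ` ?\<mm> \<subseteq> J"
    then show "J = ?\<pi> ` ?\<mm> \<or> J = carrier ?S" using proper by blast
  qed
  have uniq: "N = ?\<pi> ` ?\<mm>" if N: "maximalideal N ?S" for N
  proof -
    interpret N: maximalideal N ?S by (rule N)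
    have "N \<subseteq> ?\<pi> ` ?\<mm>" using proper[OF N.ideal_axioms] N.I_notcarr by blast
    moreover have "?\<pi> ` ?\<mm> \<subseteq> carrier ?S"
      using \<mm>.a_subset unfolding quotient_carrier by blast
    ultimately show ?thesis using N.I_maximal[OF img] not_all by blast
  qed
  show ?thesis unfolding maximal_ideal_def[of ?S] using max uniq by (rule the_equality)
qed

lemma quotient_generators:
  assumes xs: "set xs \<subseteq> carrier R" "Idl (set xs) = maximal_ideal R"
  shows "Idl\<^bsub>R Quot I\<^esub> (set (map (\<lambda>a. I +> a) xs)) = maximal_ideal (R Quot I)"
    (is "Idl\<^bsub>?S\<^esub> ?X = _")
proof -
  let ?\<pi> = "\<lambda>a. I +> a"
  interpret S: ring ?S by (rule I.quotient_is_ring)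
  interpret \<pi>: ring_hom_ring R ?S ?\<pi> by (rule I.rcos_ring_hom_ring)
  have X: "?X \<subseteq> carrier ?S" using xs(1) unfolding quotient_carrier by auto
  have "ideal (?\<pi> ` maximal_ideal R) ?S" by (rule ring_ideal_imp_quot_ideal[OF I(1) \<mm>.ideal_axioms])
  moreover have "?X \<subseteq> ?\<pi> ` maximal_ideal R" using genideal_self[OF xs(1)] xs(2) by auto
  ultimately have 1: "Idl\<^bsub>?S\<^esub> ?X \<subseteq> ?\<pi> ` maximal_ideal R" by (rule S.genideal_minimal)
  let ?P = "{r \<in> carrier R. ?\<pi> r \<in> Idl\<^bsub>?S\<^esub> ?X}"
  have "ideal ?P R" by (rule \<pi>.ideal_vimage[OF S.genideal_ideal[OF X]])
  moreover have "set xs \<subseteq> ?P" using xs(1) S.genideal_self[OF X] by auto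
  ultimately have "maximal_ideal R \<subseteq> ?P" using genideal_minimal[of ?P "set xs"] xs(2) by simp
  then have "?\<pi> ` maximal_ideal R \<subseteq> Idl\<^bsub>?S\<^esub> ?X" by blast
  then show ?thesis using 1 quotient_maximal_ideal by simp
qed

end

lemma maximal_ideal_generated: "\<exists>xs. set xs \<subseteq> carrier R \<and> Idl (set xs) = maximal_ideal R"
proof -
  interpret \<mm>: maximalideal "maximal_ideal R" R by (rule maximal_ideal_maximalideal)
  obtain B where B: "B \<subseteq> carrier R" "finite B" "maximal_ideal R = Idl B"
    using finetely_gen[OF \<mm>.ideal_axioms] by blast
  obtain xs where "set xs = B" using finite_list[OF B(2)] by blast
  then show ?thesis using B by auto
qed

end

section \<open>Independence of the generators\<close>

lemma ideal_gens_spec: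
  assumes "\<exists>xs. set xs \<subseteq> carrier R \<and> Idl\<^bsub>R\<^esub> (set xs) = I"
  shows "set (ideal_gens R I) \<subseteq> carrier R" "Idl\<^bsub>R\<^esub> (set (ideal_gens R I)) = I"
  using someI_ex[OF assms] unfolding ideal_gens_def by auto

lemma (in cech_ring) gen_image: "gen ` A = set xs"
  by (auto simp: gen_def set_conv_nth image_iff)

text \<open>Both lists are compared with their concatenation, which is obtained from either by adding redundant generators.\<close>

lemma frob_inj_change_generators:
  assumes S: "char_p_ring S p" and xs: "set xs \<subseteq> carrier S" and ys: "set ys \<subseteq> carrier S"
    and eq: "Idl\<^bsub>S\<^esub> (set xs) = Idl\<^bsub>S\<^esub> (set ys)"
    and F: "koszul_char_p.frob_inj S (cech_ring.gen S ys) p {..<length ys} i"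
  shows "koszul_char_p.frob_inj S (cech_ring.gen S xs) p {..<length xs} i"
proof -
  interpret S: char_p_ring S p by (rule S)
  have char_p: "cech_char_p S zs p" if "set zs \<subseteq> carrier S" for zs
    using that by (intro cech_char_p.intro cech_ring.intro cech_ring_axioms.intro S.is_cring S)
  interpret X: cech_char_p S xs p by (rule char_p[OF xs])
  interpret Y: cech_char_p S ys p by (rule char_p[OF ys])
  interpret Z: cech_char_p S "xs @ ys" p by (rule char_p) (use xs ys in auto)
  let ?m = "length xs"
  let ?B = "{..<?m}" and ?C = "(+) ?m ` {..<length ys}"
  have ZX: "Z.gen j = X.gen j" if "j < ?m" for j
    using that by (simp add: Z.gen_def X.gen_def nth_append)
  have ZY: "Z.gen (?m + j) = Y.gen j" for j
    by (simp add: Z.gen_def Y.gen_def)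
  have imB: "Z.gen ` ?B = set xs" unfolding X.gen_image[symmetric] using ZX by (intro image_cong) auto
  have imC: "Z.gen ` ?C = set ys" unfolding Y.gen_image[symmetric] image_image using ZY by simp
  have inB: "Z.gen j \<in> Idl\<^bsub>S\<^esub> (set ys)" if "j \<in> ?B" for j
    using that imB S.genideal_self[OF xs] eq by blast
  have inC: "Z.gen j \<in> Idl\<^bsub>S\<^esub> (set xs)" if "j \<in> ?C" for j
    using that imC S.genideal_self[OF ys] eq by blast
  have "Z.frob_inj ?C i"
    using F Z.frob_inj_shift[of Y.gen "{..<length ys}" ?m i] ZY Y.f_closed by simp
  then have "Z.frob_inj (?C \<union> ?B) i"
    using Z.frob_inj_union[of ?B ?C i] inB unfolding imC by simp
  then have "Z.frob_inj (?B \<union> ?C) i" by (simp add: Un_commute)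
  then have "Z.frob_inj ?B i"
    using Z.frob_inj_union[of ?C ?B i] inC unfolding imB by simp
  then show ?thesis
    using Z.frob_inj_shift[of X.gen ?B 0 i] ZX X.f_closed by simp
qed

section \<open>Deformation of F-injectivity\<close>

theorem theorem1p2:
  fixes R :: "('a, 'b) ring_scheme" (structure)
    and p :: nat and x :: 'a
  assumes "noetherian_local_ring R"
    and "Factorial_Ring.prime p" and "ring_char R = p"
    and "perfect_field (R Quot maximal_ideal R)"
    and "regular_element R x"
    and "\<forall>i. finite_length R (coker_mult (local_cohomology R (maximal_ideal R) i) x)"
    and "F_injective (R Quot (PIdl x))"
  shows "(\<forall>i. inj_on
            (\<lambda>u. (x [^] (p - 1)) \<odot>\<^bsub>local_cohomology R (maximal_ideal R) i\<^esub>
                   lc_frobenius p R (maximal_ideal R) i u)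
            (carrier (local_cohomology R (maximal_ideal R) i)))
       \<and> F_injective R"
proof -
  interpret noetherian_local_ring R by (rule assms(1))
  let ?\<mm> = "maximal_ideal R" and ?S = "R Quot (PIdl x)"
  let ?\<pi> = "\<lambda>a. PIdl x +> a"
  interpret \<mm>: maximalideal ?\<mm> R by (rule maximal_ideal_maximalideal)
  have one: "\<one> \<notin> ?\<mm>" using \<mm>.I_notcarr \<mm>.one_imp_carrier by auto
  have x\<mm>: "x \<in> ?\<mm>" using assms(5) by (simp add: regular_element_def)
  have xR: "x \<in> carrier R" using \<mm>.a_Hcarr[OF x\<mm>] .
  have I: "ideal (PIdl x) R" by (rule cgenideal_ideal[OF xR])
  have I\<mm>: "PIdl x \<subseteq> ?\<mm>" by (rule cgenideal_minimal[OF \<mm>.ideal_axioms x\<mm>])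
  define xs where "xs = ideal_gens R ?\<mm>"
  define ys where "ys = ideal_gens ?S (maximal_ideal ?S)"
  note xs = ideal_gens_spec[OF maximal_ideal_generated, folded xs_def]
  have p1: "[p] \<cdot> \<one> = \<zero>" using multiple_one_eq_zero_iff[of p] assms(3) by simp
  interpret deformation R xs p x
  proof (intro deformation.intro cech_char_p.intro cech_ring.intro cech_ring_axioms.intro
      char_p_ring.intro char_p_ring_axioms.intro deformation_axioms.intro is_cring)
    show "a = \<zero>" if "a \<in> carrier R" "x \<otimes> a = \<zero>" for a
      using assms(5) that by (simp add: regular_element_def)
  qed (use xs assms(2) p1 xR in auto)
  have \<pi>xs: "set (map ?\<pi> xs) \<subseteq> carrier ?S"
    using xs(1) unfolding quotient_carrier by auto
  have \<pi>xs_gen: "Idl\<^bsub>?S\<^esub> (set (map ?\<pi> xs)) = maximal_ideal ?S"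
    by (rule quotient_generators[OF I I\<mm> xs])
  have ys: "set ys \<subseteq> carrier ?S" "Idl\<^bsub>?S\<^esub> (set ys) = maximal_ideal ?S"
    using ideal_gens_spec[of ?S "maximal_ideal ?S"] \<pi>xs \<pi>xs_gen unfolding ys_def by blast+
  have S_cring: "cring ?S" by (rule ideal.quotient_is_cring[OF I is_cring])
  interpret S: cring ?S by (rule S_cring)
  have "\<one> \<notin> PIdl x" using I\<mm> one by blast
  then have S_char: "ring_char ?S = p" by (rule quotient_ring_char[OF is_cring assms(2,3) I])
  have S: "char_p_ring ?S p"
    using S.multiple_one_eq_zero_iff[of p] S_char assms(2)
    by (intro char_p_ring.intro char_p_ring_axioms.intro S_cring) auto
  interpret Y: cech_char_p ?S ys p
    by (intro cech_char_p.intro cech_ring.intro cech_ring_axioms.intro S_cring S ys(1))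
  have gens: "cech_ring.gen ?S (map ?\<pi> xs) = (\<lambda>j. ?\<pi> (gen j))"
  proof -
    have c: "cech_ring ?S (map ?\<pi> xs)"
      using \<pi>xs by (intro cech_ring.intro cech_ring_axioms.intro S_cring)
    have "?\<pi> \<zero> = \<zero>\<^bsub>?S\<^esub>" using quotient_coset_zero_iff[OF I zero_closed] ideal.axioms(1)[OF I]
      by (simp add: additive_subgroup.zero_closed)
    then show ?thesis by (intro ext) (simp add: cech_ring.gen_def[OF c] gen_def)
  qed
  have frob_inj: "koszul_char_p.frob_inj ?S (\<lambda>j. ?\<pi> (gen j)) p A h" for h
  proof -
    have "Y.frob_inj {..<length ys} h"
      using assms(7) S_char
      by (intro Y.frob_inj_of_cech_frobenius_inj)
        (simp add: F_injective_def lc_frobenius_def local_cohomology_def ys_def)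
    then show ?thesis
      using frob_inj_change_generators[OF S \<pi>xs ys(1), of h] \<pi>xs_gen ys(2) gens by simp
  qed
  have quot_inj: "bdry_mod_x h n r"
    if "\<And>J. r J \<in> carrier R" "cocycle_mod_x h n r" "bdry_mod_x h (n * p) (\<lambda>J. r J [^] p)" for h n r
    by (rule inj_mod_x_of_quotient[OF frob_inj that])
  have cocycle_cocycle_mod_x: "cocycle_mod_x h n r" if "cocycle A h n r" for h n r
    using that additive_subgroup.zero_closed[OF ideal.axioms(1)[OF I]]
    by (simp add: cocycle_mod_x_def cocycle_def)
  have surj: "\<exists>N. \<forall>m\<ge>N. \<exists>w l. (\<forall>J. w J \<in> carrier R) \<and> cocycle A h m w \<and> n + l = m * p \<and>
      bdry_mod_x h (m * p) (\<lambda>J. mpow J l \<otimes> z J \<ominus> w J [^] p)"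
    if z: "\<And>J. z J \<in> carrier R" "cocycle A h n z" for h n z
  proof (rule frobenius_surjective_mod_x[OF _ \<mm>.ideal_axioms one_minus_maximal_unit _ _ z])
    show "finite_length R (coker_mult (cech_cohomology R xs h) x)"
      using assms(6) by (simp add: local_cohomology_def xs_def)
    show "\<exists>b\<in>carrier R. a \<ominus> b [^] p \<in> ?\<mm>" if "a \<in> carrier R" for a
      by (rule perfect_residue_field[OF is_cring assms(2,3) \<mm>.is_maximalideal assms(4) that])
    show "bdry_mod_x h n r" if "\<And>J. r J \<in> carrier R" "cocycle A h n r" "bdry_mod_x h (n * p) (\<lambda>J. r J [^] p)" for n r
      by (rule quot_inj[OF that(1) cocycle_cocycle_mod_x[OF that(2)] that(3)])
  qed
  have x_gen: "x \<in> Idl (gen ` A)" using x\<mm> xs(2) by (simp add: gen_image)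
  have main: "inj_on
      (\<lambda>u. (x [^] (p - 1)) \<odot>\<^bsub>local_cohomology R ?\<mm> i\<^esub> lc_frobenius p R ?\<mm> i u)
      (carrier (local_cohomology R ?\<mm> i))" for i
    unfolding local_cohomology_def lc_frobenius_def xs_def[symmetric]
  proof (rule cech_frobenius_smult_inj)
    show "ev_bdry A i n u"
      if "\<And>J. u J \<in> carrier R" "cocycle A i n u" "ev_bdry A i (n * p) (\<lambda>J. x [^] (p - 1) \<otimes> u J [^] p)" for n u
      by (rule frobenius_deformation[OF surj quot_inj x_gen that])
  qed simp
  have "F_injective R"
    unfolding F_injective_def assms(3)
  proof
    fix i
    show "inj_on (lc_frobenius p R ?\<mm> i) (carrier (local_cohomology R ?\<mm> i))"
      using main[of i] by (auto simp: inj_on_def)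
  qed
  then show ?thesis using main by blast
qed

end
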